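(* Let $p$ be a prime, let $H$ be a finite group of order prime to $p$, let $\gamma$ be a nonnegative integer, and let $F_\gamma$ be a free pro-$p$-group with $\gamma$ generators, endowed with a continuous action of $H$. Let $P$ be a finite $p$-group endowed with an action of $H$. The following assertions are equivalent: (i) There exists a continuous $H$-epimorphism $F_\gamma \twoheadrightarrow P$. (ii) For all $\mathcal V \in \mathcal S_{\mathbb F_p[H]}$, $\dim_{\mathbb F_p} H^1(P \rtimes H, \mathcal V) \leq \delta_{\mathcal V}$.
   Context: Actions of $H$ on groups are by group automorphisms, and an $H$-epimorphism is a surjective $H$-equivariant group homomorphism. $\mathcal S_{\mathbb F_p[H]}$ is a set of representatives of the isomorphism classes of simple $\mathbb F_p[H]$-modules (finitely generated). For $\mathcal V\in\mathcal S_{\mathbb F_p[H]}$, $$\delta_{\mathcal V}:=\dim_{\mathbb F_p}H^1(F_\gamma\rtimes H,\mathcal V),$$ where the cohomology is continuous and $\mathcal V$ is viewed as a discrete $F_\gamma\rtimes H$-module via the canonical projection $F_\gamma\rtimes H\twoheadrightarrow H$; these dimensions are finite. Similarly $\mathcal V$ is a $P\rtimes H$-module via the canonical projection $P\rtimes H\twoheadrightarrow H$. *)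

theory Defs
  imports
    "HOL-Analysis.Abstract_Topological_Spaces"
    "HOL-Algebra.Group_Action"
    "HOL-Number_Theory.Residues"
    "Jordan_Normal_Form.Missing_VectorSpace"
begin

section \<open>Pro-\<open>p\<close> groups\<close>

locale topological_group = group G for G (structure) and T +
  assumes topspace_eq_carrier: "topspace T = carrier G"
    and continuous_mult: "continuous_map (prod_topology T T) T (\<lambda>(x, y). x \<otimes> y)"
    and continuous_inv: "continuous_map T T (\<lambda>x. inv x)"

locale pro_p_group = topological_group G T for p :: nat and G (structure) and T +
  assumes compact: "compact_space T"
    and Hausdorff: "Hausdorff_space T"
    and open_subgroup_basis:
      "\<lbrakk>openin T U; \<one> \<in> U\<rbrakk> \<Longrightarrow> \<exists>N. subgroup N G \<and> openin T N \<and> N \<subseteq> U"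
    and index_power: "\<lbrakk>N \<lhd> G; openin T N\<rbrakk> \<Longrightarrow> \<exists>k. card (rcosets N) = p ^ k"

definition continuous_homs ::
  "'a monoid \<Rightarrow> 'a topology \<Rightarrow> 'b monoid \<Rightarrow> 'b topology \<Rightarrow> ('a \<Rightarrow> 'b) set" where
  "continuous_homs G T G' T' = {f \<in> hom G G'. continuous_map T T' f}"

text \<open>
  The pro-\<open>p\<close> groups against which the universal property is tested live on subsets of
  \<^typ>\<open>nat set\<close>. This is no restriction: the test only concerns the closed subgroup generated
  by the finitely many elements \<open>y i\<close>, and a topologically finitely generated pro-\<open>p\<close> group has
  at most the cardinality of the continuum. Uniqueness is stated for extensional functions,
  that is, for functions on the carrier of \<open>F\<close>.
\<close>
definition free_pro_p_group :: "nat \<Rightarrow> nat \<Rightarrow> 'a monoid \<Rightarrow> 'a topology \<Rightarrow> bool" where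
  "free_pro_p_group p \<gamma> F T \<longleftrightarrow>
     pro_p_group p F T \<and>
     (\<exists>x \<in> {..<\<gamma>} \<rightarrow> carrier F.
        \<forall>(G :: nat set monoid) TG. \<forall>y \<in> {..<\<gamma>} \<rightarrow> carrier G. pro_p_group p G TG \<longrightarrow>
          (\<exists>!f. f \<in> continuous_homs F T G TG \<and> f \<in> extensional (carrier F) \<and>
                (\<forall>i<\<gamma>. f (x i) = y i)))"


section \<open>Group actions and semidirect products\<close>

abbreviation acts_by_automorphisms ::
  "'h monoid \<Rightarrow> 'a monoid \<Rightarrow> ('h \<Rightarrow> 'a \<Rightarrow> 'a) \<Rightarrow> bool" where
  "acts_by_automorphisms H G \<phi> \<equiv> \<phi> \<in> hom H (AutoGroup G)"

text \<open>The acting group carries the discrete topology.\<close>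
definition continuous_action ::
  "'h monoid \<Rightarrow> 'a topology \<Rightarrow> ('h \<Rightarrow> 'a \<Rightarrow> 'a) \<Rightarrow> bool" where
  "continuous_action H T \<phi> \<longleftrightarrow>
     continuous_map (prod_topology (discrete_topology (carrier H)) T) T (\<lambda>(h, x). \<phi> h x)"

definition semidirect_product ::
  "'a monoid \<Rightarrow> 'h monoid \<Rightarrow> ('h \<Rightarrow> 'a \<Rightarrow> 'a) \<Rightarrow> ('a \<times> 'h) monoid" where
  "semidirect_product G H \<phi> =
     \<lparr>carrier = carrier G \<times> carrier H,
      monoid.mult = (\<lambda>(x, h) (y, k). (x \<otimes>\<^bsub>G\<^esub> \<phi> h y, h \<otimes>\<^bsub>H\<^esub> k)),
      one = (\<one>\<^bsub>G\<^esub>, \<one>\<^bsub>H\<^esub>)\<rparr>"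

abbreviation semidirect_topology ::
  "'a topology \<Rightarrow> 'h monoid \<Rightarrow> ('a \<times> 'h) topology" where
  "semidirect_topology T H \<equiv> prod_topology T (discrete_topology (carrier H))"


section \<open>Modules over group algebras\<close>

text \<open>
  A module over the group algebra \<open>K[G]\<close>, given as a \<open>K\<close>-module together with a \<open>K\<close>-linear
  action of \<open>G\<close>.
\<close>
locale group_algebra_module =
  M?: module K V + A?: group_action G "carrier V" \<rho>
  for K :: "('k, 'm) ring_scheme" and G :: "'g monoid" and V :: "('k, 'v) module" and \<rho> +
  assumes linear: "g \<in> carrier G \<Longrightarrow> \<rho> g \<in> module_hom K V V"

definition group_algebra_submodule ::
  "('k, 'm) ring_scheme \<Rightarrow> 'g monoid \<Rightarrow> 'v set \<Rightarrow> ('k, 'v) module \<Rightarrow> ('g \<Rightarrow> 'v \<Rightarrow> 'v) \<Rightarrow> bool"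
where
  "group_algebra_submodule K G W V \<rho> \<longleftrightarrow>
     submodule K W V \<and> (\<forall>g \<in> carrier G. \<rho> g ` W \<subseteq> W)"

definition simple_group_algebra_module ::
  "('k, 'm) ring_scheme \<Rightarrow> 'g monoid \<Rightarrow> ('k, 'v) module \<Rightarrow> ('g \<Rightarrow> 'v \<Rightarrow> 'v) \<Rightarrow> bool" where
  "simple_group_algebra_module K G V \<rho> \<longleftrightarrow>
     group_algebra_module K G V \<rho> \<and> carrier V \<noteq> {\<zero>\<^bsub>V\<^esub>} \<and>
     (\<forall>W. group_algebra_submodule K G W V \<rho> \<longrightarrow> W = {\<zero>\<^bsub>V\<^esub>} \<or> W = carrier V)"

definition fin_gen_group_algebra_module ::
  "('k, 'm) ring_scheme \<Rightarrow> 'g monoid \<Rightarrow> ('k, 'v) module \<Rightarrow> ('g \<Rightarrow> 'v \<Rightarrow> 'v) \<Rightarrow> bool" where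
  "fin_gen_group_algebra_module K G V \<rho> \<longleftrightarrow>
     group_algebra_module K G V \<rho> \<and>
     (\<exists>A. finite A \<and> A \<subseteq> carrier V \<and>
        (\<forall>W. group_algebra_submodule K G W V \<rho> \<and> A \<subseteq> W \<longrightarrow> W = carrier V))"

definition isomorphic_group_algebra_modules ::
  "('k, 'm) ring_scheme \<Rightarrow> 'g monoid \<Rightarrow> ('k, 'v) module \<times> ('g \<Rightarrow> 'v \<Rightarrow> 'v) \<Rightarrow>
     ('k, 'w) module \<times> ('g \<Rightarrow> 'w \<Rightarrow> 'w) \<Rightarrow> bool" where
  "isomorphic_group_algebra_modules K G = (\<lambda>(V, \<rho>) (W, \<sigma>).
     \<exists>f \<in> module_hom K V W. bij_betw f (carrier V) (carrier W) \<and>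
       (\<forall>g \<in> carrier G. \<forall>v \<in> carrier V. f (\<rho> g v) = \<sigma> g (f v)))"

text \<open>
  Modules on subsets of \<^typ>\<open>nat\<close> suffice when \<open>K\<close> and \<open>G\<close> are finite, because finitely
  generated modules are then finite.
\<close>
definition simple_module_representatives ::
  "('k, 'm) ring_scheme \<Rightarrow> 'g monoid \<Rightarrow>
     (('k, nat) module \<times> ('g \<Rightarrow> nat \<Rightarrow> nat)) set \<Rightarrow> bool" where
  "simple_module_representatives K G S \<longleftrightarrow>
     (\<forall>(V, \<rho>) \<in> S. simple_group_algebra_module K G V \<rho> \<and> fin_gen_group_algebra_module K G V \<rho>) \<and>
     (\<forall>(V :: ('k, nat) module) \<rho>. simple_group_algebra_module K G V \<rho> \<and> fin_gen_group_algebra_module K G V \<rho> \<longrightarrow>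
        (\<exists>!M. M \<in> S \<and> isomorphic_group_algebra_modules K G (V, \<rho>) M))"


section \<open>Continuous cohomology in degree one\<close>

text \<open>
  The scalar multiple of a coset \<open>C = N + x\<close> by \<open>a\<close> is written as \<open>N + a C\<close>, since \<open>a C\<close>
  itself is not a coset when \<open>a = 0\<close>. The multiplicative fields of a module record play no role.
\<close>
definition quotient_module :: "('k, 'v) module \<Rightarrow> 'v set \<Rightarrow> ('k, 'v set) module" where
  "quotient_module M N =
     \<lparr>carrier = a_rcosets\<^bsub>M\<^esub> N,
      monoid.mult = (\<lambda>_ _. N), one = N, ring.zero = N,
      ring.add = AbelCoset.set_add M,
      smult = (\<lambda>a C. AbelCoset.set_add M N ((\<lambda>x. a \<odot>\<^bsub>M\<^esub> x) ` C))\<rparr>"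

text \<open>
  Coefficient modules are discrete. A group without topology is treated as a discrete group,
  for which this is ordinary group cohomology.
\<close>
definition cocycles1 ::
  "'g monoid \<Rightarrow> 'g topology \<Rightarrow> ('k, 'v) module \<Rightarrow> ('g \<Rightarrow> 'v \<Rightarrow> 'v) \<Rightarrow> ('g \<Rightarrow> 'v) set" where
  "cocycles1 G T V \<rho> =
     {f \<in> carrier G \<rightarrow>\<^sub>E carrier V.
        continuous_map T (discrete_topology (carrier V)) f \<and>
        (\<forall>g \<in> carrier G. \<forall>h \<in> carrier G. f (g \<otimes>\<^bsub>G\<^esub> h) = f g \<oplus>\<^bsub>V\<^esub> \<rho> g (f h))}"

definition coboundaries1 ::
  "'g monoid \<Rightarrow> ('k, 'v) module \<Rightarrow> ('g \<Rightarrow> 'v \<Rightarrow> 'v) \<Rightarrow> ('g \<Rightarrow> 'v) set" where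
  "coboundaries1 G V \<rho> = {\<lambda>g \<in> carrier G. \<rho> g v \<ominus>\<^bsub>V\<^esub> v | v. v \<in> carrier V}"

definition cocycle_module ::
  "'g monoid \<Rightarrow> 'g topology \<Rightarrow> ('k, 'v) module \<Rightarrow> ('g \<Rightarrow> 'v \<Rightarrow> 'v) \<Rightarrow> ('k, 'g \<Rightarrow> 'v) module" where
  "cocycle_module G T V \<rho> =
     \<lparr>carrier = cocycles1 G T V \<rho>,
      monoid.mult = (\<lambda>_ _. \<lambda>g \<in> carrier G. \<zero>\<^bsub>V\<^esub>),
      one = (\<lambda>g \<in> carrier G. \<zero>\<^bsub>V\<^esub>),
      ring.zero = (\<lambda>g \<in> carrier G. \<zero>\<^bsub>V\<^esub>),
      ring.add = (\<lambda>f f'. \<lambda>g \<in> carrier G. f g \<oplus>\<^bsub>V\<^esub> f' g),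
      smult = (\<lambda>a f. \<lambda>g \<in> carrier G. a \<odot>\<^bsub>V\<^esub> f g)\<rparr>"

definition H1 ::
  "'g monoid \<Rightarrow> 'g topology \<Rightarrow> ('k, 'v) module \<Rightarrow> ('g \<Rightarrow> 'v \<Rightarrow> 'v) \<Rightarrow> ('k, ('g \<Rightarrow> 'v) set) module"
where
  "H1 G T V \<rho> = quotient_module (cocycle_module G T V \<rho>) (coboundaries1 G V \<rho>)"

text \<open>
  The dimension over \<open>K\<close> of \<open>H\<^sup>1(G \<rtimes> H, V)\<close>, where the \<open>H\<close>-module \<open>V\<close> is inflated along the
  projection \<open>snd\<close> from the semidirect product to \<open>H\<close>.
\<close>
definition dim_H1_semidirect ::
  "('k, 'm) ring_scheme \<Rightarrow> 'a monoid \<Rightarrow> 'a topology \<Rightarrow> 'h monoid \<Rightarrow> ('h \<Rightarrow> 'a \<Rightarrow> 'a) \<Rightarrow>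
     ('k, 'v) module \<Rightarrow> ('h \<Rightarrow> 'v \<Rightarrow> 'v) \<Rightarrow> nat" where
  "dim_H1_semidirect K G T H \<phi> V \<rho> =
     vectorspace.dim K
       (H1 (semidirect_product G H \<phi>) (semidirect_topology T H) V (\<rho> \<circ> snd))"

end

theory Submission
  imports Defs "HOL-Algebra.Weak_Morphisms"
begin

text \<open>
  Write \<open>Hom\<^sub>H(G, V)\<close> for the continuous \<open>H\<close>-equivariant homomorphisms from \<open>G\<close> to the additive group of
  an \<open>\<bbbF>\<^sub>p[H]\<close>-module \<open>V\<close>. Both groups \<open>G = P\<close> and \<open>G = F\<close> act trivially on \<open>V\<close>, so restricting a cocycle
  of \<open>G \<rtimes> H\<close> to \<open>G\<close> gives an element of \<open>Hom\<^sub>H(G, V)\<close>. Conversely every such homomorphism inflates to a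
  cocycle, and a cocycle that vanishes on \<open>G\<close> comes from \<open>H\<close>, where it is a coboundary, because one can
  average over a group of order prime to \<open>p\<close>. Hence \<open>Hom\<^sub>H(G, V)\<close> has \<open>p\<^sup>d\<close> elements with \<open>d = dim H\<^sup>1(G \<rtimes> H, V)\<close>
  (\<open>card_equivariant_homs\<close>), and the inequality of dimensions says that
  \<open>Hom\<^sub>H(P, V)\<close> has at most as many elements as \<open>Hom\<^sub>H(F, V)\<close>.

  An epimorphism from \<open>F\<close> to \<open>P\<close> embeds \<open>Hom\<^sub>H(P, V)\<close> into \<open>Hom\<^sub>H(F, V)\<close>; this is one implication.

  The converse is an induction on the order of \<open>P\<close> (\<open>equivariant_epi_exists\<close>). If \<open>P\<close> is not trivial, then
  the elements of order dividing \<open>p\<close> in its centre form a nontrivial \<open>\<bbbF>\<^sub>p[H]\<close>-module, and this module contains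
  a simple one, \<open>V\<close>. The quotient \<open>Q = P / V\<close> satisfies the same inequalities, so there is an
  equivariant epimorphism \<open>g\<close> from \<open>F\<close> onto \<open>Q\<close>. Freeness lifts it to a homomorphism into \<open>P\<close>, and since
  two lifts differ by a homomorphism into the central subgroup \<open>V\<close>, averaging over \<open>H\<close> makes the lift equivariant
  (\<open>equivariant_lift\<close>). Let \<open>Q\<^sub>0\<close> be the image of the equivariant lift \<open>g'\<close>. As \<open>V\<close> is simple, \<open>Q\<^sub>0\<close> either
  contains \<open>V\<close>, and then \<open>g'\<close> is onto, or it meets \<open>V\<close> trivially, and then \<open>P = Q\<^sub>0 \<times> V\<close>. In the second case the
  projection of \<open>P\<close> to \<open>V\<close> is an element of \<open>Hom\<^sub>H(P, V)\<close> that does not factor through \<open>Q\<close>, so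
  \<open>Hom\<^sub>H(F, V)\<close>, being at least as large as \<open>Hom\<^sub>H(P, V)\<close>, is strictly larger than \<open>Hom\<^sub>H(Q, V)\<close>. Therefore some
  \<open>k\<close> in \<open>Hom\<^sub>H(F, V)\<close> does not vanish on the kernel of \<open>g\<close> (\<open>exists_hom_nontrivial_on_kernel\<close>). It maps this
  kernel onto \<open>V\<close>, again by simplicity, and the product of \<open>g'\<close> and \<open>k\<close> is the epimorphism that is sought
  (\<open>epi_by_central_correction\<close>).
\<close>

section \<open>Actions and averages\<close>

text \<open>
  Only the values of \<open>\<phi> h\<close> on the carrier matter here, in contrast to \<^const>\<open>AutoGroup\<close>, whose elements are
  extensional functions. So one and the same function \<open>\<phi>\<close> also acts on every invariant subgroup, and an
  action can be transported to a quotient without restricting it.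
\<close>
locale automorphism_action = H: group H + G: group G
  for H (structure) and G (structure) and \<phi> +
  assumes act_hom: "h \<in> carrier H \<Longrightarrow> \<phi> h \<in> hom G G"
    and act_mult: "\<lbrakk>h \<in> carrier H; k \<in> carrier H; x \<in> carrier G\<rbrakk>
      \<Longrightarrow> \<phi> (h \<otimes>\<^bsub>H\<^esub> k) x = \<phi> h (\<phi> k x)"
    and act_one: "x \<in> carrier G \<Longrightarrow> \<phi> \<one>\<^bsub>H\<^esub> x = x"
begin

lemma act_closed [simp, intro]:
  "\<lbrakk>h \<in> carrier H; x \<in> carrier G\<rbrakk> \<Longrightarrow> \<phi> h x \<in> carrier G"
  using act_hom by (auto simp: hom_def)

lemma act_prod:
  "\<lbrakk>h \<in> carrier H; x \<in> carrier G; y \<in> carrier G\<rbrakk> \<Longrightarrow> \<phi> h (x \<otimes>\<^bsub>G\<^esub> y) = \<phi> h x \<otimes>\<^bsub>G\<^esub> \<phi> h y"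
  using act_hom by (auto simp: hom_def)

lemma act_G_one: "h \<in> carrier H \<Longrightarrow> \<phi> h \<one>\<^bsub>G\<^esub> = \<one>\<^bsub>G\<^esub>"
  using act_hom G.is_group hom_one by blast

lemma act_inv_G:
  assumes "h \<in> carrier H" "x \<in> carrier G"
  shows "\<phi> h (inv\<^bsub>G\<^esub> x) = inv\<^bsub>G\<^esub> (\<phi> h x)"
proof -
  interpret group_hom G G "\<phi> h"
    using assms act_hom by unfold_locales auto
  show ?thesis using assms(2) by (rule hom_inv)
qed

lemma act_pow:
  assumes "h \<in> carrier H" "x \<in> carrier G"
  shows "\<phi> h (x [^]\<^bsub>G\<^esub> (n::nat)) = \<phi> h x [^]\<^bsub>G\<^esub> n"
  using assms by (induction n) (auto simp: act_G_one act_prod)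

lemma act_inverse:
  assumes "h \<in> carrier H" "x \<in> carrier G"
  shows "\<phi> h (\<phi> (inv\<^bsub>H\<^esub> h) x) = x" "\<phi> (inv\<^bsub>H\<^esub> h) (\<phi> h x) = x"
  using assms act_mult[of h "inv\<^bsub>H\<^esub> h" x] act_mult[of "inv\<^bsub>H\<^esub> h" h x] by (auto simp: act_one)

end

lemma acts_by_automorphisms_imp_action:
  assumes "group H" "group G" "acts_by_automorphisms H G \<phi>"
  shows "automorphism_action H G \<phi>"
proof -
  interpret H: group H by fact
  interpret G: group G by fact
  have grp: "group_hom H (AutoGroup G) \<phi>"
    using assms G.AutoGroup by (simp add: group_hom_def group_hom_axioms_def)
  have aut: "\<phi> h \<in> auto G" if "h \<in> carrier H" for h
    using group_hom.hom_closed[OF grp that] by (simp add: AutoGroup_def)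
  show ?thesis
  proof
    show "\<phi> h \<in> hom G G" if "h \<in> carrier H" for h
      using aut[OF that] by (auto simp: auto_def)
    show "\<phi> (h \<otimes>\<^bsub>H\<^esub> k) x = \<phi> h (\<phi> k x)"
      if "h \<in> carrier H" "k \<in> carrier H" "x \<in> carrier G" for h k x
      using that aut group_hom.hom_mult[OF grp, of h k]
      by (auto simp: AutoGroup_def BijGroup_def compose_def auto_def)
    show "\<phi> \<one>\<^bsub>H\<^esub> x = x" if "x \<in> carrier G" for x
      using that group_hom.hom_one[OF grp] by (auto simp: AutoGroup_def BijGroup_def)
  qed
qed

text \<open>
  The exponent inverts the order of \<open>H\<close> modulo \<open>p\<close>. In additive notation, and for \<open>A\<close> of exponent \<open>p\<close>, this
  is the mean value of \<open>u\<close> over \<open>H\<close>.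
\<close>
definition average ::
  "nat \<Rightarrow> ('h, 'n) monoid_scheme \<Rightarrow> ('a, 'm) monoid_scheme \<Rightarrow> ('h \<Rightarrow> 'a) \<Rightarrow> 'a" where
  "average p H A u =
     finprod A u (carrier H) [^]\<^bsub>A\<^esub> (SOME m::nat. [m * card (carrier H) = 1] (mod p))"

context comm_group
begin

lemma average_closed: "u \<in> carrier H \<rightarrow> carrier G \<Longrightarrow> average p H G u \<in> carrier G"
  by (simp add: average_def)

lemma average_mult:
  assumes "u \<in> carrier H \<rightarrow> carrier G" "v \<in> carrier H \<rightarrow> carrier G"
  shows "average p H G (\<lambda>h. u h \<otimes> v h) = average p H G u \<otimes> average p H G v"
  using assms by (simp add: average_def finprod_multf pow_mult_distrib m_comm)

lemma average_cong:
  assumes "\<And>h. h \<in> carrier H \<Longrightarrow> u h = v h" "v \<in> carrier H \<rightarrow> carrier G"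
  shows "average p H G u = average p H G v"
proof -
  have "finprod G u (carrier H) = finprod G v (carrier H)"
    using assms by (intro finprod_cong') auto
  then show ?thesis by (simp add: average_def)
qed

lemma average_hom:
  assumes \<alpha>: "\<alpha> \<in> hom G G" and u: "u \<in> carrier H \<rightarrow> carrier G"
  shows "\<alpha> (average p H G u) = average p H G (\<lambda>h. \<alpha> (u h))"
proof -
  interpret \<alpha>: group_hom G G \<alpha>
    using \<alpha> by unfold_locales
  have "\<alpha> (finprod G u B) = finprod G (\<lambda>h. \<alpha> (u h)) B"
    if "B \<subseteq> carrier H" for B
  proof (cases "finite B")
    case True
    then show ?thesis using that
    proof (induction B)
      case (insert b B)
      then have "u \<in> B \<rightarrow> carrier G" "u b \<in> carrier G" using u by auto
      with insert show ?case by (simp add: Pi_def)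
    qed simp
  qed simp
  moreover have "\<alpha> (x [^] (n::nat)) = \<alpha> x [^] n" if "x \<in> carrier G" for x n
    using that by (rule \<alpha>.hom_nat_pow)
  ultimately show ?thesis
    using u by (simp add: average_def)
qed

lemma average_shift:
  assumes "group H" "h \<in> carrier H" "u \<in> carrier H \<rightarrow> carrier G"
  shows "average p H G (\<lambda>k. u (h \<otimes>\<^bsub>H\<^esub> k)) = average p H G u"
proof -
  interpret H: group H by fact
  have "inj_on (\<lambda>k. h \<otimes>\<^bsub>H\<^esub> k) (carrier H)"
    using assms(2) by (auto intro: inj_onI)
  moreover have "(\<lambda>k. h \<otimes>\<^bsub>H\<^esub> k) ` carrier H = carrier H"
    using assms(2) H.surj_const_mult by simp
  ultimately have "finprod G u (carrier H) = finprod G (\<lambda>k. u (h \<otimes>\<^bsub>H\<^esub> k)) (carrier H)"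
    using assms finprod_reindex[of u "\<lambda>k. h \<otimes>\<^bsub>H\<^esub> k" "carrier H"] by auto
  then show ?thesis by (simp add: average_def)
qed

lemma average_const:
  assumes "coprime (card (carrier H)) p" and "a \<in> carrier G" and "a [^] p = \<one>"
  shows "average p H G (\<lambda>_. a) = a"
proof -
  define n where "n = card (carrier H)"
  define m where "m = (SOME m::nat. [m * n = 1] (mod p))"
  have "\<exists>m::nat. [m * n = 1] (mod p)"
    using cong_solve_coprime_nat[of n p] assms(1) by (auto simp: n_def mult.commute)
  then have m: "[m * n = 1] (mod p)"
    unfolding m_def by (rule someI_ex)
  have mod: "a [^] (k::nat) = a [^] (k mod p)" for k
  proof -
    have "a [^] k = a [^] (p * (k div p) + k mod p)" by simp
    also have "\<dots> = (a [^] p) [^] (k div p) \<otimes> a [^] (k mod p)"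
      using assms(2) by (simp only: nat_pow_mult[symmetric] nat_pow_pow)
    finally show ?thesis using assms by simp
  qed
  have "average p H G (\<lambda>_. a) = (a [^] n) [^] m"
    using assms(2) by (simp add: average_def finprod_const n_def m_def)
  also have "\<dots> = a [^] (m * n)"
    using assms(2) by (simp add: nat_pow_pow mult.commute)
  also have "\<dots> = a [^] (1::nat)"
    using m mod[of "m * n"] mod[of 1] by (simp add: cong_def)
  finally show ?thesis using assms(2) by simp
qed

text \<open>
  Every use of averaging has this form: a function that satisfies a cocycle identity is transformed by the action
  of \<open>h\<close> into its translate divided by \<open>u h\<close>, and the mean value follows.
\<close>
lemma average_translate:
  assumes "group H" "coprime (card (carrier H)) p" and exp: "\<And>a. a \<in> carrier G \<Longrightarrow> a [^] p = \<one>"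
    and u: "u \<in> carrier H \<rightarrow> carrier G" and h: "h \<in> carrier H"
    and v: "\<And>k. k \<in> carrier H \<Longrightarrow> v k = inv (u h) \<otimes> u (h \<otimes>\<^bsub>H\<^esub> k)"
  shows "average p H G v = inv (u h) \<otimes> average p H G u"
proof -
  interpret H: group H by fact
  have uh: "u h \<in> carrier G" using u h by auto
  have sh: "(\<lambda>k. u (h \<otimes>\<^bsub>H\<^esub> k)) \<in> carrier H \<rightarrow> carrier G" using u h by auto
  have "average p H G v = average p H G (\<lambda>k. inv (u h) \<otimes> u (h \<otimes>\<^bsub>H\<^esub> k))"
    using v uh sh by (intro average_cong) auto
  also have "\<dots> = average p H G (\<lambda>_. inv (u h)) \<otimes> average p H G (\<lambda>k. u (h \<otimes>\<^bsub>H\<^esub> k))"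
    using uh sh by (intro average_mult) auto
  also have "average p H G (\<lambda>_. inv (u h)) = inv (u h)"
    using assms(2) uh exp by (intro average_const) auto
  also have "average p H G (\<lambda>k. u (h \<otimes>\<^bsub>H\<^esub> k)) = average p H G u"
    using assms(1) h u by (rule average_shift)
  finally show ?thesis .
qed

end

section \<open>Continuity into discrete spaces\<close>

text \<open>
  Continuity into a discrete space is local constancy. The maps below are built pointwise from finitely many
  continuous maps into discrete spaces, and are therefore constant wherever all of those are.
\<close>
lemma continuous_map_into_discrete_iff:
  "continuous_map X (discrete_topology U) f \<longleftrightarrow>
     f \<in> topspace X \<rightarrow> U \<and>
     (\<forall>x\<in>topspace X. \<exists>W. openin X W \<and> x \<in> W \<and> (\<forall>y\<in>W. f y = f x))" (is "_ = ?R")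
proof
  assume f: "continuous_map X (discrete_topology U) f"
  then have fU: "f \<in> topspace X \<rightarrow> U" by (auto simp: continuous_map_def)
  have "openin X {y \<in> topspace X. f y \<in> {f x}}" if "x \<in> topspace X" for x
    using f fU that by (intro openin_continuous_map_preimage[OF f]) auto
  moreover have "\<forall>y\<in>{y \<in> topspace X. f y \<in> {f x}}. f y = f x" for x by blast
  ultimately show ?R using fU by blast
next
  assume R: ?R
  have "openin X {x \<in> topspace X. f x \<in> A}" for A
  proof (subst openin_subopen, intro ballI)
    fix x assume x: "x \<in> {x \<in> topspace X. f x \<in> A}"
    then have "\<exists>W. openin X W \<and> x \<in> W \<and> (\<forall>y\<in>W. f y = f x)"
      using R by simp
    then obtain W where W: "openin X W" "x \<in> W" "\<forall>y\<in>W. f y = f x" by blast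
    then have "W \<subseteq> {x \<in> topspace X. f x \<in> A}"
      using x openin_subset[OF W(1)] by (metis (mono_tags, lifting) mem_Collect_eq subset_iff)
    then show "\<exists>W. openin X W \<and> x \<in> W \<and> W \<subseteq> {x \<in> topspace X. f x \<in> A}"
      using W by blast
  qed
  then show "continuous_map X (discrete_topology U) f"
    using R by (auto simp: continuous_map_def)
qed

lemma continuous_map_determined_by:
  assumes "finite I" and g: "\<And>i. i \<in> I \<Longrightarrow> continuous_map X (discrete_topology (U i)) (g i)"
    and f: "f \<in> topspace X \<rightarrow> A"
    and det: "\<And>x y. \<lbrakk>x \<in> topspace X; y \<in> topspace X; \<And>i. i \<in> I \<Longrightarrow> g i y = g i x\<rbrakk> \<Longrightarrow> f y = f x"
  shows "continuous_map X (discrete_topology A) f"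
  unfolding continuous_map_into_discrete_iff
proof (intro conjI ballI f)
  fix x assume x: "x \<in> topspace X"
  have "\<forall>i\<in>I. \<exists>W. openin X W \<and> x \<in> W \<and> (\<forall>y\<in>W. g i y = g i x)"
    using g x by (simp add: continuous_map_into_discrete_iff)
  then obtain W where W: "\<And>i. i \<in> I \<Longrightarrow> openin X (W i) \<and> x \<in> W i \<and> (\<forall>y\<in>W i. g i y = g i x)"
    by metis
  let ?W = "topspace X \<inter> \<Inter> (W ` I)"
  have "openin X ?W"
    using W assms(1) by (intro openin_Int_Inter) auto
  moreover have "\<forall>y\<in>?W. f y = f x" using W x by (intro ballI det) blast+
  moreover have "x \<in> ?W" using W x by blast
  ultimately show "\<exists>W. openin X W \<and> x \<in> W \<and> (\<forall>y\<in>W. f y = f x)"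
    by blast
qed

lemma continuous_map_determined_by_two:
  assumes "continuous_map X (discrete_topology U) g" "continuous_map X (discrete_topology U') g'"
    and "f \<in> topspace X \<rightarrow> A"
    and "\<And>x y. \<lbrakk>x \<in> topspace X; y \<in> topspace X; g y = g x; g' y = g' x\<rbrakk> \<Longrightarrow> f y = f x"
  shows "continuous_map X (discrete_topology A) f"
  unfolding continuous_map_into_discrete_iff
proof (intro conjI ballI)
  show "f \<in> topspace X \<rightarrow> A" by fact
  fix x assume x: "x \<in> topspace X"
  have "\<exists>W. openin X W \<and> x \<in> W \<and> (\<forall>y\<in>W. g y = g x)"
    "\<exists>W. openin X W \<and> x \<in> W \<and> (\<forall>y\<in>W. g' y = g' x)"
    using assms(1,2) x by (simp_all add: continuous_map_into_discrete_iff)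
  then obtain W W' where W: "openin X W" "x \<in> W" "\<forall>y\<in>W. g y = g x"
    and W': "openin X W'" "x \<in> W'" "\<forall>y\<in>W'. g' y = g' x"
    by blast
  have "f y = f x" if "y \<in> W \<inter> W'" for y
    using that x W W' openin_subset[OF W(1)] by (intro assms(4)) blast+
  moreover have "openin X (W \<inter> W')" using W W' by blast
  ultimately show "\<exists>W. openin X W \<and> x \<in> W \<and> (\<forall>y\<in>W. f y = f x)"
    using W W' by (intro exI[of _ "W \<inter> W'"] conjI) blast+
qed

lemma continuous_map_determined_by_one:
  assumes "continuous_map X (discrete_topology U) g" "f \<in> topspace X \<rightarrow> A"
    and "\<And>x y. \<lbrakk>x \<in> topspace X; y \<in> topspace X; g y = g x\<rbrakk> \<Longrightarrow> f y = f x"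
  shows "continuous_map X (discrete_topology A) f"
  by (rule continuous_map_determined_by_two[OF assms(1,1,2)]) (rule assms(3))

section \<open>First cohomology as equivariant homomorphisms\<close>

text \<open>
  Through this formula, dimensions are compared by comparing cardinalities of finite spaces.
\<close>
lemma card_vectorspace:
  assumes "vectorspace K V" "finite (carrier K)" "finite (carrier V)"
  shows "card (carrier V) = card (carrier K) ^ vectorspace.dim K V"
proof -
  interpret vectorspace K V by fact
  have "fin_dim"
    unfolding fin_dim_def using assms(3) span_is_subset2[of "carrier V"] in_own_span[of "carrier V"]
    by (intro exI[of _ "carrier V"]) auto
  then obtain B where B: "finite B" "basis B"
    using finite_basis_exists by blast
  then have BV: "B \<subseteq> carrier V" by (simp add: basis_def)
  have uniq: "\<exists>!a. a \<in> B \<rightarrow>\<^sub>E carrier K \<and> lincomb a B = v" if "v \<in> carrier V" for v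
    using basis_criterion[OF B(1) BV] B(2) that by blast
  have "bij_betw (\<lambda>a. lincomb a B) (B \<rightarrow>\<^sub>E carrier K) (carrier V)"
  proof (rule bij_betwI')
    show "lincomb a B \<in> carrier V" if "a \<in> B \<rightarrow>\<^sub>E carrier K" for a
      using that BV by (intro lincomb_closed) auto
    then show "(lincomb a B = lincomb b B) = (a = b)"
      if "a \<in> B \<rightarrow>\<^sub>E carrier K" "b \<in> B \<rightarrow>\<^sub>E carrier K" for a b
      using that uniq[of "lincomb a B"] by auto
    show "\<exists>a\<in>B \<rightarrow>\<^sub>E carrier K. v = lincomb a B" if "v \<in> carrier V" for v
      using uniq[OF that] by blast
  qed
  then have "card (B \<rightarrow>\<^sub>E carrier K) = card (carrier V)"
    by (rule bij_betw_same_card)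
  then show ?thesis
    using B dim_basis by (simp add: card_funcsetE)
qed

lemma (in module) submodule_abelian_subgroup:
  assumes "submodule R N M"
  shows "abelian_subgroup N M"
proof -
  interpret N: submodule R N M by fact
  have "\<ominus>\<^bsub>M\<^esub> x \<in> N" if x: "x \<in> N" for x
  proof -
    have "\<ominus>\<^bsub>M\<^esub> x = \<ominus> \<one> \<odot>\<^bsub>M\<^esub> x"
      using x N.subset by (simp add: smult_l_minus subset_iff)
    then show ?thesis using x by simp
  qed
  then have "subgroup N (add_monoid M)"
    using N.subset N.m_closed N.zero_closed by (intro subgroup.intro) (auto simp: a_inv_def)
  then have "additive_subgroup N M" by (rule additive_subgroup.intro)
  then show ?thesis using M.abelian_group_axioms by (rule abelian_subgroupI3)
qed

lemma quotient_module_is_module: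
  fixes R (structure) and M :: "('k, 'v) module" (structure)
  assumes "module R M" "submodule R N M"
  shows "module R (quotient_module M N)"
proof -
  interpret module R M by fact
  interpret N: abelian_subgroup N M using assms(2) by (rule submodule_abelian_subgroup)
  interpret S: submodule R N M by fact
  let ?Q = "quotient_module M N"
  have carr: "carrier ?Q = (\<Union>x\<in>carrier M. {N +>\<^bsub>M\<^esub> x})"
    by (simp add: quotient_module_def A_RCOSETS_def')
  have add: "(N +>\<^bsub>M\<^esub> x) \<oplus>\<^bsub>?Q\<^esub> (N +>\<^bsub>M\<^esub> y) = N +>\<^bsub>M\<^esub> (x \<oplus>\<^bsub>M\<^esub> y)"
    if "x \<in> carrier M" "y \<in> carrier M" for x y
    using N.a_rcos_sum[OF that] by (simp add: quotient_module_def)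
  have zero: "\<zero>\<^bsub>?Q\<^esub> = N +>\<^bsub>M\<^esub> \<zero>\<^bsub>M\<^esub>"
    using N.a_subset by (simp add: quotient_module_def a_coset_add_zero)
  have smult: "a \<odot>\<^bsub>?Q\<^esub> (N +>\<^bsub>M\<^esub> x) = N +>\<^bsub>M\<^esub> (a \<odot>\<^bsub>M\<^esub> x)"
    if a: "a \<in> carrier R" and x: "x \<in> carrier M" for a x
  proof -
    have "n \<oplus>\<^bsub>M\<^esub> a \<odot>\<^bsub>M\<^esub> (n' \<oplus>\<^bsub>M\<^esub> x) \<in> N +>\<^bsub>M\<^esub> a \<odot>\<^bsub>M\<^esub> x"
      if "n \<in> N" "n' \<in> N" for n n'
    proof -
      have "n \<oplus>\<^bsub>M\<^esub> a \<odot>\<^bsub>M\<^esub> (n' \<oplus>\<^bsub>M\<^esub> x) = (n \<oplus>\<^bsub>M\<^esub> a \<odot>\<^bsub>M\<^esub> n') \<oplus>\<^bsub>M\<^esub> a \<odot>\<^bsub>M\<^esub> x"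
        using that a x N.a_Hcarr by (simp add: smult_r_distr M.a_assoc)
      then show ?thesis using that a by (auto simp: a_r_coset_def')
    qed
    moreover have "n \<oplus>\<^bsub>M\<^esub> a \<odot>\<^bsub>M\<^esub> x \<in> N <+>\<^bsub>M\<^esub> (\<lambda>x. a \<odot>\<^bsub>M\<^esub> x) ` (N +>\<^bsub>M\<^esub> x)" if "n \<in> N" for n
      using that x N.a_rcos_self[OF x] by (auto simp: set_add_def' )
    ultimately show ?thesis
      by (auto simp: quotient_module_def set_add_def' a_r_coset_def')
  qed
  show ?thesis
  proof (rule moduleI)
    show "cring R" by (rule R.cring_axioms)
    show "abelian_group ?Q"
    proof (rule abelian_groupI)
      show "\<exists>y\<in>carrier ?Q. y \<oplus>\<^bsub>?Q\<^esub> x = \<zero>\<^bsub>?Q\<^esub>" if x: "x \<in> carrier ?Q" for x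
      proof -
        obtain y where y: "y \<in> carrier M" "x = N +>\<^bsub>M\<^esub> y" using x unfolding carr by blast
        then have "(N +>\<^bsub>M\<^esub> (\<ominus>\<^bsub>M\<^esub> y)) \<oplus>\<^bsub>?Q\<^esub> x = \<zero>\<^bsub>?Q\<^esub>"
          by (simp add: add zero M.l_neg)
        then show ?thesis using y by (auto simp: carr)
      qed
    qed (auto simp: carr add zero M.a_ac)
  qed (auto simp: carr add smult smult_l_distr smult_r_distr smult_assoc1)
qed

text \<open>
  The part of a continuous linear action that makes the cocycles a module and the coboundaries a submodule. It
  is applied to a semidirect product \<open>G \<rtimes> H\<close> acting through \<open>H\<close>.
\<close>
locale linear_monoid_action = module K V for K (structure) and V :: "('k, 'v) module" (structure) +
  fixes \<Gamma> :: "'g monoid" and T :: "'g topology" and \<rho> :: "'g \<Rightarrow> 'v \<Rightarrow> 'v"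
  assumes top: "topspace T = carrier \<Gamma>"
    and mult_closed: "\<lbrakk>g \<in> carrier \<Gamma>; h \<in> carrier \<Gamma>\<rbrakk> \<Longrightarrow> g \<otimes>\<^bsub>\<Gamma>\<^esub> h \<in> carrier \<Gamma>"
    and linear: "g \<in> carrier \<Gamma> \<Longrightarrow> \<rho> g \<in> module_hom K V V"
    and compose: "\<lbrakk>g \<in> carrier \<Gamma>; h \<in> carrier \<Gamma>; v \<in> carrier V\<rbrakk>
      \<Longrightarrow> \<rho> (g \<otimes>\<^bsub>\<Gamma>\<^esub> h) v = \<rho> g (\<rho> h v)"
    and continuous: "v \<in> carrier V \<Longrightarrow> continuous_map T (discrete_topology (carrier V)) (\<lambda>g. \<rho> g v)"
begin

lemma \<rho>_closed [simp]: "\<lbrakk>g \<in> carrier \<Gamma>; v \<in> carrier V\<rbrakk> \<Longrightarrow> \<rho> g v \<in> carrier V"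
  and \<rho>_add: "\<lbrakk>g \<in> carrier \<Gamma>; v \<in> carrier V; w \<in> carrier V\<rbrakk> \<Longrightarrow> \<rho> g (v \<oplus>\<^bsub>V\<^esub> w) = \<rho> g v \<oplus>\<^bsub>V\<^esub> \<rho> g w"
  and \<rho>_smult: "\<lbrakk>g \<in> carrier \<Gamma>; a \<in> carrier K; v \<in> carrier V\<rbrakk> \<Longrightarrow> \<rho> g (a \<odot>\<^bsub>V\<^esub> v) = a \<odot>\<^bsub>V\<^esub> \<rho> g v"
  using linear[of g] by (auto simp: module_hom_def)

lemma \<rho>_zero: "g \<in> carrier \<Gamma> \<Longrightarrow> \<rho> g \<zero>\<^bsub>V\<^esub> = \<zero>\<^bsub>V\<^esub>"
  using \<rho>_smult[of g \<zero> "\<zero>\<^bsub>V\<^esub>"] by simp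

lemma \<rho>_minus: "\<lbrakk>g \<in> carrier \<Gamma>; v \<in> carrier V\<rbrakk> \<Longrightarrow> \<rho> g (\<ominus>\<^bsub>V\<^esub> v) = \<ominus>\<^bsub>V\<^esub> \<rho> g v"
  using \<rho>_smult[of g "\<ominus> \<one>" v] smult_l_minus[of \<one>] by simp

abbreviation "Z \<equiv> cocycle_module \<Gamma> T V \<rho>"

lemma cocycleD:
  assumes "f \<in> cocycles1 \<Gamma> T V \<rho>"
  shows "g \<in> carrier \<Gamma> \<Longrightarrow> f g \<in> carrier V"
    and "continuous_map T (discrete_topology (carrier V)) f"
    and "\<lbrakk>g \<in> carrier \<Gamma>; h \<in> carrier \<Gamma>\<rbrakk> \<Longrightarrow> f (g \<otimes>\<^bsub>\<Gamma>\<^esub> h) = f g \<oplus>\<^bsub>V\<^esub> \<rho> g (f h)"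
    and "f \<in> extensional (carrier \<Gamma>)"
  using assms by (auto simp: cocycles1_def PiE_def)

lemma cocycles_add_closed:
  assumes "f \<in> cocycles1 \<Gamma> T V \<rho>" "f' \<in> cocycles1 \<Gamma> T V \<rho>"
  shows "(\<lambda>g \<in> carrier \<Gamma>. f g \<oplus>\<^bsub>V\<^esub> f' g) \<in> cocycles1 \<Gamma> T V \<rho>"
proof -
  note f = cocycleD[OF assms(1)] and f' = cocycleD[OF assms(2)]
  have "continuous_map T (discrete_topology (carrier V)) (\<lambda>g \<in> carrier \<Gamma>. f g \<oplus>\<^bsub>V\<^esub> f' g)"
    using f(1) f'(1) by (intro continuous_map_determined_by_two[OF f(2) f'(2)]) (auto simp: top)
  moreover have "f g \<oplus>\<^bsub>V\<^esub> \<rho> g (f h) \<oplus>\<^bsub>V\<^esub> (f' g \<oplus>\<^bsub>V\<^esub> \<rho> g (f' h)) = f g \<oplus>\<^bsub>V\<^esub> f' g \<oplus>\<^bsub>V\<^esub> \<rho> g (f h \<oplus>\<^bsub>V\<^esub> f' h)"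
    if "g \<in> carrier \<Gamma>" "h \<in> carrier \<Gamma>" for g h
    using that f(1) f'(1) by (simp add: \<rho>_add M.a_ac)
  ultimately show ?thesis
    using f f' by (auto simp: cocycles1_def mult_closed)
qed

lemma cocycles_smult_closed:
  assumes "f \<in> cocycles1 \<Gamma> T V \<rho>" "a \<in> carrier K"
  shows "(\<lambda>g \<in> carrier \<Gamma>. a \<odot>\<^bsub>V\<^esub> f g) \<in> cocycles1 \<Gamma> T V \<rho>"
proof -
  note f = cocycleD[OF assms(1)]
  have "continuous_map T (discrete_topology (carrier V)) (\<lambda>g \<in> carrier \<Gamma>. a \<odot>\<^bsub>V\<^esub> f g)"
    using f(1) assms(2) by (intro continuous_map_determined_by_one[OF f(2)]) (auto simp: top)
  then show ?thesis
    using f assms(2) by (auto simp: cocycles1_def mult_closed \<rho>_smult smult_r_distr)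
qed

lemma zero_cocycle: "(\<lambda>g \<in> carrier \<Gamma>. \<zero>\<^bsub>V\<^esub>) \<in> cocycles1 \<Gamma> T V \<rho>"
proof -
  have "continuous_map T (discrete_topology (carrier V)) (\<lambda>g \<in> carrier \<Gamma>. \<zero>\<^bsub>V\<^esub>)"
    by (rule continuous_map_eq[of _ _ "\<lambda>_. \<zero>\<^bsub>V\<^esub>"]) (auto simp: top)
  then show ?thesis by (auto simp: cocycles1_def \<rho>_zero mult_closed)
qed

lemma cocycle_eqI:
  assumes "f \<in> extensional (carrier \<Gamma>)" "f' \<in> extensional (carrier \<Gamma>)"
    and "\<And>g. g \<in> carrier \<Gamma> \<Longrightarrow> f g = f' g"
  shows "f = f'"
  using assms by (rule extensionalityI)

lemma Z_simps [simp]: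
  "carrier Z = cocycles1 \<Gamma> T V \<rho>"
  "\<zero>\<^bsub>Z\<^esub> = (\<lambda>g \<in> carrier \<Gamma>. \<zero>\<^bsub>V\<^esub>)"
  "f \<oplus>\<^bsub>Z\<^esub> f' = (\<lambda>g \<in> carrier \<Gamma>. f g \<oplus>\<^bsub>V\<^esub> f' g)"
  "a \<odot>\<^bsub>Z\<^esub> f = (\<lambda>g \<in> carrier \<Gamma>. a \<odot>\<^bsub>V\<^esub> f g)"
  by (simp_all add: cocycle_module_def)

lemma cocycle_module_is_module: "module K Z"
proof (rule moduleI)
  show "cring K" by (rule R.cring_axioms)
  show "abelian_group Z"
  proof (rule abelian_groupI)
    fix f assume "f \<in> carrier Z"
    then have f: "f \<in> cocycles1 \<Gamma> T V \<rho>" by simp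
    note fD = cocycleD[OF f]
    show "\<exists>f'\<in>carrier Z. f' \<oplus>\<^bsub>Z\<^esub> f = \<zero>\<^bsub>Z\<^esub>"
    proof
      show "(\<lambda>g \<in> carrier \<Gamma>. (\<ominus> \<one>) \<odot>\<^bsub>V\<^esub> f g) \<in> carrier Z"
        using cocycles_smult_closed[OF f, of "\<ominus> \<one>"] by simp
      show "(\<lambda>g \<in> carrier \<Gamma>. (\<ominus> \<one>) \<odot>\<^bsub>V\<^esub> f g) \<oplus>\<^bsub>Z\<^esub> f = \<zero>\<^bsub>Z\<^esub>"
        using fD(1) by (auto intro!: restrict_ext simp: smult_l_minus M.l_neg)
    qed
    show "\<zero>\<^bsub>Z\<^esub> \<oplus>\<^bsub>Z\<^esub> f = f"
      by (rule cocycle_eqI) (use fD in auto)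
  next
    fix f f' f'' assume "f \<in> carrier Z" "f' \<in> carrier Z" "f'' \<in> carrier Z"
    then have "\<And>g. g \<in> carrier \<Gamma> \<Longrightarrow> f g \<in> carrier V \<and> f' g \<in> carrier V \<and> f'' g \<in> carrier V"
      by (auto dest: cocycleD(1))
    then show "(f \<oplus>\<^bsub>Z\<^esub> f') \<oplus>\<^bsub>Z\<^esub> f'' = f \<oplus>\<^bsub>Z\<^esub> (f' \<oplus>\<^bsub>Z\<^esub> f'')"
      by (auto intro!: restrict_ext simp: M.a_assoc)
  next
    fix f f' assume "f \<in> carrier Z" "f' \<in> carrier Z"
    then have "\<And>g. g \<in> carrier \<Gamma> \<Longrightarrow> f g \<in> carrier V \<and> f' g \<in> carrier V"
      by (auto dest: cocycleD(1))
    then show "f \<oplus>\<^bsub>Z\<^esub> f' = f' \<oplus>\<^bsub>Z\<^esub> f"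
      by (auto intro!: restrict_ext simp: M.a_comm)
  qed (simp_all add: cocycles_add_closed zero_cocycle)
next
  fix a b f f'
  assume a: "a \<in> carrier K" "b \<in> carrier K" and "f \<in> carrier Z" "f' \<in> carrier Z"
  then have fV: "\<And>g. g \<in> carrier \<Gamma> \<Longrightarrow> f g \<in> carrier V \<and> f' g \<in> carrier V"
    by (auto dest: cocycleD(1))
  show "a \<odot>\<^bsub>Z\<^esub> (f \<oplus>\<^bsub>Z\<^esub> f') = (a \<odot>\<^bsub>Z\<^esub> f) \<oplus>\<^bsub>Z\<^esub> (a \<odot>\<^bsub>Z\<^esub> f')"
    using fV a by (auto intro!: restrict_ext simp: smult_r_distr)
  show "(a \<oplus> b) \<odot>\<^bsub>Z\<^esub> f = (a \<odot>\<^bsub>Z\<^esub> f) \<oplus>\<^bsub>Z\<^esub> (b \<odot>\<^bsub>Z\<^esub> f)"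
    using fV a by (auto intro!: restrict_ext simp: smult_l_distr)
  show "(a \<otimes> b) \<odot>\<^bsub>Z\<^esub> f = a \<odot>\<^bsub>Z\<^esub> (b \<odot>\<^bsub>Z\<^esub> f)"
    using fV a by (auto intro!: restrict_ext simp: smult_assoc1)
next
  fix f assume "f \<in> carrier Z"
  then have f: "f \<in> cocycles1 \<Gamma> T V \<rho>" by simp
  show "\<one> \<odot>\<^bsub>Z\<^esub> f = f"
    by (rule cocycle_eqI) (use cocycleD[OF f] in auto)
qed (simp_all add: cocycles_smult_closed)

lemma coboundary_cocycle:
  assumes v: "v \<in> carrier V"
  shows "(\<lambda>g \<in> carrier \<Gamma>. \<rho> g v \<ominus>\<^bsub>V\<^esub> v) \<in> cocycles1 \<Gamma> T V \<rho>"
proof -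
  have "continuous_map T (discrete_topology (carrier V)) (\<lambda>g \<in> carrier \<Gamma>. \<rho> g v \<ominus>\<^bsub>V\<^esub> v)"
    using v by (intro continuous_map_determined_by_one[OF continuous[OF v]]) (auto simp: top)
  moreover have "\<rho> (g \<otimes>\<^bsub>\<Gamma>\<^esub> h) v \<ominus>\<^bsub>V\<^esub> v = (\<rho> g v \<ominus>\<^bsub>V\<^esub> v) \<oplus>\<^bsub>V\<^esub> \<rho> g (\<rho> h v \<ominus>\<^bsub>V\<^esub> v)"
    if "g \<in> carrier \<Gamma>" "h \<in> carrier \<Gamma>" for g h
  proof -
    have "(\<rho> g v \<ominus>\<^bsub>V\<^esub> v) \<oplus>\<^bsub>V\<^esub> \<rho> g (\<rho> h v \<ominus>\<^bsub>V\<^esub> v)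
      = (\<ominus>\<^bsub>V\<^esub> v \<oplus>\<^bsub>V\<^esub> \<rho> g (\<rho> h v)) \<oplus>\<^bsub>V\<^esub> (\<rho> g v \<oplus>\<^bsub>V\<^esub> \<ominus>\<^bsub>V\<^esub> \<rho> g v)"
      using that v by (simp add: a_minus_def \<rho>_add \<rho>_minus M.a_ac)
    then show ?thesis using that v by (simp add: M.r_neg compose a_minus_def M.a_ac)
  qed
  ultimately show ?thesis
    using v by (auto simp: cocycles1_def mult_closed)
qed

lemma coboundaries_submodule: "submodule K (coboundaries1 \<Gamma> V \<rho>) Z"
proof (rule LinearCombinations.submodule.intro)
  let ?b = "\<lambda>v. \<lambda>g \<in> carrier \<Gamma>. \<rho> g v \<ominus>\<^bsub>V\<^esub> v"
  have memb: "?b v \<in> coboundaries1 \<Gamma> V \<rho>" if "v \<in> carrier V" for v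
    using that by (auto simp: coboundaries1_def)
  show "module K Z" by (rule cocycle_module_is_module)
  show "coboundaries1 \<Gamma> V \<rho> \<subseteq> carrier Z"
    by (auto simp: coboundaries1_def coboundary_cocycle)
  show "f \<oplus>\<^bsub>Z\<^esub> f' \<in> coboundaries1 \<Gamma> V \<rho>"
    if f: "f \<in> coboundaries1 \<Gamma> V \<rho>" "f' \<in> coboundaries1 \<Gamma> V \<rho>" for f f'
  proof -
    obtain v w where vw: "v \<in> carrier V" "w \<in> carrier V" "f = ?b v" "f' = ?b w"
      using f unfolding coboundaries1_def by blast
    have "f \<oplus>\<^bsub>Z\<^esub> f' = ?b (v \<oplus>\<^bsub>V\<^esub> w)"
      using vw by (auto intro!: restrict_ext simp: a_minus_def \<rho>_add M.minus_add M.a_ac)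
    then show ?thesis using memb vw by simp
  qed
  have "\<zero>\<^bsub>Z\<^esub> = ?b \<zero>\<^bsub>V\<^esub>"
    by (auto intro!: restrict_ext simp: \<rho>_zero M.r_neg a_minus_def)
  then show "\<zero>\<^bsub>Z\<^esub> \<in> coboundaries1 \<Gamma> V \<rho>"
    using memb by simp
  show "a \<odot>\<^bsub>Z\<^esub> f \<in> coboundaries1 \<Gamma> V \<rho>"
    if f: "a \<in> carrier K" "f \<in> coboundaries1 \<Gamma> V \<rho>" for a f
  proof -
    obtain v where v: "v \<in> carrier V" "f = ?b v"
      using f unfolding coboundaries1_def by blast
    have "a \<odot>\<^bsub>Z\<^esub> f = ?b (a \<odot>\<^bsub>V\<^esub> v)"
      using v f by (auto intro!: restrict_ext simp: a_minus_def \<rho>_smult smult_r_distr smult_r_minus)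
    then show ?thesis using memb v f by simp
  qed
qed

lemma H1_is_module: "module K (H1 \<Gamma> T V \<rho>)"
  unfolding H1_def
  by (rule quotient_module_is_module[OF cocycle_module_is_module coboundaries_submodule])

end

text \<open>
  Extensional functions, so that the homomorphisms can be counted. The target is any monoid scheme in order to
  admit the additive group of a module.
\<close>
definition equivariant_homs ::
  "'h monoid \<Rightarrow> 'a monoid \<Rightarrow> 'a topology \<Rightarrow> ('h \<Rightarrow> 'a \<Rightarrow> 'a) \<Rightarrow> ('b, 'm) monoid_scheme \<Rightarrow> ('h \<Rightarrow> 'b \<Rightarrow> 'b)
    \<Rightarrow> ('a \<Rightarrow> 'b) set" where
  "equivariant_homs H G T \<phi> G' \<psi> =
     {f \<in> hom G G' \<inter> extensional (carrier G).
        continuous_map T (discrete_topology (carrier G')) f \<and>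
        (\<forall>h \<in> carrier H. \<forall>x \<in> carrier G. f (\<phi> h x) = \<psi> h (f x))}"

text \<open>
  The passage from additive to multiplicative notation, so that averages and equivariant homomorphisms need to be
  treated for groups only.
\<close>
lemma module_imp_action:
  assumes "group_algebra_module K H V \<rho>"
  shows "automorphism_action H (add_monoid V) \<rho>"
proof -
  interpret group_algebra_module K H V \<rho> by fact
  interpret H: group H using group_hom by (simp add: group_hom_def)
  interpret add: comm_group "add_monoid V" by (rule M.a_comm_group)
  show ?thesis
  proof
    show "\<rho> h \<in> hom (add_monoid V) (add_monoid V)" if "h \<in> carrier H" for h
      using linear[OF that] by (auto simp: module_hom_def hom_def)
    show "\<rho> (h \<otimes>\<^bsub>H\<^esub> k) x = \<rho> h (\<rho> k x)"
      if "h \<in> carrier H" "k \<in> carrier H" "x \<in> carrier (add_monoid V)" for h k x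
      using that composition_rule by simp
    show "\<rho> \<one>\<^bsub>H\<^esub> x = x" if "x \<in> carrier (add_monoid V)" for x
      using that by (simp flip: id_eq_one)
  qed
qed

lemma residue_module_exponent:
  fixes V :: "(int, 'v) module"
  assumes "prime p" and "module (residue_ring (int p)) V" and v: "v \<in> carrier V"
  shows "v [^]\<^bsub>add_monoid V\<^esub> p = \<zero>\<^bsub>V\<^esub>"
proof -
  interpret module "residue_ring (int p)" V by fact
  have p: "p > 1" using assms(1) prime_gt_1_nat by blast
  have "v [^]\<^bsub>add_monoid V\<^esub> n = (int n mod int p) \<odot>\<^bsub>V\<^esub> v" for n :: nat
  proof (induction n)
    case 0
    then show ?case using smult_l_null[OF v] by (simp add: residue_ring_def)
  next
    case (Suc n)
    have "int (Suc n) mod int p = (int n mod int p) \<oplus>\<^bsub>residue_ring (int p)\<^esub> \<one>\<^bsub>residue_ring (int p)\<^esub>"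
      by (simp add: residue_ring_def mod_simps add.commute)
    moreover have "int n mod int p \<in> carrier (residue_ring (int p))"
      using p by (simp add: residue_ring_def)
    ultimately show ?case
      using Suc v by (simp add: smult_l_distr)
  qed
  from this[of p] show ?thesis using smult_l_null[OF v] by (simp add: residue_ring_def)
qed

text \<open>
  This is the vanishing of \<open>H\<^sup>1(H, V)\<close>: minus the mean value of \<open>u\<close> is a vector whose coboundary is \<open>u\<close>.
\<close>
lemma cocycle_on_prime_to_p_group:
  fixes V :: "(int, 'v) module"
  assumes "prime p" "coprime (card (carrier H)) p"
    and V: "group_algebra_module (residue_ring (int p)) H V \<rho>"
    and u: "\<And>h. h \<in> carrier H \<Longrightarrow> u h \<in> carrier V"
    and coc: "\<And>h k. \<lbrakk>h \<in> carrier H; k \<in> carrier H\<rbrakk> \<Longrightarrow> u (h \<otimes>\<^bsub>H\<^esub> k) = u h \<oplus>\<^bsub>V\<^esub> \<rho> h (u k)"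
  shows "\<exists>w\<in>carrier V. \<forall>h\<in>carrier H. u h = \<rho> h w \<ominus>\<^bsub>V\<^esub> w"
proof -
  interpret group_algebra_module "residue_ring (int p)" H V \<rho> by fact
  interpret act: automorphism_action H "add_monoid V" \<rho> by (rule module_imp_action[OF V])
  interpret add: comm_group "add_monoid V" by (rule M.a_comm_group)
  have uf: "u \<in> carrier H \<rightarrow> carrier V" using u by auto
  let ?s = "average p H (add_monoid V) u"
  have s: "?s \<in> carrier V" using add.average_closed[OF uf] by simp
  have "u h = \<rho> h (\<ominus>\<^bsub>V\<^esub> ?s) \<ominus>\<^bsub>V\<^esub> (\<ominus>\<^bsub>V\<^esub> ?s)" if h: "h \<in> carrier H" for h
  proof -
    have rs: "\<rho> h ?s \<in> carrier V" using act.act_closed[OF h] s by simp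
    have "\<rho> h (u k) = inv\<^bsub>add_monoid V\<^esub> (u h) \<otimes>\<^bsub>add_monoid V\<^esub> u (h \<otimes>\<^bsub>H\<^esub> k)" if k: "k \<in> carrier H" for k
    proof -
      have "\<rho> h (u k) \<in> carrier V" using act.act_closed[OF h] u[OF k] by simp
      then show ?thesis
        using coc[OF h k] u[OF h] by (simp flip: a_inv_def add: M.r_neg1 M.r_neg2)
    qed
    then have "average p H (add_monoid V) (\<lambda>k. \<rho> h (u k))
        = inv\<^bsub>add_monoid V\<^esub> (u h) \<otimes>\<^bsub>add_monoid V\<^esub> ?s"
      using act.H.is_group assms(2) uf h residue_module_exponent[OF assms(1) M.module_axioms]
      by (intro comm_group.average_translate[OF M.a_comm_group]) auto
    then have "\<rho> h ?s = \<ominus>\<^bsub>V\<^esub> u h \<oplus>\<^bsub>V\<^esub> ?s"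
      using add.average_hom[OF act.act_hom[OF h] uf] by (simp add: a_inv_def)
    then have "\<ominus>\<^bsub>V\<^esub> \<rho> h ?s \<oplus>\<^bsub>V\<^esub> ?s = u h \<oplus>\<^bsub>V\<^esub> (\<ominus>\<^bsub>V\<^esub> ?s \<oplus>\<^bsub>V\<^esub> ?s)"
      using u[OF h] s by (simp add: M.minus_add M.a_assoc)
    moreover have "\<rho> h (\<ominus>\<^bsub>V\<^esub> ?s) = \<ominus>\<^bsub>V\<^esub> \<rho> h ?s"
      using act.act_inv_G[OF h, of ?s] s by (simp add: a_inv_def)
    ultimately show ?thesis
      using u[OF h] s by (simp add: a_minus_def M.l_neg)
  qed
  then show ?thesis using s by (intro bexI[of _ "\<ominus>\<^bsub>V\<^esub> ?s"]) auto
qed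

lemma semidirect_linear_action:
  fixes V :: "(int, 'v) module"
  assumes "automorphism_action H G \<phi>" "topspace T = carrier G" "group_algebra_module K H V \<rho>"
  shows "linear_monoid_action K V (semidirect_product G H \<phi>) (semidirect_topology T H) (\<rho> \<circ> snd)"
proof -
  interpret automorphism_action H G \<phi> by fact
  interpret group_algebra_module K H V \<rho> by fact
  interpret \<rho>: automorphism_action H "add_monoid V" \<rho> by (rule module_imp_action[OF assms(3)])
  show ?thesis
  proof
    show "topspace (semidirect_topology T H) = carrier (semidirect_product G H \<phi>)"
      using assms(2) by (simp add: semidirect_product_def)
    show "continuous_map (semidirect_topology T H) (discrete_topology (carrier V)) (\<lambda>g. (\<rho> \<circ> snd) g v)"
      if v: "v \<in> carrier V" for v
    proof (rule continuous_map_determined_by_one[OF continuous_map_snd])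
      show "(\<lambda>g. (\<rho> \<circ> snd) g v) \<in> topspace (semidirect_topology T H) \<rightarrow> carrier V"
        using v \<rho>.act_closed by auto
    qed simp
  qed (auto simp: semidirect_product_def linear composition_rule)
qed

text \<open>
  The bijection sends \<open>f\<close> to the class of the cocycle \<open>(x, h) \<mapsto> f x\<close>. Injectivity holds because coboundaries vanish
  on \<open>G\<close>. For surjectivity, a cocycle is the sum of its restriction to \<open>G\<close> and its restriction to \<open>H\<close>, and the latter
  is a coboundary.
\<close>
lemma inflation_bij_H1:
  fixes V :: "(int, 'v) module"
  assumes "prime p" "coprime (card (carrier H)) p"
    and G: "automorphism_action H G \<phi>" and T: "topspace T = carrier G"
    and V: "group_algebra_module (residue_ring (int p)) H V \<rho>"
  defines "\<Gamma> \<equiv> semidirect_product G H \<phi>" and "S \<equiv> semidirect_topology T H"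
  shows "\<exists>\<Phi>. bij_betw \<Phi> (equivariant_homs H G T \<phi> (add_monoid V) \<rho>) (carrier (H1 \<Gamma> S V (\<rho> \<circ> snd)))"
proof -
  interpret automorphism_action H G \<phi> by fact
  interpret L: linear_monoid_action "residue_ring (int p)" V \<Gamma> S "\<rho> \<circ> snd"
    unfolding \<Gamma>_def S_def by (rule semidirect_linear_action[OF G T V])
  interpret \<rho>: automorphism_action H "add_monoid V" \<rho> by (rule module_imp_action[OF V])
  interpret Z: module "residue_ring (int p)" L.Z by (rule L.cocycle_module_is_module)
  let ?B = "coboundaries1 \<Gamma> V (\<rho> \<circ> snd)"
  interpret B: abelian_subgroup ?B L.Z
    by (rule Z.submodule_abelian_subgroup[OF L.coboundaries_submodule])
  have carr: "carrier \<Gamma> = carrier G \<times> carrier H" by (simp add: \<Gamma>_def semidirect_product_def)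
  have mult: "(x, h) \<otimes>\<^bsub>\<Gamma>\<^esub> (y, k) = (x \<otimes>\<^bsub>G\<^esub> \<phi> h y, h \<otimes>\<^bsub>H\<^esub> k)" for x h y k
    by (simp add: \<Gamma>_def semidirect_product_def)
  let ?Hom = "equivariant_homs H G T \<phi> (add_monoid V) \<rho>"
  define infl where "infl f = (\<lambda>(x, h) \<in> carrier G \<times> carrier H. f x)" for f :: "'b \<Rightarrow> 'v"
  have infl: "infl f \<in> cocycles1 \<Gamma> S V (\<rho> \<circ> snd)" if f: "f \<in> ?Hom" for f
  proof -
    have fc: "continuous_map T (discrete_topology (carrier V)) f"
      and fV: "\<And>x. x \<in> carrier G \<Longrightarrow> f x \<in> carrier V"
      and fm: "\<And>x y. \<lbrakk>x \<in> carrier G; y \<in> carrier G\<rbrakk> \<Longrightarrow> f (x \<otimes>\<^bsub>G\<^esub> y) = f x \<oplus>\<^bsub>V\<^esub> f y"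
      and fe: "\<And>h x. \<lbrakk>h \<in> carrier H; x \<in> carrier G\<rbrakk> \<Longrightarrow> f (\<phi> h x) = \<rho> h (f x)"
      using f by (auto simp: equivariant_homs_def hom_def)
    have "continuous_map S (discrete_topology (carrier V)) (f \<circ> fst)"
      unfolding S_def by (rule continuous_map_compose[OF continuous_map_fst fc])
    then have "continuous_map S (discrete_topology (carrier V)) (infl f)"
      by (rule continuous_map_eq) (auto simp: infl_def L.top carr)
    then show ?thesis
      by (auto simp: cocycles1_def infl_def carr mult fV fm fe)
  qed
  let ?\<Phi> = "\<lambda>f. ?B +>\<^bsub>L.Z\<^esub> infl f"
  have H1: "carrier (H1 \<Gamma> S V (\<rho> \<circ> snd)) = (\<Union>z\<in>cocycles1 \<Gamma> S V (\<rho> \<circ> snd). {?B +>\<^bsub>L.Z\<^esub> z})"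
    by (simp add: H1_def quotient_module_def A_RCOSETS_def')
  have "inj_on ?\<Phi> ?Hom"
  proof (rule inj_onI)
    fix f f' assume f: "f \<in> ?Hom" "f' \<in> ?Hom" and eq: "?\<Phi> f = ?\<Phi> f'"
    have "infl f \<in> ?\<Phi> f'"
      using B.a_rcos_self[of "infl f"] infl[OF f(1)] eq by simp
    then obtain b where b: "b \<in> ?B" "infl f = b \<oplus>\<^bsub>L.Z\<^esub> infl f'"
      by (auto simp: a_r_coset_def' simp del: L.Z_simps)
    then obtain v where v: "v \<in> carrier V" "b = (\<lambda>g \<in> carrier \<Gamma>. (\<rho> \<circ> snd) g v \<ominus>\<^bsub>V\<^esub> v)"
      by (auto simp: coboundaries1_def)
    show "f = f'"
    proof (rule extensionalityI)
      fix x assume x: "x \<in> carrier G"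
      have fx: "f' x \<in> carrier V" using f x by (auto simp: equivariant_homs_def hom_def)
      \<comment> \<open>Evaluation at \<open>(x, 1)\<close> kills the coboundary, since \<open>G\<close> acts trivially on \<open>V\<close>.\<close>
      have "infl f (x, \<one>\<^bsub>H\<^esub>) = (b \<oplus>\<^bsub>L.Z\<^esub> infl f') (x, \<one>\<^bsub>H\<^esub>)" using b(2) by simp
      then show "f x = f' x"
        using x v fx by (simp add: infl_def carr \<rho>.act_one a_minus_def L.M.r_neg)
    qed (use f in \<open>auto simp: equivariant_homs_def\<close>)
  qed
  moreover have "?\<Phi> ` ?Hom = carrier (H1 \<Gamma> S V (\<rho> \<circ> snd))"
  proof
    show "?\<Phi> ` ?Hom \<subseteq> carrier (H1 \<Gamma> S V (\<rho> \<circ> snd))"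
      using infl by (auto simp: H1)
    show "carrier (H1 \<Gamma> S V (\<rho> \<circ> snd)) \<subseteq> ?\<Phi> ` ?Hom"
    proof
      fix C assume "C \<in> carrier (H1 \<Gamma> S V (\<rho> \<circ> snd))"
      then obtain z where z: "z \<in> cocycles1 \<Gamma> S V (\<rho> \<circ> snd)" and C: "C = ?B +>\<^bsub>L.Z\<^esub> z"
        by (auto simp: H1)
      have zV: "z (x, h) \<in> carrier V" if "x \<in> carrier G" "h \<in> carrier H" for x h
        using L.cocycleD(1)[OF z] that by (simp add: carr)
      have zm: "z (x \<otimes>\<^bsub>G\<^esub> \<phi> h y, h \<otimes>\<^bsub>H\<^esub> k) = z (x, h) \<oplus>\<^bsub>V\<^esub> \<rho> h (z (y, k))"
        if "x \<in> carrier G" "y \<in> carrier G" "h \<in> carrier H" "k \<in> carrier H" for x y h k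
        using L.cocycleD(3)[OF z, of "(x, h)" "(y, k)"] that by (simp add: carr mult)
      define f where "f = (\<lambda>x\<in>carrier G. z (x, \<one>\<^bsub>H\<^esub>))"
      \<comment> \<open>This is the cocycle identity for \<open>(x, h) = (x, 1) (1, h)\<close>.\<close>
      have split: "z (x, h) = f x \<oplus>\<^bsub>V\<^esub> z (\<one>\<^bsub>G\<^esub>, h)" if "x \<in> carrier G" "h \<in> carrier H" for x h
        using zm[of x "\<one>\<^bsub>G\<^esub>" "\<one>\<^bsub>H\<^esub>" h] that zV \<rho>.act_one by (simp add: act_one f_def)
      have f: "f \<in> ?Hom"
      proof -
        have fV: "f x \<in> carrier V" if "x \<in> carrier G" for x using that zV by (simp add: f_def)
        have "continuous_map T S (\<lambda>x. (x, \<one>\<^bsub>H\<^esub>))"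
          unfolding S_def by (auto intro!: continuous_map_pairedI)
        then have "continuous_map T (discrete_topology (carrier V)) (z \<circ> (\<lambda>x. (x, \<one>\<^bsub>H\<^esub>)))"
          using L.cocycleD(2)[OF z] by (rule continuous_map_compose)
        then have cont: "continuous_map T (discrete_topology (carrier V)) f"
          by (rule continuous_map_eq) (auto simp: f_def T)
        have hom: "f (x \<otimes>\<^bsub>G\<^esub> y) = f x \<oplus>\<^bsub>V\<^esub> f y" if "x \<in> carrier G" "y \<in> carrier G" for x y
          using that zm[of x y "\<one>\<^bsub>H\<^esub>" "\<one>\<^bsub>H\<^esub>"] zV \<rho>.act_one by (simp add: f_def act_one)
        have "f (\<phi> h x) = \<rho> h (f x)" if hx: "h \<in> carrier H" "x \<in> carrier G" for h x
        proof -
          have u: "z (\<one>\<^bsub>G\<^esub>, h) \<in> carrier V" using zV hx by simp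
          have r: "\<rho> h (f x) \<in> carrier V" using \<rho>.act_closed[OF hx(1)] fV hx by simp
          \<comment> \<open>Equivariance comes from the two factorisations \<open>(\<phi> h x, h) = (\<phi> h x, 1) (1, h) = (1, h) (x, 1)\<close>.\<close>
          have "f (\<phi> h x) \<oplus>\<^bsub>V\<^esub> z (\<one>\<^bsub>G\<^esub>, h) = z (\<phi> h x, h)"
            using split[of "\<phi> h x" h] hx by simp
          also have "\<dots> = z (\<one>\<^bsub>G\<^esub>, h) \<oplus>\<^bsub>V\<^esub> \<rho> h (f x)"
            using zm[of "\<one>\<^bsub>G\<^esub>" x h "\<one>\<^bsub>H\<^esub>"] hx by (simp add: f_def)
          also have "\<dots> = \<rho> h (f x) \<oplus>\<^bsub>V\<^esub> z (\<one>\<^bsub>G\<^esub>, h)"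
            using u r by (rule L.M.a_comm)
          finally show ?thesis using u r fV hx by (simp add: L.M.add.right_cancel)
        qed
        then show ?thesis
          using cont hom fV by (auto simp: equivariant_homs_def hom_def f_def)
      qed
      have uV: "z (\<one>\<^bsub>G\<^esub>, h) \<in> carrier V" if "h \<in> carrier H" for h using that zV by simp
      have "z (\<one>\<^bsub>G\<^esub>, h \<otimes>\<^bsub>H\<^esub> k) = z (\<one>\<^bsub>G\<^esub>, h) \<oplus>\<^bsub>V\<^esub> \<rho> h (z (\<one>\<^bsub>G\<^esub>, k))"
        if "h \<in> carrier H" "k \<in> carrier H" for h k
        using that zm[of "\<one>\<^bsub>G\<^esub>" "\<one>\<^bsub>G\<^esub>" h k] by (simp add: act_G_one)
      then obtain w where w: "w \<in> carrier V" "\<And>h. h \<in> carrier H \<Longrightarrow> z (\<one>\<^bsub>G\<^esub>, h) = \<rho> h w \<ominus>\<^bsub>V\<^esub> w"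
        using cocycle_on_prime_to_p_group[OF assms(1,2) V, of "\<lambda>h. z (\<one>\<^bsub>G\<^esub>, h)"] uV by blast
      define b where "b = (\<lambda>g \<in> carrier \<Gamma>. (\<rho> \<circ> snd) g w \<ominus>\<^bsub>V\<^esub> w)"
      have b: "b \<in> ?B" using w by (auto simp: b_def coboundaries1_def)
      have "z = b \<oplus>\<^bsub>L.Z\<^esub> infl f"
      proof (rule L.cocycle_eqI)
        fix g assume "g \<in> carrier \<Gamma>"
        then obtain x h where g: "g = (x, h)" "x \<in> carrier G" "h \<in> carrier H" by (auto simp: carr)
        have "f x \<in> carrier V" using g zV by (simp add: f_def)
        then show "z g = (b \<oplus>\<^bsub>L.Z\<^esub> infl f) g"
          using g split[of x h] w(2)[of h] uV[of h] by (simp add: b_def infl_def carr L.M.a_comm)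
      qed (use L.cocycleD(4)[OF z] in auto)
      then have "z \<in> ?B +>\<^bsub>L.Z\<^esub> infl f" using b by (auto simp: a_r_coset_def' simp del: L.Z_simps)
      then have "?B +>\<^bsub>L.Z\<^esub> infl f = C"
        unfolding C using infl[OF f] B.a_subgroup by (intro Z.a_repr_independence) auto
      then show "C \<in> ?\<Phi> ` ?Hom" using f by blast
    qed
  qed
  ultimately show ?thesis by (auto simp: bij_betw_def)
qed

text \<open>
  The translation of the cohomological condition into a condition on equivariant homomorphisms. Finiteness of the
  set of homomorphisms makes \<open>H\<^sup>1\<close> a finite vector space.
\<close>
lemma card_equivariant_homs:
  fixes V :: "(int, 'v) module"
  assumes "prime p" "coprime (card (carrier H)) p"
    and G: "automorphism_action H G \<phi>" and T: "topspace T = carrier G"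
    and V: "group_algebra_module (residue_ring (int p)) H V \<rho>"
    and fin: "finite (equivariant_homs H G T \<phi> (add_monoid V) \<rho>)"
  shows "card (equivariant_homs H G T \<phi> (add_monoid V) \<rho>) =
    p ^ dim_H1_semidirect (residue_ring (int p)) G T H \<phi> V \<rho>"
proof -
  let ?H1 = "H1 (semidirect_product G H \<phi>) (semidirect_topology T H) V (\<rho> \<circ> snd)"
  interpret L: linear_monoid_action "residue_ring (int p)" V "semidirect_product G H \<phi>"
    "semidirect_topology T H" "\<rho> \<circ> snd"
    by (rule semidirect_linear_action[OF G T V])
  interpret residues_prime p "residue_ring (int p)"
    using assms(1) by unfold_locales
  obtain \<Phi> where \<Phi>: "bij_betw \<Phi> (equivariant_homs H G T \<phi> (add_monoid V) \<rho>) (carrier ?H1)"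
    using inflation_bij_H1[OF assms(1,2) G T V] by blast
  then have "finite (carrier ?H1)" using fin bij_betw_finite by blast
  moreover have "vectorspace (residue_ring (int p)) ?H1"
    using L.H1_is_module is_field by (simp add: vectorspace_def)
  ultimately have "card (carrier ?H1) = p ^ vectorspace.dim (residue_ring (int p)) ?H1"
    using card_vectorspace by (fastforce simp: residue_ring_def)
  then show ?thesis
    using bij_betw_same_card[OF \<Phi>] by (simp add: dim_H1_semidirect_def)
qed

section \<open>Finite quotients, free generators and finiteness\<close>

definition finite_p_group :: "nat \<Rightarrow> ('a, 'm) monoid_scheme \<Rightarrow> bool" where
  "finite_p_group p G \<longleftrightarrow> group G \<and> finite (carrier G) \<and> (\<exists>n. card (carrier G) = p ^ n)"

lemma finite_p_group_is_pro_p_group: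
  fixes G (structure)
  assumes "prime p" and G: "finite_p_group p G"
  shows "pro_p_group p G (discrete_topology (carrier G))"
proof -
  interpret group G using G by (simp add: finite_p_group_def)
  obtain n where n: "card (carrier G) = p ^ n" and fin: "finite (carrier G)"
    using G by (auto simp: finite_p_group_def)
  show ?thesis
  proof
    show "topspace (discrete_topology (carrier G)) = carrier G" by simp
    have "prod_topology (discrete_topology (carrier G)) (discrete_topology (carrier G))
        = discrete_topology (carrier G \<times> carrier G)"
      by (simp add: prod_topology_discrete_topology)
    then show "continuous_map (prod_topology (discrete_topology (carrier G)) (discrete_topology (carrier G)))
        (discrete_topology (carrier G)) (\<lambda>(x, y). x \<otimes> y)"
      by auto
    show "continuous_map (discrete_topology (carrier G)) (discrete_topology (carrier G)) (\<lambda>x. inv x)"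
      by auto
    show "compact_space (discrete_topology (carrier G))"
      using fin by (simp add: compact_space_discrete_topology)
    show "Hausdorff_space (discrete_topology (carrier G))"
      by (simp add: Hausdorff_space_discrete_topology)
    show "\<exists>N. subgroup N G \<and> openin (discrete_topology (carrier G)) N \<and> N \<subseteq> U"
      if "openin (discrete_topology (carrier G)) U" "\<one> \<in> U" for U
      using that by (intro exI[of _ "{\<one>}"]) (auto intro: triv_subgroup)
    show "\<exists>k. card (rcosets N) = p ^ k" if "N \<lhd> G" for N
    proof -
      have "card (rcosets N) * card N = p ^ n"
        using that n lagrange_finite[OF fin, of N] by (simp add: normal_imp_subgroup order_def)
      then have "card (rcosets N) dvd p ^ n" by (metis dvd_triv_left)
      then show ?thesis using assms(1) by (auto simp: divides_primepow_nat)
    qed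
  qed
qed

text \<open>
  Freeness tested on finite \<open>p\<close>-groups only. The uniqueness part replaces any statement about topological generation
  of \<open>F\<close>.
\<close>
lemma free_pro_p_group_generators:
  assumes "prime p" "free_pro_p_group p \<gamma> F T"
  obtains x where "x \<in> {..<\<gamma>} \<rightarrow> carrier F"
    and "\<And>(G :: nat set monoid) y. \<lbrakk>finite_p_group p G; y \<in> {..<\<gamma>} \<rightarrow> carrier G\<rbrakk> \<Longrightarrow>
      \<exists>f \<in> hom F G. continuous_map T (discrete_topology (carrier G)) f \<and> (\<forall>i<\<gamma>. f (x i) = y i)"
    and "\<And>(G :: nat set monoid) f f' a. \<lbrakk>finite_p_group p G;
      f \<in> hom F G; continuous_map T (discrete_topology (carrier G)) f;
      f' \<in> hom F G; continuous_map T (discrete_topology (carrier G)) f';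
      \<And>i. i < \<gamma> \<Longrightarrow> f (x i) = f' (x i); a \<in> carrier F\<rbrakk> \<Longrightarrow> f a = f' a"
proof -
  interpret F: pro_p_group p F T using assms(2) by (simp add: free_pro_p_group_def)
  obtain x where x: "x \<in> {..<\<gamma>} \<rightarrow> carrier F"
    and univ: "\<And>(G :: nat set monoid) TG y. \<lbrakk>y \<in> {..<\<gamma>} \<rightarrow> carrier G; pro_p_group p G TG\<rbrakk> \<Longrightarrow>
          (\<exists>!f. f \<in> continuous_homs F T G TG \<and> f \<in> extensional (carrier F) \<and>
                (\<forall>i<\<gamma>. f (x i) = y i))"
    using assms(2) unfolding free_pro_p_group_def by metis
  show ?thesis
  proof (rule that[OF x])
    fix G :: "nat set monoid" and y
    assume "finite_p_group p G" "y \<in> {..<\<gamma>} \<rightarrow> carrier G"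
    then show "\<exists>f \<in> hom F G. continuous_map T (discrete_topology (carrier G)) f \<and> (\<forall>i<\<gamma>. f (x i) = y i)"
      using univ[of y G, OF _ finite_p_group_is_pro_p_group[OF assms(1)]]
      by (auto simp: continuous_homs_def)
  next
    fix G :: "nat set monoid" and f f' a
    assume G: "finite_p_group p G"
      and f: "f \<in> hom F G" "continuous_map T (discrete_topology (carrier G)) f"
      and f': "f' \<in> hom F G" "continuous_map T (discrete_topology (carrier G)) f'"
      and eq: "\<And>i. i < \<gamma> \<Longrightarrow> f (x i) = f' (x i)" and a: "a \<in> carrier F"
    have restr: "restrict k (carrier F) \<in> continuous_homs F T G (discrete_topology (carrier G))"
      if "k \<in> hom F G" "continuous_map T (discrete_topology (carrier G)) k" for k
    proof -
      have "continuous_map T (discrete_topology (carrier G)) (restrict k (carrier F))"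
        using that(2) by (rule continuous_map_eq) (simp add: F.topspace_eq_carrier)
      then show ?thesis using that(1) by (auto simp: continuous_homs_def hom_def)
    qed
    have "(\<lambda>i. f (x i)) \<in> {..<\<gamma>} \<rightarrow> carrier G"
      using f(1) x by (auto simp: hom_def)
    note ex1 = univ[OF this finite_p_group_is_pro_p_group[OF assms(1) G]]
    have val: "restrict k (carrier F) (x i) = k (x i)" if "i < \<gamma>" for k :: "'a \<Rightarrow> nat set" and i
      using x that by (auto simp: Pi_iff)
    have "restrict f (carrier F) = restrict f' (carrier F)"
      using restr[OF f] restr[OF f'] val eq
      by (intro Uniq_D[OF ex1_iff_ex_Uniq[THEN iffD1, OF ex1, THEN conjunct2]])
        (simp_all add: restrict_extensional)
    then show "f a = f' a" using a by (metis restrict_apply')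
  qed
qed

lemma finite_imp_inj_into_infinite:
  assumes "finite A" "infinite (UNIV :: 'b set)"
  shows "\<exists>\<iota> :: 'a \<Rightarrow> 'b. inj_on \<iota> A"
proof -
  obtain B :: "'b set" where B: "finite B" "card B = card A"
    using infinite_arbitrarily_large[OF assms(2)] by blast
  then obtain \<iota> where "bij_betw \<iota> A B"
    using finite_same_card_bij[OF assms(1) B(1)] by auto
  then show ?thesis by (auto simp: bij_betw_def)
qed

text \<open>
  A copy of \<open>G / N\<close>, with the induced action, on a prescribed infinite type. It keeps the induction on the order of
  \<open>P\<close> inside the type \<^typ>\<open>nat set\<close>, on which freeness can be applied; with \<open>N\<close> trivial it transports a finite
  group with action to another type.
\<close>
lemma finite_quotient_model:
  fixes G :: "('a, 'm) monoid_scheme" (structure)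
  assumes "automorphism_action H G \<psi>" "finite (carrier G)" "N \<lhd> G"
    and inv: "\<And>h. h \<in> carrier H \<Longrightarrow> \<psi> h ` N \<subseteq> N"
    and inf: "infinite (UNIV :: 'b set)"
  obtains Q :: "'b monoid" and \<psi>' \<pi> where
    "automorphism_action H Q \<psi>'" "\<pi> \<in> hom G Q" "\<pi> ` carrier G = carrier Q"
    "\<And>x. x \<in> carrier G \<Longrightarrow> \<pi> x = \<one>\<^bsub>Q\<^esub> \<longleftrightarrow> x \<in> N"
    "\<And>h x. \<lbrakk>h \<in> carrier H; x \<in> carrier G\<rbrakk> \<Longrightarrow> \<pi> (\<psi> h x) = \<psi>' h (\<pi> x)"
proof -
  interpret automorphism_action H G \<psi> by fact
  interpret N: normal N G by fact
  have "finite (rcosets N)" using assms(2) by (simp add: RCOSETS_def)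
  then obtain \<iota> :: "'a set \<Rightarrow> 'b" where \<iota>: "inj_on \<iota> (rcosets N)"
    using finite_imp_inj_into_infinite[OF _ inf] by blast
  define \<pi> where "\<pi> x = \<iota> (N #> x)" for x
  have \<pi>_eq: "\<pi> a = \<pi> b \<longleftrightarrow> a \<otimes> inv b \<in> N" if "a \<in> carrier G" "b \<in> carrier G" for a b
  proof -
    have "\<pi> a = \<pi> b \<longleftrightarrow> N #> a = N #> b"
      using \<iota> that by (auto simp: \<pi>_def inj_on_def RCOSETS_def)
    also have "\<dots> \<longleftrightarrow> a \<in> N #> b"
      using that G.rcos_self[OF that(1) N.is_subgroup] G.repr_independence[OF _ that(2) N.is_subgroup] by blast
    also have "\<dots> \<longleftrightarrow> a \<otimes> inv b \<in> N"
      using that by (intro N.rcos_module[OF G.is_group])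
    finally show ?thesis .
  qed
  then have weak: "weak_group_morphism \<pi> N G"
    by (intro weak_group_morphismsI assms(3))
  define Q where "Q = image_group \<pi> G"
  interpret Q: group Q unfolding Q_def by (rule G.image_group_is_group[OF weak])
  have \<pi>: "\<pi> \<in> hom G Q" unfolding Q_def by (rule G.weak_group_morphism_is_hom[OF weak])
  have surj: "\<pi> ` carrier G = carrier Q" by (simp add: Q_def image_group_carrier)
  have ker: "\<pi> x = \<one>\<^bsub>Q\<^esub> \<longleftrightarrow> x \<in> N" if "x \<in> carrier G" for x
    using \<pi>_eq[OF that G.one_closed] that by (simp add: Q_def image_group_one)
  have \<pi>m: "\<pi> (x \<otimes> y) = \<pi> x \<otimes>\<^bsub>Q\<^esub> \<pi> y" if "x \<in> carrier G" "y \<in> carrier G" for x y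
    using \<pi> that by (auto simp: hom_def)
  \<comment> \<open>The choice of a preimage does not matter, because \<open>N\<close> is invariant.\<close>
  define \<psi>' where "\<psi>' h y = \<pi> (\<psi> h (inv_into (carrier G) \<pi> y))" for h y
  have eq: "\<pi> (\<psi> h x) = \<psi>' h (\<pi> x)" if h: "h \<in> carrier H" and x: "x \<in> carrier G" for h x
  proof -
    let ?x' = "inv_into (carrier G) \<pi> (\<pi> x)"
    have x': "?x' \<in> carrier G" "\<pi> ?x' = \<pi> x"
      using x by (auto simp: inv_into_into f_inv_into_f)
    then have "\<psi> h (x \<otimes> inv ?x') \<in> N"
      using inv[OF h] \<pi>_eq[OF x x'(1)] by auto
    then show ?thesis
      using h x x' \<pi>_eq[of "\<psi> h x" "\<psi> h ?x'"] by (simp add: \<psi>'_def act_prod act_inv_G)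
  qed
  have "automorphism_action H Q \<psi>'"
  proof
    show "\<psi>' h \<in> hom Q Q" if h: "h \<in> carrier H" for h
    proof (rule homI)
      fix y z assume "y \<in> carrier Q" "z \<in> carrier Q"
      then obtain a b where ab: "a \<in> carrier G" "b \<in> carrier G" "y = \<pi> a" "z = \<pi> b"
        by (auto simp flip: surj)
      show "\<psi>' h y \<in> carrier Q" using ab h surj by (auto simp flip: eq)
      have "\<psi>' h (y \<otimes>\<^bsub>Q\<^esub> z) = \<pi> (\<psi> h (a \<otimes> b))" using ab h by (simp add: eq \<pi>m)
      then show "\<psi>' h (y \<otimes>\<^bsub>Q\<^esub> z) = \<psi>' h y \<otimes>\<^bsub>Q\<^esub> \<psi>' h z"
        using ab h by (simp add: act_prod \<pi>m eq[symmetric] del: eq)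
    qed
    show "\<psi>' (h \<otimes>\<^bsub>H\<^esub> k) y = \<psi>' h (\<psi>' k y)"
      if "h \<in> carrier H" "k \<in> carrier H" "y \<in> carrier Q" for h k y
      using that by (auto simp: act_mult simp flip: surj eq)
    show "\<psi>' \<one>\<^bsub>H\<^esub> y = y" if "y \<in> carrier Q" for y
      using that by (auto simp: act_one simp flip: surj eq)
  qed
  then show ?thesis using \<pi> surj ker eq by (rule that)
qed

lemma finite_p_group_image:
  assumes "prime p" "finite_p_group p G" "group Q" "\<pi> \<in> hom G Q" "\<pi> ` carrier G = carrier Q"
  shows "finite_p_group p Q"
proof -
  interpret G: group G using assms(2) by (simp add: finite_p_group_def)
  interpret \<pi>: group_hom G Q \<pi>
    using assms by (simp add: group_hom_def group_hom_axioms_def finite_p_group_def)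
  obtain n where n: "card (carrier G) = p ^ n" and fin: "finite (carrier G)"
    using assms(2) by (auto simp: finite_p_group_def)
  have "card (carrier (G Mod kernel G Q \<pi>)) = card (carrier Q)"
    using iso_same_card[OF \<pi>.FactGroup_iso[OF assms(5)]] .
  moreover have "card (rcosets\<^bsub>G\<^esub> kernel G Q \<pi>) * card (kernel G Q \<pi>) = p ^ n"
    using n G.lagrange_finite[OF fin \<pi>.subgroup_kernel] by (simp add: order_def)
  ultimately have "card (carrier Q) dvd p ^ n"
    by (metis FactGroup_def dvd_triv_left partial_object.select_convs(1))
  then have "\<exists>k. card (carrier Q) = p ^ k" using assms(1) by (auto simp: divides_primepow_nat)
  moreover have "finite (carrier Q)" using fin assms(5) by (metis finite_imageI)
  ultimately show ?thesis using assms(3) by (simp add: finite_p_group_def)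
qed

text \<open>
  The span of the orbit of a nonzero vector is an invariant submodule, hence everything, and a finitely spanned space over a
  finite ring is finite.
\<close>
lemma simple_module_finite:
  assumes "finite (carrier K)" "finite (carrier H)" "simple_group_algebra_module K H V \<rho>"
  shows "finite (carrier V)"
proof -
  interpret group_algebra_module K H V \<rho>
    using assms(3) by (simp add: simple_group_algebra_module_def)
  interpret \<rho>: automorphism_action H "add_monoid V" \<rho> by (rule module_imp_action) unfold_locales
  obtain v where v: "v \<in> carrier V" "v \<noteq> \<zero>\<^bsub>V\<^esub>"
    using assms(3) M.zero_closed unfolding simple_group_algebra_module_def by blast
  define A where "A = (\<lambda>h. \<rho> h v) ` carrier H"
  have A: "A \<subseteq> carrier V" "finite A"
    using v assms(2) \<rho>.act_closed by (auto simp: A_def)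
  have sub: "submodule K (span A) V" by (rule span_is_submodule[OF A(1)])
  have "\<rho> h ` span A \<subseteq> span A" if h: "h \<in> carrier H" for h
  proof -
    interpret h: mod_hom K V V "\<rho> h"
      using linear[OF h] M.module_axioms by (intro mod_hom.intro) (auto simp: mod_hom_axioms_def)
    have "\<rho> h a \<in> A" if a: "a \<in> A" for a
    proof -
      obtain k where k: "k \<in> carrier H" "a = \<rho> k v" using a by (auto simp: A_def)
      then have "\<rho> h a = \<rho> (h \<otimes>\<^bsub>H\<^esub> k) v" using h v composition_rule by simp
      then show ?thesis using h k by (auto simp: A_def)
    qed
    then have img: "\<rho> h ` A \<subseteq> span A" using in_own_span[OF A(1)] by auto
    \<comment> \<open>The preimage of the span under \<open>\<rho> h\<close> is a submodule containing the orbit.\<close>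
    let ?W = "{x \<in> carrier V. \<rho> h x \<in> span A}"
    interpret S: LinearCombinations.submodule K "span A" V by (rule sub)
    have "submodule K ?W V"
      by (rule LinearCombinations.submodule.intro) (auto intro: M.module_axioms)
    then have "span A \<subseteq> ?W"
      using img A(1) by (intro span_is_subset) auto
    then show ?thesis by blast
  qed
  then have "group_algebra_submodule K H (span A) V \<rho>"
    using sub by (simp add: group_algebra_submodule_def)
  moreover have "v \<in> A"
    using v \<rho>.act_one by (auto simp: A_def intro!: image_eqI[of _ _ "\<one>\<^bsub>H\<^esub>"])
  ultimately have "span A = carrier V"
    using v(2) in_own_span[OF A(1)] assms(3)
    unfolding simple_group_algebra_module_def by blast
  moreover have "finite (span A)"
  proof -
    have "span A \<subseteq> (\<lambda>a. lincomb a A) ` (A \<rightarrow>\<^sub>E carrier K)"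
    proof
      fix w assume "w \<in> span A"
      then obtain a where a: "a \<in> A \<rightarrow> carrier K" "w = lincomb a A"
        using finite_span[OF A(2,1)] by auto
      have "lincomb a A = lincomb (restrict a A) A"
        unfolding lincomb_def using a A by (intro M.finsum_cong') (auto simp: Pi_iff subset_iff)
      then show "w \<in> (\<lambda>a. lincomb a A) ` (A \<rightarrow>\<^sub>E carrier K)"
        using a by (intro image_eqI[of _ _ "restrict a A"]) auto
    qed
    then show ?thesis
      using A(2) assms(1) by (meson finite_PiE finite_imageI finite_subset)
  qed
  ultimately show ?thesis by simp
qed

section \<open>Equivariant lifting through central extensions\<close>

definition equivariant_epi ::
  "'h monoid \<Rightarrow> 'a monoid \<Rightarrow> 'a topology \<Rightarrow> ('h \<Rightarrow> 'a \<Rightarrow> 'a) \<Rightarrow> 'b monoid \<Rightarrow> ('h \<Rightarrow> 'b \<Rightarrow> 'b)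
    \<Rightarrow> ('a \<Rightarrow> 'b) \<Rightarrow> bool" where
  "equivariant_epi H G T \<phi> Q \<psi> \<pi> \<longleftrightarrow>
     \<pi> \<in> continuous_homs G T Q (discrete_topology (carrier Q)) \<and> \<pi> ` carrier G = carrier Q \<and>
     (\<forall>h \<in> carrier H. \<forall>x \<in> carrier G. \<pi> (\<phi> h x) = \<psi> h (\<pi> x))"

lemma equivariant_epiD:
  assumes "equivariant_epi H G T \<phi> Q \<psi> \<pi>"
  shows "\<pi> \<in> hom G Q" "continuous_map T (discrete_topology (carrier Q)) \<pi>"
    "\<pi> ` carrier G = carrier Q"
    "\<lbrakk>h \<in> carrier H; x \<in> carrier G\<rbrakk> \<Longrightarrow> \<pi> (\<phi> h x) = \<psi> h (\<pi> x)"
    "x \<in> carrier G \<Longrightarrow> \<pi> x \<in> carrier Q"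
    "\<lbrakk>x \<in> carrier G; y \<in> carrier G\<rbrakk> \<Longrightarrow> \<pi> (x \<otimes>\<^bsub>G\<^esub> y) = \<pi> x \<otimes>\<^bsub>Q\<^esub> \<pi> y"
  using assms by (auto simp: equivariant_epi_def continuous_homs_def hom_def)

lemma equivariant_homsD:
  assumes "k \<in> equivariant_homs H G T \<phi> A \<rho>"
  shows "k \<in> hom G A" "continuous_map T (discrete_topology (carrier A)) k"
    "k \<in> extensional (carrier G)"
    "\<lbrakk>h \<in> carrier H; x \<in> carrier G\<rbrakk> \<Longrightarrow> k (\<phi> h x) = \<rho> h (k x)"
    "x \<in> carrier G \<Longrightarrow> k x \<in> carrier A"
    "\<lbrakk>x \<in> carrier G; y \<in> carrier G\<rbrakk> \<Longrightarrow> k (x \<otimes>\<^bsub>G\<^esub> y) = k x \<otimes>\<^bsub>A\<^esub> k y"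
  using assms by (auto simp: equivariant_homs_def hom_def)

lemma equivariant_homsI:
  assumes "automorphism_action H G \<phi>" "topspace T = carrier G"
    and "\<And>x. x \<in> carrier G \<Longrightarrow> k x \<in> carrier A"
    and "\<And>x y. \<lbrakk>x \<in> carrier G; y \<in> carrier G\<rbrakk> \<Longrightarrow> k (x \<otimes>\<^bsub>G\<^esub> y) = k x \<otimes>\<^bsub>A\<^esub> k y"
    and "continuous_map T (discrete_topology (carrier A)) k"
    and "\<And>h x. \<lbrakk>h \<in> carrier H; x \<in> carrier G\<rbrakk> \<Longrightarrow> k (\<phi> h x) = \<rho> h (k x)"
  shows "restrict k (carrier G) \<in> equivariant_homs H G T \<phi> A \<rho>"
proof -
  interpret automorphism_action H G \<phi> by fact
  have "continuous_map T (discrete_topology (carrier A)) (restrict k (carrier G))"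
    using assms(5) by (rule continuous_map_eq) (simp add: assms(2))
  then show ?thesis
    using assms(3,4,6) by (auto simp: equivariant_homs_def hom_def)
qed

definition pullback :: "'a monoid \<Rightarrow> ('a \<Rightarrow> 'q) \<Rightarrow> ('q \<Rightarrow> 'v) \<Rightarrow> 'a \<Rightarrow> 'v" where
  "pullback G \<pi> k = (\<lambda>x \<in> carrier G. k (\<pi> x))"

lemma pullback_equivariant_homs:
  assumes G: "automorphism_action H G \<phi>" "topspace T = carrier G"
    and \<pi>: "equivariant_epi H G T \<phi> Q \<psi> \<pi>" and k: "k \<in> equivariant_homs H Q T' \<psi> A \<rho>"
  shows "pullback G \<pi> k \<in> equivariant_homs H G T \<phi> A \<rho>"
proof -
  note \<pi>D = equivariant_epiD[OF \<pi>] and kD = equivariant_homsD[OF k]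
  have "continuous_map T (discrete_topology (carrier A)) (\<lambda>x. k (\<pi> x))"
    by (rule continuous_map_determined_by_one[OF \<pi>D(2)]) (use \<pi>D(5) kD(5) assms(2) in auto)
  then show ?thesis
    unfolding pullback_def by (intro equivariant_homsI[OF G]) (simp_all add: \<pi>D kD)
qed

lemma inj_on_pullback:
  assumes "equivariant_epi H G T \<phi> Q \<psi> \<pi>"
  shows "inj_on (pullback G \<pi>) (equivariant_homs H Q T' \<psi> A \<rho>)"
proof (rule inj_onI)
  fix k k' assume k: "k \<in> equivariant_homs H Q T' \<psi> A \<rho>" "k' \<in> equivariant_homs H Q T' \<psi> A \<rho>"
    and eq: "pullback G \<pi> k = pullback G \<pi> k'"
  show "k = k'"
  proof (rule extensionalityI)
    fix y assume "y \<in> carrier Q"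
    then obtain x where "x \<in> carrier G" "y = \<pi> x" using equivariant_epiD(3)[OF assms] by blast
    then show "k y = k' y" using fun_cong[OF eq, of x] by (simp add: pullback_def)
  qed (use k in \<open>auto dest: equivariant_homsD(3)\<close>)
qed

text \<open>
  The homomorphism theorem. A homomorphism that is trivial on the kernel of \<open>\<pi>\<close> factors through \<open>\<pi>\<close>; the factor is
  equivariant because \<open>\<pi>\<close> is onto.
\<close>
lemma in_range_pullback:
  assumes G: "automorphism_action H G \<phi>" and Q: "automorphism_action H Q \<psi>"
    and A: "group A" and \<pi>: "equivariant_epi H G T \<phi> Q \<psi> \<pi>"
    and k: "k \<in> equivariant_homs H G T \<phi> A \<rho>"
    and ker: "\<And>x. \<lbrakk>x \<in> carrier G; \<pi> x = \<one>\<^bsub>Q\<^esub>\<rbrakk> \<Longrightarrow> k x = \<one>\<^bsub>A\<^esub>"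
  shows "k \<in> pullback G \<pi> ` equivariant_homs H Q (discrete_topology (carrier Q)) \<psi> A \<rho>"
proof -
  interpret G: automorphism_action H G \<phi> by fact
  interpret Q: automorphism_action H Q \<psi> by fact
  interpret A: group A by fact
  note \<pi>D = equivariant_epiD[OF \<pi>] and kD = equivariant_homsD[OF k]
  have inv: "f (inv\<^bsub>G\<^esub> x) = inv\<^bsub>B\<^esub> (f x)" if "group B" "f \<in> hom G B" "x \<in> carrier G"
    for B :: "('z, 'y) monoid_scheme" and f x
    using group_hom.hom_inv[of G B f x] that G.G.is_group by (simp add: group_hom_def group_hom_axioms_def)
  define k' where "k' y = k (inv_into (carrier G) \<pi> y)" for y
  have k': "k' (\<pi> x) = k x" if x: "x \<in> carrier G" for x
  proof -
    let ?x = "inv_into (carrier G) \<pi> (\<pi> x)"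
    have x': "?x \<in> carrier G" "\<pi> ?x = \<pi> x" using x by (auto simp: inv_into_into f_inv_into_f)
    then have "\<pi> (?x \<otimes>\<^bsub>G\<^esub> inv\<^bsub>G\<^esub> x) = \<pi> x \<otimes>\<^bsub>Q\<^esub> \<pi> (inv\<^bsub>G\<^esub> x)"
      using x \<pi>D(6) by simp
    also have "\<dots> = \<pi> (x \<otimes>\<^bsub>G\<^esub> inv\<^bsub>G\<^esub> x)" using x \<pi>D(6)[of x "inv\<^bsub>G\<^esub> x"] by simp
    also have "\<dots> = \<one>\<^bsub>Q\<^esub>" using x hom_one[OF \<pi>D(1) G.G.is_group Q.G.is_group] by simp
    finally have "k ?x \<otimes>\<^bsub>A\<^esub> k (inv\<^bsub>G\<^esub> x) = \<one>\<^bsub>A\<^esub>"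
      using x x' ker[of "?x \<otimes>\<^bsub>G\<^esub> inv\<^bsub>G\<^esub> x"] kD(6) by simp
    also have "\<dots> = k x \<otimes>\<^bsub>A\<^esub> k (inv\<^bsub>G\<^esub> x)"
      using x kD(6)[of x "inv\<^bsub>G\<^esub> x"] hom_one[OF kD(1) G.G.is_group A] by simp
    finally show ?thesis using x x' kD(5) by (simp add: k'_def)
  qed
  have "restrict k' (carrier Q) \<in> equivariant_homs H Q (discrete_topology (carrier Q)) \<psi> A \<rho>"
  proof (rule equivariant_homsI[OF Q])
    show k'A: "k' y \<in> carrier A" if "y \<in> carrier Q" for y
      using that kD(5) by (auto simp: k' simp flip: \<pi>D(3))
    show "k' (y \<otimes>\<^bsub>Q\<^esub> z) = k' y \<otimes>\<^bsub>A\<^esub> k' z" if yz: "y \<in> carrier Q" "z \<in> carrier Q" for y z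
    proof -
      obtain a b where ab: "a \<in> carrier G" "b \<in> carrier G" "y = \<pi> a" "z = \<pi> b"
        using yz \<pi>D(3) by blast
      then have "k' (y \<otimes>\<^bsub>Q\<^esub> z) = k (a \<otimes>\<^bsub>G\<^esub> b)"
        using k'[of "a \<otimes>\<^bsub>G\<^esub> b"] \<pi>D(6)[of a b] by simp
      then show ?thesis using ab kD(6)[of a b] by (simp add: k')
    qed
    show "k' (\<psi> h y) = \<rho> h (k' y)" if hy: "h \<in> carrier H" "y \<in> carrier Q" for h y
    proof -
      obtain a where a: "a \<in> carrier G" "y = \<pi> a" using hy \<pi>D(3) by blast
      then have "k' (\<psi> h y) = k (\<phi> h a)"
        using hy k'[of "\<phi> h a"] \<pi>D(4)[of h a] by simp
      then show ?thesis using a hy kD(4)[of h a] by (simp add: k')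
    qed
    show "continuous_map (discrete_topology (carrier Q)) (discrete_topology (carrier A)) k'"
      using k'A by auto
  qed simp
  moreover have "k = pullback G \<pi> (restrict k' (carrier Q))"
    by (rule extensionalityI[OF kD(3)]) (auto simp: pullback_def k' \<pi>D(5))
  ultimately show ?thesis by blast
qed

locale free_pro_p_action =
  fixes p \<gamma> :: nat and H :: "'h monoid" and F :: "'f monoid" and T :: "'f topology"
    and \<phi> :: "'h \<Rightarrow> 'f \<Rightarrow> 'f"
  assumes prime_p: "prime p" and finite_H: "finite (carrier H)"
    and coprime_H: "coprime (card (carrier H)) p"
    and free: "free_pro_p_group p \<gamma> F T"
    and F_action: "automorphism_action H F \<phi>" and F_continuous: "continuous_action H T \<phi>"

sublocale free_pro_p_action \<subseteq> F: automorphism_action H F \<phi> by (rule F_action)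

context free_pro_p_action
begin

lemma topspace_T: "topspace T = carrier F"
  using free by (auto simp: free_pro_p_group_def pro_p_group_def topological_group.topspace_eq_carrier)

lemma continuous_act:
  assumes h: "h \<in> carrier H"
  shows "continuous_map T T (\<phi> h)"
proof -
  have "continuous_map T (prod_topology (discrete_topology (carrier H)) T) (\<lambda>x. (h, x))"
    using h by (auto intro!: continuous_map_pairedI)
  from continuous_map_compose[OF this F_continuous[unfolded continuous_action_def]]
  show ?thesis by (simp add: comp_def)
qed

text \<open>
  Let \<open>f\<close> be any homomorphic lift of \<open>g\<close>, obtained by freeness. Its conjugates \<open>x \<mapsto> \<psi> h (f (\<phi> (inv h) x))\<close> are lifts
  as well, since \<open>\<pi>\<close> and \<open>g\<close> are equivariant. So each of them is the product of \<open>f\<close> with a homomorphism \<open>x \<mapsto> c x h\<close> into the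
  kernel of \<open>\<pi>\<close>, which is central and of exponent \<open>p\<close>. Multiplying \<open>f\<close> by the mean value of \<open>c x\<close>
  over \<open>H\<close> gives the average of all the conjugates, and this is equivariant.
\<close>
lemma equivariant_lift:
  fixes P :: "nat set monoid" and Q :: "nat set monoid"
  assumes P: "finite_p_group p P" "automorphism_action H P \<psi>"
    and Q: "finite_p_group p Q" "automorphism_action H Q \<psi>'"
    and \<pi>: "equivariant_epi H P (discrete_topology (carrier P)) \<psi> Q \<psi>' \<pi>"
    and central: "\<And>x y. \<lbrakk>x \<in> carrier P; \<pi> x = \<one>\<^bsub>Q\<^esub>; y \<in> carrier P\<rbrakk> \<Longrightarrow> x \<otimes>\<^bsub>P\<^esub> y = y \<otimes>\<^bsub>P\<^esub> x"
    and expo: "\<And>x. \<lbrakk>x \<in> carrier P; \<pi> x = \<one>\<^bsub>Q\<^esub>\<rbrakk> \<Longrightarrow> x [^]\<^bsub>P\<^esub> p = \<one>\<^bsub>P\<^esub>"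
    and g: "equivariant_epi H F T \<phi> Q \<psi>' g"
  shows "\<exists>f \<in> equivariant_homs H F T \<phi> P \<psi>. \<forall>x \<in> carrier F. \<pi> (f x) = g x"
proof -
  interpret P: automorphism_action H P \<psi> by fact
  interpret Q: automorphism_action H Q \<psi>' by fact
  note \<pi>D = equivariant_epiD[OF \<pi>] and gD = equivariant_epiD[OF g]
  obtain f where f: "f \<in> hom F P" "continuous_map T (discrete_topology (carrier P)) f"
    and \<pi>f: "\<And>x. x \<in> carrier F \<Longrightarrow> \<pi> (f x) = g x"
  proof (rule free_pro_p_group_generators[OF prime_p free])
    fix x assume x: "x \<in> {..<\<gamma>} \<rightarrow> carrier F"
      and ex: "\<And>(G :: nat set monoid) y. \<lbrakk>finite_p_group p G; y \<in> {..<\<gamma>} \<rightarrow> carrier G\<rbrakk> \<Longrightarrow>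
        \<exists>f \<in> hom F G. continuous_map T (discrete_topology (carrier G)) f \<and> (\<forall>i<\<gamma>. f (x i) = y i)"
      and uniq: "\<And>(G :: nat set monoid) f f' a. \<lbrakk>finite_p_group p G;
        f \<in> hom F G; continuous_map T (discrete_topology (carrier G)) f;
        f' \<in> hom F G; continuous_map T (discrete_topology (carrier G)) f';
        \<And>i. i < \<gamma> \<Longrightarrow> f (x i) = f' (x i); a \<in> carrier F\<rbrakk> \<Longrightarrow> f a = f' a"
    define y where "y i = inv_into (carrier P) \<pi> (g (x i))" for i
    have y: "y i \<in> carrier P" "\<pi> (y i) = g (x i)" if "i < \<gamma>" for i
    proof -
      have "g (x i) \<in> \<pi> ` carrier P" using that x gD(5) \<pi>D(3) by auto
      then show "y i \<in> carrier P" "\<pi> (y i) = g (x i)"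
        unfolding y_def by (rule inv_into_into, rule f_inv_into_f)
    qed
    obtain f where f: "f \<in> hom F P" "continuous_map T (discrete_topology (carrier P)) f"
      "\<And>i. i < \<gamma> \<Longrightarrow> f (x i) = y i"
      using ex[OF P(1), of y] y(1) by auto
    have "(\<pi> \<circ> f) a = g a" if a: "a \<in> carrier F" for a
    proof (rule uniq[OF Q(1) _ _ gD(1,2) _ a])
      show "\<pi> \<circ> f \<in> hom F Q" using f(1) \<pi>D(1) by (rule hom_compose)
      show "continuous_map T (discrete_topology (carrier Q)) (\<pi> \<circ> f)"
        using f(2) \<pi>D(2) by (rule continuous_map_compose)
      show "(\<pi> \<circ> f) (x i) = g (x i)" if "i < \<gamma>" for i
        using f(3)[OF that] y(2)[OF that] by simp
    qed
    then have "\<pi> (f a) = g a" if "a \<in> carrier F" for a using that by simp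
    with f(1,2) show thesis by (rule that)
  qed
  have fP [simp]: "f x \<in> carrier P" if "x \<in> carrier F" for x using f(1) that by (auto simp: hom_def)
  have fm: "f (x \<otimes>\<^bsub>F\<^esub> y) = f x \<otimes>\<^bsub>P\<^esub> f y" if "x \<in> carrier F" "y \<in> carrier F" for x y
    using f(1) that by (auto simp: hom_def)
  interpret \<pi>: group_hom P Q \<pi>
    using \<pi>D(1) by unfold_locales
  define N where "N = kernel P Q \<pi>"
  have N: "x \<in> N \<longleftrightarrow> x \<in> carrier P \<and> \<pi> x = \<one>\<^bsub>Q\<^esub>" for x by (auto simp: N_def kernel_def)
  have subN: "subgroup N P" unfolding N_def by (rule \<pi>.subgroup_kernel)
  define C where "C = P\<lparr>carrier := N\<rparr>"
  interpret C: group C unfolding C_def by (rule P.G.subgroup_imp_group[OF subN])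
  interpret C: comm_group C
    by (rule C.group_comm_groupI) (auto simp: C_def N central)
  have C_simps [simp]: "carrier C = N" "x \<otimes>\<^bsub>C\<^esub> y = x \<otimes>\<^bsub>P\<^esub> y" for x y by (simp_all add: C_def)
  have C_inv: "inv\<^bsub>C\<^esub> x = inv\<^bsub>P\<^esub> x" if "x \<in> N" for x
    unfolding C_def using P.G.m_inv_consistent[OF subN that] .
  have C_exp: "x [^]\<^bsub>C\<^esub> p = \<one>\<^bsub>C\<^esub>" if "x \<in> carrier C" for x
    using that expo by (simp add: C_def N flip: P.G.nat_pow_consistent)
  have comm: "n \<otimes>\<^bsub>P\<^esub> y = y \<otimes>\<^bsub>P\<^esub> n" if "n \<in> N" "y \<in> carrier P" for n y
    using that central[of n y] unfolding N by blast
  have NP: "n \<in> carrier P" if "n \<in> N" for n using that by (simp add: N)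
  \<comment> \<open>\<open>tw h\<close> is the conjugate of \<open>f\<close> by \<open>h\<close>, and \<open>c x h\<close> measures its deviation from \<open>f\<close> at \<open>x\<close>.\<close>
  define tw where "tw h x = \<psi> h (f (\<phi> (inv\<^bsub>H\<^esub> h) x))" for h x
  define c where "c x h = inv\<^bsub>P\<^esub> (f x) \<otimes>\<^bsub>P\<^esub> tw h x" for x h
  have tw [simp]: "tw h x \<in> carrier P" if "h \<in> carrier H" "x \<in> carrier F" for h x
    using that by (simp add: tw_def)
  have cN: "c x h \<in> N" if "h \<in> carrier H" "x \<in> carrier F" for x h
  proof -
    have "\<pi> (tw h x) = g x"
      using that \<pi>f[of "\<phi> (inv\<^bsub>H\<^esub> h) x"] \<pi>D(4)[of h] gD(4)[of h "\<phi> (inv\<^bsub>H\<^esub> h) x"]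
      by (simp add: tw_def F.act_inverse)
    then show ?thesis
      using that \<pi>f gD(5) by (simp add: c_def N)
  qed
  have tw_c: "tw h x = f x \<otimes>\<^bsub>P\<^esub> c x h" if "h \<in> carrier H" "x \<in> carrier F" for x h
    using that by (simp add: c_def flip: P.G.m_assoc)
  have c_mult: "c (x \<otimes>\<^bsub>F\<^esub> y) h = c x h \<otimes>\<^bsub>P\<^esub> c y h"
    if "h \<in> carrier H" "x \<in> carrier F" "y \<in> carrier F" for x y h
  proof -
    have "c (x \<otimes>\<^bsub>F\<^esub> y) h = inv\<^bsub>P\<^esub> (f y) \<otimes>\<^bsub>P\<^esub> (c x h \<otimes>\<^bsub>P\<^esub> tw h y)"
      using that
      by (simp add: c_def fm P.G.inv_mult_group P.G.m_assoc tw_def P.act_prod F.act_prod)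
    also have "\<dots> = c x h \<otimes>\<^bsub>P\<^esub> c y h"
      using that comm[OF cN, of h x "inv\<^bsub>P\<^esub> (f y)"] NP[OF cN]
      by (simp add: c_def[of y] flip: P.G.m_assoc)
    finally show ?thesis .
  qed
  define d where "d x = average p H C (c x)" for x
  have cC: "c x \<in> carrier H \<rightarrow> carrier C" if "x \<in> carrier F" for x using cN that by auto
  have dN: "d x \<in> N" if "x \<in> carrier F" for x
    unfolding d_def using C.average_closed[OF cC[OF that]] by simp
  have d_mult: "d (x \<otimes>\<^bsub>F\<^esub> y) = d x \<otimes>\<^bsub>P\<^esub> d y" if "x \<in> carrier F" "y \<in> carrier F" for x y
  proof -
    have "d (x \<otimes>\<^bsub>F\<^esub> y) = average p H C (\<lambda>h. c x h \<otimes>\<^bsub>C\<^esub> c y h)"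
      unfolding d_def
      by (rule C.average_cong) (use that cC in \<open>auto simp: c_mult intro!: C.m_closed[simplified]\<close>)
    then show ?thesis
      using C.average_mult[OF cC cC, OF that] by (simp add: d_def)
  qed
  have psi_C: "\<psi> h \<in> hom C C" if "h \<in> carrier H" for h
    using that Q.act_G_one \<pi>D(4) by (auto simp: hom_def N P.act_prod)
  have d_act: "\<psi> h (d (\<phi> (inv\<^bsub>H\<^esub> h) x)) = inv\<^bsub>P\<^esub> (c x h) \<otimes>\<^bsub>P\<^esub> d x"
    if h: "h \<in> carrier H" and x: "x \<in> carrier F" for h x
  proof -
    let ?x = "\<phi> (inv\<^bsub>H\<^esub> h) x"
    have x': "?x \<in> carrier F" using h x by simp
    \<comment> \<open>The cocycle identity for \<open>h \<mapsto> c _ h\<close>: conjugating the \<open>k\<close>-th conjugate by \<open>h\<close> gives the \<open>hk\<close>-th.\<close>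
    have "\<psi> h (c ?x k) = inv\<^bsub>C\<^esub> (c x h) \<otimes>\<^bsub>C\<^esub> c x (h \<otimes>\<^bsub>H\<^esub> k)" if k: "k \<in> carrier H" for k
    proof -
      have "\<psi> h (tw k ?x) = tw (h \<otimes>\<^bsub>H\<^esub> k) x"
        using h k x by (simp add: tw_def P.act_mult F.H.inv_mult_group F.act_mult)
      then have "\<psi> h (c ?x k) = inv\<^bsub>P\<^esub> (tw h x) \<otimes>\<^bsub>P\<^esub> tw (h \<otimes>\<^bsub>H\<^esub> k) x"
        using h k x by (simp add: c_def P.act_prod P.act_inv_G tw_def[of h])
      also have "\<dots> = inv\<^bsub>P\<^esub> (c x h) \<otimes>\<^bsub>P\<^esub> c x (h \<otimes>\<^bsub>H\<^esub> k)"
      proof -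
        have "inv\<^bsub>P\<^esub> (f x) \<otimes>\<^bsub>P\<^esub> (f x \<otimes>\<^bsub>P\<^esub> c x (h \<otimes>\<^bsub>H\<^esub> k)) = c x (h \<otimes>\<^bsub>H\<^esub> k)"
          using h k x NP[OF cN] by (simp flip: P.G.m_assoc)
        then show ?thesis
          using h k x NP[OF cN] by (simp add: tw_c P.G.inv_mult_group P.G.m_assoc)
      qed
      finally show ?thesis using h x by (simp add: C_inv cN)
    qed
    then have "average p H C (\<lambda>k. \<psi> h (c ?x k)) = inv\<^bsub>C\<^esub> (c x h) \<otimes>\<^bsub>C\<^esub> d x"
      unfolding d_def using h cC[OF x] C_exp coprime_H F.H.is_group
      by (intro C.average_translate) auto
    then show ?thesis
      using C.average_hom[OF psi_C[OF h] cC[OF x'], of p] h x by (simp add: d_def C_inv cN)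
  qed
  define f' where "f' x = f x \<otimes>\<^bsub>P\<^esub> d x" for x
  have f'P: "f' x \<in> carrier P" if "x \<in> carrier F" for x
    using that dN NP by (simp add: f'_def)
  have f'_tw: "\<psi> h (f' (\<phi> (inv\<^bsub>H\<^esub> h) x)) = f' x" if h: "h \<in> carrier H" and x: "x \<in> carrier F" for h x
  proof -
    have "\<psi> h (f' (\<phi> (inv\<^bsub>H\<^esub> h) x)) = tw h x \<otimes>\<^bsub>P\<^esub> (inv\<^bsub>P\<^esub> (c x h) \<otimes>\<^bsub>P\<^esub> d x)"
      using h x dN[of "\<phi> (inv\<^bsub>H\<^esub> h) x"] NP by (simp add: f'_def P.act_prod tw_def flip: d_act)
    also have "\<dots> = f' x"
    proof -
      have "c x h \<otimes>\<^bsub>P\<^esub> (inv\<^bsub>P\<^esub> (c x h) \<otimes>\<^bsub>P\<^esub> d x) = d x"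
        using h x NP[OF cN] NP[OF dN] by (simp flip: P.G.m_assoc)
      then show ?thesis
        using h x NP[OF cN] NP[OF dN] by (simp add: tw_c f'_def P.G.m_assoc)
    qed
    finally show ?thesis .
  qed
  have "restrict f' (carrier F) \<in> equivariant_homs H F T \<phi> P \<psi>"
  proof (rule equivariant_homsI[OF F_action topspace_T f'P])
    show "f' (x \<otimes>\<^bsub>F\<^esub> y) = f' x \<otimes>\<^bsub>P\<^esub> f' y" if "x \<in> carrier F" "y \<in> carrier F" for x y
    proof -
      have "f' (x \<otimes>\<^bsub>F\<^esub> y) = f x \<otimes>\<^bsub>P\<^esub> ((f y \<otimes>\<^bsub>P\<^esub> d x) \<otimes>\<^bsub>P\<^esub> d y)"
        using that NP[OF dN] by (simp add: f'_def fm d_mult P.G.m_assoc)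
      also have "f y \<otimes>\<^bsub>P\<^esub> d x = d x \<otimes>\<^bsub>P\<^esub> f y" using that comm[OF dN, of x "f y"] by simp
      finally show ?thesis using that NP[OF dN] by (simp add: f'_def P.G.m_assoc)
    qed
    show "f' (\<phi> h x) = \<psi> h (f' x)" if "h \<in> carrier H" "x \<in> carrier F" for h x
      using f'_tw[of h "\<phi> h x"] that by (simp add: F.act_inverse)
    show "continuous_map T (discrete_topology (carrier P)) f'"
    \<comment> \<open>The value of \<open>f'\<close> at \<open>x\<close> depends only on the finitely many values of \<open>f\<close> on the orbit of \<open>x\<close>.\<close>
    proof (rule continuous_map_determined_by[OF finite_H])
      show "continuous_map T (discrete_topology (carrier P)) (\<lambda>x. f (\<phi> (inv\<^bsub>H\<^esub> h) x))"
        if "h \<in> carrier H" for h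
        using continuous_map_compose[OF continuous_act f(2), of "inv\<^bsub>H\<^esub> h"] that by (simp add: comp_def)
      show "f' \<in> topspace T \<rightarrow> carrier P" using f'P by (auto simp: topspace_T)
      fix x y assume xy: "x \<in> topspace T" "y \<in> topspace T"
        and eq: "\<And>h. h \<in> carrier H \<Longrightarrow> f (\<phi> (inv\<^bsub>H\<^esub> h) y) = f (\<phi> (inv\<^bsub>H\<^esub> h) x)"
      have fxy: "f y = f x" using eq[of "\<one>\<^bsub>H\<^esub>"] xy by (simp add: F.act_one topspace_T)
      have "d y = d x"
        unfolding d_def by (rule C.average_cong) (use eq fxy cC xy in \<open>auto simp: c_def tw_def topspace_T\<close>)
      then show "f' y = f' x" using fxy by (simp add: f'_def)
    qed
  qed
  moreover have "\<pi> (f' x) = g x" if "x \<in> carrier F" for x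
    using that dN[of x] gD(5) by (simp add: f'_def \<pi>f N)
  ultimately show ?thesis by (intro bexI[of _ "restrict f' (carrier F)"]) auto
qed

end

section \<open>Minimal invariant central subgroups as simple modules\<close>

text \<open>
  Orbits of a \<open>p\<close>-group have \<open>p\<close>-power length, so if \<open>x0\<close> were the only fixed point, then the number of
  elements of \<open>E\<close> would be congruent to one modulo \<open>p\<close>.
\<close>
lemma fixed_points_of_p_group:
  assumes "group_action G E \<phi>" and "prime p" "order G = p ^ n" "finite E" "p dvd card E"
    and x0: "x0 \<in> E" "\<And>g. g \<in> carrier G \<Longrightarrow> \<phi> g x0 = x0"
  shows "\<exists>z\<in>E. z \<noteq> x0 \<and> (\<forall>g\<in>carrier G. \<phi> g z = z)"
proof (rule ccontr)
  assume none: "\<not> ?thesis"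
  interpret group_action G E \<phi> by fact
  have orb0: "orbit G \<phi> x0 = {x0}"
    using x0 orbit_refl[OF x0(1)] by (auto simp: orbit_def)
  have fin: "finite (orbits G E \<phi>)"
    using assms(4) orbits_coverture by (metis finite_UnionD)
  have "p dvd card B" if B: "B \<in> orbits G E \<phi> - {{x0}}" for B
  proof -
    obtain z where z: "z \<in> E" "B = orbit G \<phi> z" using B by (auto simp: orbits_def)
    have "card B dvd p ^ n"
      using orbit_stabilizer_theorem[OF z(1)] assms(3) z(2) by (metis dvd_triv_left)
    then obtain k where k: "card B = p ^ k" using assms(2) by (auto simp: divides_primepow_nat)
    have "k \<noteq> 0"
    proof
      assume "k = 0"
      then have "card B = 1" using k by simp
      moreover have "z \<in> B" using orbit_refl[OF z(1)] z(2) by simp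
      ultimately have "B = {z}" by (metis card_1_singletonE singletonD)
      then have "\<forall>g\<in>carrier G. \<phi> g z = z" "z \<noteq> x0"
        using z(2) B by (auto simp: orbit_def)
      then show False using none z(1) by blast
    qed
    then show ?thesis using k by simp
  qed
  then have "p dvd (\<Sum>B\<in>orbits G E \<phi> - {{x0}}. card B)" by (rule dvd_sum)
  moreover have "card E = (\<Sum>B\<in>orbits G E \<phi>. card B)"
    using disjoint_sum[OF assms(4), of "\<lambda>_. 1::nat"] by simp
  moreover have "{x0} \<in> orbits G E \<phi>" using orb0 x0(1) by (auto simp: orbits_def)
  ultimately have "p dvd (\<Sum>B\<in>orbits G E \<phi> - {{x0}}. card B)"
    "p dvd (\<Sum>B\<in>orbits G E \<phi> - {{x0}}. card B) + 1"
    using assms(5) fin by (simp_all add: sum.remove)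
  then have "p dvd 1" using dvd_add_right_iff by blast
  then show False using assms(2) by simp
qed

lemma p_group_nontrivial_center:
  fixes G (structure)
  assumes "prime p" "finite_p_group p G" "carrier G \<noteq> {\<one>}"
  shows "\<exists>z\<in>carrier G. z \<noteq> \<one> \<and> (\<forall>g\<in>carrier G. g \<otimes> z = z \<otimes> g)"
proof -
  interpret group G using assms(2) by (simp add: finite_p_group_def)
  obtain n where n: "order G = p ^ n" and fin: "finite (carrier G)"
    using assms(2) by (auto simp: finite_p_group_def order_def)
  have "n \<noteq> 0"
  proof
    assume "n = 0"
    then have "card (carrier G) = 1" using n by (simp add: order_def)
    then show False using assms(3) one_closed by (metis card_1_singletonE singletonD)
  qed
  then have "p dvd card (carrier G)" using n by (simp add: order_def)
  from fixed_points_of_p_group[OF action_by_conjugation assms(1) n fin this one_closed]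
  obtain z where z: "z \<in> carrier G" "z \<noteq> \<one>" "\<And>g. g \<in> carrier G \<Longrightarrow> g \<otimes> z \<otimes> inv g = z"
    by auto
  then have "g \<otimes> z = z \<otimes> g" if "g \<in> carrier G" for g
    using that by (metis inv_solve_right' m_closed)
  then show ?thesis using z by blast
qed

lemma p_group_central_element_of_order_p:
  fixes G (structure)
  assumes "prime p" "finite_p_group p G" "carrier G \<noteq> {\<one>}"
  shows "\<exists>z\<in>carrier G. z \<noteq> \<one> \<and> z [^] p = \<one> \<and> (\<forall>g\<in>carrier G. g \<otimes> z = z \<otimes> g)"
proof -
  interpret group G using assms(2) by (simp add: finite_p_group_def)
  obtain n where n: "order G = p ^ n"
    using assms(2) by (auto simp: finite_p_group_def order_def)
  obtain z where z: "z \<in> carrier G" "z \<noteq> \<one>" "\<And>g. g \<in> carrier G \<Longrightarrow> g \<otimes> z = z \<otimes> g"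
    using p_group_nontrivial_center[OF assms] by blast
  define k where "k = (LEAST k. z [^] (p ^ k) = \<one>)"
  have k: "z [^] (p ^ k) = \<one>"
    unfolding k_def by (rule LeastI[of _ n]) (use z(1) pow_order_eq_1 n in metis)
  then have "k \<noteq> 0" using z by (metis nat_pow_eone power_0)
  then obtain l where l: "k = Suc l" using not0_implies_Suc by blast
  let ?w = "z [^] (p ^ l)"
  have "?w \<noteq> \<one>" using not_less_Least[of l "\<lambda>k. z [^] (p ^ k) = \<one>"] l by (simp add: k_def)
  moreover have "?w [^] p = \<one>" using k l z(1) by (simp add: nat_pow_pow mult.commute)
  moreover have "g \<otimes> z [^] (m::nat) = z [^] m \<otimes> g" if "g \<in> carrier G" for g m
  proof (induction m)
    case (Suc m)
    have "g \<otimes> z [^] Suc m = (g \<otimes> z [^] m) \<otimes> z" using that z(1) by (simp add: m_assoc)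
    also have "\<dots> = z [^] m \<otimes> (g \<otimes> z)" using Suc that z(1) by (simp add: m_assoc)
    also have "g \<otimes> z = z \<otimes> g" using that by (rule z(3))
    also have "z [^] m \<otimes> (z \<otimes> g) = z [^] Suc m \<otimes> g" using that z(1) by (simp add: m_assoc)
    finally show ?case .
  qed (use that in simp)
  ultimately show ?thesis using z(1) by (intro bexI[of _ ?w]) auto
qed

text \<open>
  The central elements whose \<open>p\<close>-th power is trivial form an invariant subgroup that is not trivial, and \<open>V\<close> is a nontrivial invariant
  subgroup of it with the fewest elements.
\<close>
lemma minimal_invariant_central_subgroup:
  fixes G (structure)
  assumes "prime p" "finite_p_group p G" "carrier G \<noteq> {\<one>}" "automorphism_action H G \<psi>"
  obtains V where "subgroup V G" "V \<noteq> {\<one>}" "\<And>h. h \<in> carrier H \<Longrightarrow> \<psi> h ` V \<subseteq> V"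
    "\<And>v x. \<lbrakk>v \<in> V; x \<in> carrier G\<rbrakk> \<Longrightarrow> v \<otimes> x = x \<otimes> v" "\<And>v. v \<in> V \<Longrightarrow> v [^] p = \<one>"
    "\<And>W. \<lbrakk>subgroup W G; W \<subseteq> V; \<forall>h\<in>carrier H. \<psi> h ` W \<subseteq> W\<rbrakk> \<Longrightarrow> W = {\<one>} \<or> W = V"
proof -
  interpret automorphism_action H G \<psi> by fact
  have fin: "finite (carrier G)" using assms(2) by (simp add: finite_p_group_def)
  define Z where "Z = {z \<in> carrier G. z [^] p = \<one> \<and> (\<forall>g\<in>carrier G. g \<otimes> z = z \<otimes> g)}"
  have comm: "z \<otimes> y = y \<otimes> z" if "z \<in> Z" "y \<in> carrier G" for y z using that by (simp add: Z_def)
  have Z: "subgroup Z G"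
  proof
    show "Z \<subseteq> carrier G" by (auto simp: Z_def)
    show "\<one> \<in> Z" by (simp add: Z_def)
    show "x \<otimes> y \<in> Z" if xy: "x \<in> Z" "y \<in> Z" for x y
    proof -
      have c: "x \<in> carrier G" "y \<in> carrier G" "x [^] p = \<one>" "y [^] p = \<one>"
        using xy by (auto simp: Z_def)
      have "g \<otimes> (x \<otimes> y) = (x \<otimes> y) \<otimes> g" if g: "g \<in> carrier G" for g
      proof -
        have "g \<otimes> (x \<otimes> y) = (x \<otimes> g) \<otimes> y" using comm[OF xy(1) g] c g by (simp add: G.m_assoc)
        also have "\<dots> = x \<otimes> (y \<otimes> g)" using comm[OF xy(2) g] c g by (simp add: G.m_assoc)
        finally show ?thesis using c g by (simp add: G.m_assoc)
      qed
      moreover have "(x \<otimes> y) [^] p = \<one>"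
        using G.pow_mult_distrib[OF comm[OF xy(1) c(2)] c(1,2)] c by simp
      ultimately show ?thesis using c by (simp add: Z_def)
    qed
    show "inv x \<in> Z" if x: "x \<in> Z" for x
    proof -
      have c: "x \<in> carrier G" "x [^] p = \<one>" using x by (auto simp: Z_def)
      have "g \<otimes> inv x = inv x \<otimes> g" if g: "g \<in> carrier G" for g
        using comm[OF x, of "inv g"] g c by (metis G.inv_closed G.inv_inv G.inv_mult_group)
      then show ?thesis using c by (simp add: Z_def G.nat_pow_inv)
    qed
  qed
  have Z_inv: "\<psi> h ` Z \<subseteq> Z" if h: "h \<in> carrier H" for h
  proof
    fix y assume "y \<in> \<psi> h ` Z"
    then obtain x where x: "x \<in> Z" "y = \<psi> h x" by blast
    have c: "x \<in> carrier G" "x [^] p = \<one>" using x by (auto simp: Z_def)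
    have "g \<otimes> y = y \<otimes> g" if g: "g \<in> carrier G" for g
    proof -
      let ?g = "\<psi> (inv\<^bsub>H\<^esub> h) g"
      have "\<psi> h (?g \<otimes> x) = \<psi> h (x \<otimes> ?g)" using comm[OF x(1), of ?g] h g by simp
      then show ?thesis using h g c x(2) by (simp add: act_prod act_inverse)
    qed
    moreover have "y [^] p = \<one>" using act_pow[OF h c(1), of p] c x(2) by (simp add: act_G_one h)
    ultimately show "y \<in> Z" using c h x(2) by (simp add: Z_def)
  qed
  define A where "A W \<longleftrightarrow> subgroup W G \<and> W \<subseteq> Z \<and> W \<noteq> {\<one>} \<and> (\<forall>h\<in>carrier H. \<psi> h ` W \<subseteq> W)" for W
  have "Z \<noteq> {\<one>}"
    using p_group_central_element_of_order_p[OF assms(1-3)] by (auto simp: Z_def)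
  then have "A Z" using Z Z_inv by (simp add: A_def)
  from ex_has_least_nat[of A, OF this, of card]
  obtain V where AV: "A V" and least: "\<And>W. A W \<Longrightarrow> card V \<le> card W"
    by auto
  have V: "subgroup V G" "V \<subseteq> Z" "V \<noteq> {\<one>}" "\<forall>h\<in>carrier H. \<psi> h ` V \<subseteq> V"
    using AV by (simp_all add: A_def)
  show ?thesis
  proof (rule that[of V])
    show "W = {\<one>} \<or> W = V"
      if W: "subgroup W G" "W \<subseteq> V" "\<forall>h\<in>carrier H. \<psi> h ` W \<subseteq> W" for W
    proof -
      have "finite V" using V(1) fin by (meson finite_subset subgroup.subset)
      moreover have "card V \<le> card W" if "W \<noteq> {\<one>}"
        using that W V(2) by (intro least) (auto simp: A_def)
      ultimately show ?thesis using W(2) card_seteq by blast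
    qed
    show "subgroup V G" "V \<noteq> {\<one>}" by fact+
    show "\<psi> h ` V \<subseteq> V" if "h \<in> carrier H" for h using V(4) that by simp
    show "v \<otimes> x = x \<otimes> v" if "v \<in> V" "x \<in> carrier G" for v x
      using that V(2) by (intro comm) auto
    show "v [^] p = \<one>" if "v \<in> V" for v using that V(2) by (auto simp: Z_def)
  qed
qed

lemma action_on_carrier:
  assumes "automorphism_action H G \<psi>"
  shows "group_action H (carrier G) (\<lambda>h. restrict (\<psi> h) (carrier G))"
proof -
  interpret automorphism_action H G \<psi> by fact
  have bij: "restrict (\<psi> h) (carrier G) \<in> Bij (carrier G)" if h: "h \<in> carrier H" for h
  proof -
    have "bij_betw (\<psi> h) (carrier G) (carrier G)"
      by (rule bij_betwI[of _ _ _ "\<psi> (inv\<^bsub>H\<^esub> h)"]) (use h act_inverse in auto)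
    then show ?thesis by (simp add: Bij_def cong: bij_betw_cong)
  qed
  show ?thesis
  proof (unfold group_action_def group_hom_def group_hom_axioms_def, intro conjI homI)
    show "restrict (\<psi> (h \<otimes>\<^bsub>H\<^esub> k)) (carrier G) =
        restrict (\<psi> h) (carrier G) \<otimes>\<^bsub>BijGroup (carrier G)\<^esub> restrict (\<psi> k) (carrier G)"
      if "h \<in> carrier H" "k \<in> carrier H" for h k
      using that bij by (auto simp: BijGroup_def compose_def act_mult intro!: restrict_ext)
  qed (use bij group_BijGroup in \<open>auto simp: BijGroup_def\<close>)
qed

text \<open>
  An abelian group of exponent \<open>p\<close>, written multiplicatively, as a vector space over the field with \<open>p\<close> elements: the scalar \<open>a\<close> acts
  as the \<open>a\<close>-th power.
\<close>
definition elementary_module :: "'a monoid \<Rightarrow> (int, 'a) module" where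
  "elementary_module A =
     \<lparr>carrier = carrier A, monoid.mult = monoid.mult A, one = \<one>\<^bsub>A\<^esub>, ring.zero = \<one>\<^bsub>A\<^esub>,
      ring.add = monoid.mult A, smult = (\<lambda>a x. x [^]\<^bsub>A\<^esub> a)\<rparr>"

lemma elementary_module_group_algebra_module:
  assumes "prime p" "comm_group A" and A: "automorphism_action H A \<psi>"
    and expo: "\<And>x. x \<in> carrier A \<Longrightarrow> x [^]\<^bsub>A\<^esub> p = \<one>\<^bsub>A\<^esub>"
  shows "group_algebra_module (residue_ring (int p)) H (elementary_module A)
    (\<lambda>h. restrict (\<psi> h) (carrier A))"
proof -
  interpret A: comm_group A by fact
  interpret act: automorphism_action H A \<psi> by fact
  interpret K: residues_prime p "residue_ring (int p)" using assms(1) by unfold_locales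
  let ?V = "elementary_module A"
  have V [simp]: "carrier ?V = carrier A" "x \<oplus>\<^bsub>?V\<^esub> y = x \<otimes>\<^bsub>A\<^esub> y" "\<zero>\<^bsub>?V\<^esub> = \<one>\<^bsub>A\<^esub>"
    "a \<odot>\<^bsub>?V\<^esub> x = x [^]\<^bsub>A\<^esub> a" for x y a
    by (simp_all add: elementary_module_def)
  have mod: "x [^]\<^bsub>A\<^esub> (a mod int p) = x [^]\<^bsub>A\<^esub> a" if "x \<in> carrier A" for x and a :: int
  proof -
    have "x [^]\<^bsub>A\<^esub> a = x [^]\<^bsub>A\<^esub> (int p * (a div int p) + a mod int p)" by simp
    also have "\<dots> = (x [^]\<^bsub>A\<^esub> int p) [^]\<^bsub>A\<^esub> (a div int p) \<otimes>\<^bsub>A\<^esub> x [^]\<^bsub>A\<^esub> (a mod int p)"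
      using that by (simp only: A.int_pow_mult A.int_pow_pow)
    also have "x [^]\<^bsub>A\<^esub> int p = \<one>\<^bsub>A\<^esub>" using expo[OF that] by (simp add: int_pow_int)
    finally show ?thesis using that by simp
  qed
  have "module (residue_ring (int p)) ?V"
  proof (rule moduleI)
    show "cring (residue_ring (int p))" by (rule K.cring)
    show "abelian_group ?V"
    proof (rule abelian_groupI)
      show "\<exists>y\<in>carrier ?V. y \<oplus>\<^bsub>?V\<^esub> x = \<zero>\<^bsub>?V\<^esub>" if "x \<in> carrier ?V" for x
        using that by (intro bexI[of _ "inv\<^bsub>A\<^esub> x"]) auto
    qed (auto simp: A.m_ac)
  qed (auto simp: residue_ring_def mod A.int_pow_mult A.int_pow_distrib A.int_pow_pow mult.commute)
  moreover have "\<psi> h (x [^]\<^bsub>A\<^esub> a) = \<psi> h x [^]\<^bsub>A\<^esub> a" if "h \<in> carrier H" "x \<in> carrier A" for h x and a :: int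
  proof -
    interpret group_hom A A "\<psi> h"
      using that act.act_hom by unfold_locales auto
    show ?thesis using that by (simp add: hom_int_pow)
  qed
  then have "restrict (\<psi> h) (carrier A) \<in> module_hom (residue_ring (int p)) ?V ?V" if "h \<in> carrier H" for h
    using that by (auto simp: module_hom_def act.act_prod)
  ultimately show ?thesis
    using action_on_carrier[OF A] by (simp add: group_algebra_module_def group_algebra_module_axioms_def)
qed

text \<open>
  Minimality among the invariant subgroups is simplicity of the associated module. A copy of that module on the natural numbers is
  isomorphic to one of the chosen representatives.
\<close>
lemma minimal_subgroup_representative:
  fixes G (structure) and S :: "((int, nat) module \<times> ('h \<Rightarrow> nat \<Rightarrow> nat)) set"
  assumes "prime p" and G: "automorphism_action H G \<psi>" and fin: "finite (carrier G)"
    and S: "simple_module_representatives (residue_ring (int p)) H S"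
    and V0: "subgroup V0 G" "V0 \<noteq> {\<one>}" "\<And>h. h \<in> carrier H \<Longrightarrow> \<psi> h ` V0 \<subseteq> V0"
    "\<And>v w. \<lbrakk>v \<in> V0; w \<in> V0\<rbrakk> \<Longrightarrow> v \<otimes> w = w \<otimes> v" "\<And>v. v \<in> V0 \<Longrightarrow> v [^] p = \<one>"
    and minimal: "\<And>W. \<lbrakk>subgroup W G; W \<subseteq> V0; \<forall>h\<in>carrier H. \<psi> h ` W \<subseteq> W\<rbrakk> \<Longrightarrow> W = {\<one>} \<or> W = V0"
  obtains V \<rho> j where "(V, \<rho>) \<in> S" "bij_betw j V0 (carrier V)"
    "\<And>x y. \<lbrakk>x \<in> V0; y \<in> V0\<rbrakk> \<Longrightarrow> j (x \<otimes> y) = j x \<oplus>\<^bsub>V\<^esub> j y"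
    "\<And>h x. \<lbrakk>h \<in> carrier H; x \<in> V0\<rbrakk> \<Longrightarrow> j (\<psi> h x) = \<rho> h (j x)"
proof -
  interpret automorphism_action H G \<psi> by fact
  interpret V0: subgroup V0 G by fact
  define A0 where "A0 = G\<lparr>carrier := V0\<rparr>"
  have A0 [simp]: "carrier A0 = V0" "x \<otimes>\<^bsub>A0\<^esub> y = x \<otimes> y" "\<one>\<^bsub>A0\<^esub> = \<one>" for x y
    by (simp_all add: A0_def)
  interpret A0: group A0 unfolding A0_def by (rule G.subgroup_imp_group[OF V0(1)])
  have A0_act: "automorphism_action H A0 \<psi>"
  proof
    show "\<psi> h \<in> hom A0 A0" if "h \<in> carrier H" for h
      using that V0(3)[OF that] by (auto simp: hom_def act_prod)
  qed (auto simp: act_mult act_one)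
  have fin0: "finite (carrier A0)" using fin V0.subset finite_subset by auto
  have inv0: "\<psi> h ` {\<one>\<^bsub>A0\<^esub>} \<subseteq> {\<one>\<^bsub>A0\<^esub>}" if "h \<in> carrier H" for h
    using that act_G_one by simp
  obtain A :: "nat monoid" and \<psi>' \<pi> where A: "automorphism_action H A \<psi>'"
    and \<pi>: "\<pi> \<in> hom A0 A" "\<pi> ` carrier A0 = carrier A"
    and ker: "\<And>x. x \<in> carrier A0 \<Longrightarrow> \<pi> x = \<one>\<^bsub>A\<^esub> \<longleftrightarrow> x \<in> {\<one>\<^bsub>A0\<^esub>}"
    and eq: "\<And>h x. \<lbrakk>h \<in> carrier H; x \<in> carrier A0\<rbrakk> \<Longrightarrow> \<pi> (\<psi> h x) = \<psi>' h (\<pi> x)"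
    by (rule finite_quotient_model[OF A0_act fin0 A0.one_is_normal inv0 infinite_UNIV_nat]) (assumption, rule that)
  interpret A: automorphism_action H A \<psi>' by fact
  interpret \<pi>: group_hom A0 A \<pi> using \<pi>(1) by unfold_locales
  have surj: "\<pi> ` V0 = carrier A" using \<pi>(2) by simp
  have \<pi>m: "\<pi> (x \<otimes> y) = \<pi> x \<otimes>\<^bsub>A\<^esub> \<pi> y" if "x \<in> V0" "y \<in> V0" for x y
    using \<pi>.hom_mult[of x y] that by simp
  have \<pi>1: "\<pi> \<one> = \<one>\<^bsub>A\<^esub>" using \<pi>.hom_one by simp
  have inj: "inj_on \<pi> V0"
    using \<pi>.inj_on_one_iff ker by auto
  have cA: "comm_group A"
  proof (rule A.G.group_comm_groupI)
    fix x y assume "x \<in> carrier A" "y \<in> carrier A"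
    then obtain a b where ab: "a \<in> V0" "b \<in> V0" "x = \<pi> a" "y = \<pi> b" by (auto simp flip: surj)
    then show "x \<otimes>\<^bsub>A\<^esub> y = y \<otimes>\<^bsub>A\<^esub> x" using V0(4)[of a b] by (simp flip: \<pi>m)
  qed
  have expo: "x [^]\<^bsub>A\<^esub> p = \<one>\<^bsub>A\<^esub>" if x: "x \<in> carrier A" for x
  proof -
    obtain a where a: "a \<in> V0" "x = \<pi> a" using x by (auto simp flip: surj)
    have "a [^]\<^bsub>A0\<^esub> p = \<one>" using V0(5)[OF a(1)] by (simp add: A0_def flip: G.nat_pow_consistent)
    then show ?thesis using \<pi>.hom_nat_pow[of a p] a \<pi>1 by simp
  qed
  let ?K = "residue_ring (int p)"
  define M where "M = elementary_module A"
  define \<sigma> where "\<sigma> h = restrict (\<psi>' h) (carrier A)" for h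
  have M [simp]: "carrier M = carrier A" "x \<oplus>\<^bsub>M\<^esub> y = x \<otimes>\<^bsub>A\<^esub> y" "\<zero>\<^bsub>M\<^esub> = \<one>\<^bsub>A\<^esub>" for x y
    by (simp_all add: M_def elementary_module_def)
  have gam: "group_algebra_module ?K H M \<sigma>"
    unfolding M_def \<sigma>_def using assms(1) cA A expo by (rule elementary_module_group_algebra_module)
  interpret M: group_algebra_module ?K H M \<sigma> by (rule gam)
  have simple: "W = {\<zero>\<^bsub>M\<^esub>} \<or> W = carrier M" if W: "group_algebra_submodule ?K H W M \<sigma>" for W
  proof -
    have "abelian_subgroup W M"
      using W M.submodule_abelian_subgroup by (simp add: group_algebra_submodule_def)
    then have subW: "subgroup W (add_monoid M)"
      by (simp add: abelian_subgroup_def additive_subgroup_def)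
    have WA: "W \<subseteq> carrier A" using subgroup.subset[OF subW] by simp
    define W0 where "W0 = {x \<in> V0. \<pi> x \<in> W}"
    have W0W: "\<pi> ` W0 = W" using WA surj by (auto simp: W0_def)
    have mW: "x \<otimes>\<^bsub>A\<^esub> y \<in> W" if "x \<in> W" "y \<in> W" for x y
      using subgroup.m_closed[OF subW that] by simp
    have oneW: "\<one>\<^bsub>A\<^esub> \<in> W" using subgroup.one_closed[OF subW] by simp
    have invW: "inv\<^bsub>A\<^esub> x \<in> W" if "x \<in> W" for x
    proof -
      have i: "inv\<^bsub>add_monoid M\<^esub> x \<in> W" using subgroup.m_inv_closed[OF subW that] .
      have "inv\<^bsub>add_monoid M\<^esub> x \<otimes>\<^bsub>A\<^esub> x = \<one>\<^bsub>A\<^esub>"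
        using group.l_inv[OF abelian_group.a_group[OF M.M.abelian_group_axioms], of x] that WA by auto
      then have "inv\<^bsub>A\<^esub> x = inv\<^bsub>add_monoid M\<^esub> x"
        using that WA i by (intro A.G.inv_equality) auto
      then show ?thesis using i by simp
    qed
    have "subgroup W0 G"
    proof
      show "inv x \<in> W0" if "x \<in> W0" for x
      proof -
        have x: "x \<in> V0" "\<pi> x \<in> W" using that by (auto simp: W0_def)
        have "\<pi> (inv x) \<otimes>\<^bsub>A\<^esub> \<pi> x = \<one>\<^bsub>A\<^esub>"
          using x \<pi>m[of "inv x" x] \<pi>1 by simp
        then have "inv\<^bsub>A\<^esub> (\<pi> x) = \<pi> (inv x)"
          using x surj by (intro A.G.inv_equality) auto
        then show ?thesis using x invW[of "\<pi> x"] by (auto simp: W0_def)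
      qed
    qed (use \<pi>1 oneW mW in \<open>auto simp: W0_def \<pi>m\<close>)
    moreover have "\<forall>h\<in>carrier H. \<psi> h ` W0 \<subseteq> W0"
    proof
      fix h assume h: "h \<in> carrier H"
      have "\<sigma> h ` W \<subseteq> W" using W h by (simp add: group_algebra_submodule_def)
      then show "\<psi> h ` W0 \<subseteq> W0" using h V0(3)[OF h] WA eq[OF h] by (fastforce simp: W0_def \<sigma>_def)
    qed
    moreover have "W0 \<subseteq> V0" by (auto simp: W0_def)
    ultimately have "W0 = {\<one>} \<or> W0 = V0" by (intro minimal)
    then show ?thesis using W0W surj \<pi>1 by auto
  qed
  have "carrier M \<noteq> {\<zero>\<^bsub>M\<^esub>}"
  proof
    assume "carrier M = {\<zero>\<^bsub>M\<^esub>}"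
    then have "x = \<one>" if "x \<in> V0" for x using ker[of x] that surj by auto
    then show False using V0(2) V0.one_closed by blast
  qed
  then have "simple_group_algebra_module ?K H M \<sigma>"
    using gam simple by (simp add: simple_group_algebra_module_def)
  moreover have "finite (carrier M)" using fin V0.subset surj by (metis M(1) finite_imageI finite_subset)
  then have "fin_gen_group_algebra_module ?K H M \<sigma>"
    unfolding fin_gen_group_algebra_module_def using gam
    by (auto intro!: exI[of _ "carrier M"] simp: group_algebra_submodule_def LinearCombinations.submodule_def)
  ultimately obtain V \<rho> where V: "(V, \<rho>) \<in> S"
    and iso: "isomorphic_group_algebra_modules ?K H (M, \<sigma>) (V, \<rho>)"
    using S unfolding simple_module_representatives_def by (metis surj_pair)
  then obtain f where f: "f \<in> module_hom ?K M V" "bij_betw f (carrier A) (carrier V)"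
    and feq: "\<And>h v. \<lbrakk>h \<in> carrier H; v \<in> carrier A\<rbrakk> \<Longrightarrow> f (\<sigma> h v) = \<rho> h (f v)"
    by (auto simp: isomorphic_group_algebra_modules_def)
  have fm: "f (x \<otimes>\<^bsub>A\<^esub> y) = f x \<oplus>\<^bsub>V\<^esub> f y" if "x \<in> carrier A" "y \<in> carrier A" for x y
    using f(1) that by (auto simp: module_hom_def)
  have \<pi>A: "\<pi> x \<in> carrier A" if "x \<in> V0" for x using that surj by auto
  show ?thesis
  proof (rule that[OF V, of "f \<circ> \<pi>"])
    show "bij_betw (f \<circ> \<pi>) V0 (carrier V)"
      using inj surj f(2) by (intro bij_betw_trans[of \<pi> V0 "carrier A"]) (auto simp: bij_betw_def)
    show "(f \<circ> \<pi>) (x \<otimes> y) = (f \<circ> \<pi>) x \<oplus>\<^bsub>V\<^esub> (f \<circ> \<pi>) y" if "x \<in> V0" "y \<in> V0" for x y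
      using that fm \<pi>A by (simp add: \<pi>m)
    show "(f \<circ> \<pi>) (\<psi> h x) = \<rho> h ((f \<circ> \<pi>) x)" if "h \<in> carrier H" "x \<in> V0" for h x
      using that feq[of h "\<pi> x"] eq[of h x] \<pi>A by (simp add: \<sigma>_def)
  qed
qed

section \<open>Counting and induction\<close>

lemma equivariant_homs_finite_source:
  assumes "finite (carrier G)" "finite (carrier A)"
  shows "finite (equivariant_homs H G T \<phi> A \<rho>)"
proof (rule finite_subset)
  show "equivariant_homs H G T \<phi> A \<rho> \<subseteq> carrier G \<rightarrow>\<^sub>E carrier A"
    by (auto simp: equivariant_homs_def hom_def PiE_def)
  show "finite (carrier G \<rightarrow>\<^sub>E carrier A)" using assms by (intro finite_PiE) auto
qed

lemma simple_module_finite_p_group: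
  fixes V :: "(int, 'v) module"
  assumes "prime p" "finite (carrier H)" "simple_group_algebra_module (residue_ring (int p)) H V \<rho>"
  shows "finite_p_group p (add_monoid V)"
proof -
  interpret group_algebra_module "residue_ring (int p)" H V \<rho>
    using assms(3) by (simp add: simple_group_algebra_module_def)
  interpret K: residues_prime p "residue_ring (int p)" using assms(1) by unfold_locales
  have K: "finite (carrier (residue_ring (int p)))" "card (carrier (residue_ring (int p))) = p"
    by (simp_all add: residue_ring_def)
  have "finite (carrier V)" using K(1) assms(2,3) by (rule simple_module_finite)
  moreover have "vectorspace (residue_ring (int p)) V"
    using M.module_axioms K.is_field by (simp add: vectorspace_def)
  ultimately have "card (carrier V) = p ^ vectorspace.dim (residue_ring (int p)) V"
    using card_vectorspace K by metis
  then show ?thesis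
    using \<open>finite (carrier V)\<close> M.a_group by (auto simp: finite_p_group_def)
qed

lemma representatives_simple:
  assumes "simple_module_representatives K H S" "(V, \<rho>) \<in> S"
  shows "simple_group_algebra_module K H V \<rho>" "group_algebra_module K H V \<rho>"
  using assms by (auto simp: simple_module_representatives_def simple_group_algebra_module_def)

lemma equivariant_homs_surj_imp_epi:
  assumes "f \<in> equivariant_homs H G T \<phi> Q \<psi>" "carrier Q \<subseteq> f ` carrier G"
  shows "equivariant_epi H G T \<phi> Q \<psi> f"
  using assms by (auto simp: equivariant_homs_def equivariant_epi_def continuous_homs_def hom_def)

lemma card_equivariant_homs_le:
  assumes "automorphism_action H G \<psi>" "topspace TG = carrier G"
    and "equivariant_epi H G TG \<psi> Q \<psi>' \<pi>" and "finite (equivariant_homs H G TG \<psi> A \<rho>)"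
  shows "card (equivariant_homs H Q T' \<psi>' A \<rho>) \<le> card (equivariant_homs H G TG \<psi> A \<rho>)"
  using inj_on_pullback[OF assms(3)] pullback_equivariant_homs[OF assms(1-3)] assms(4)
  by (intro card_inj_on_le[of "pullback G \<pi>"]) blast+

text \<open>
  If \<open>P\<close> is the direct product of the invariant subgroups \<open>Q0\<close> and \<open>V0\<close>, an equivariant homomorphism on \<open>V0\<close> extends to \<open>P\<close> by the
  projection along \<open>Q0\<close>.
\<close>
lemma complement_projection:
  fixes P :: "'a monoid" and A :: "('v, 'm) monoid_scheme"
  assumes P: "automorphism_action H P \<psi>"
    and Q0: "subgroup Q0 P" "\<And>h. h \<in> carrier H \<Longrightarrow> \<psi> h ` Q0 \<subseteq> Q0"
    and V0: "subgroup V0 P" "\<And>h. h \<in> carrier H \<Longrightarrow> \<psi> h ` V0 \<subseteq> V0"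
      "\<And>v x. \<lbrakk>v \<in> V0; x \<in> carrier P\<rbrakk> \<Longrightarrow> v \<otimes>\<^bsub>P\<^esub> x = x \<otimes>\<^bsub>P\<^esub> v"
    and gen: "\<And>x. x \<in> carrier P \<Longrightarrow> \<exists>q\<in>Q0. \<exists>v\<in>V0. x = q \<otimes>\<^bsub>P\<^esub> v"
    and int: "Q0 \<inter> V0 = {\<one>\<^bsub>P\<^esub>}"
    and j: "\<And>v. v \<in> V0 \<Longrightarrow> j v \<in> carrier A"
      "\<And>v w. \<lbrakk>v \<in> V0; w \<in> V0\<rbrakk> \<Longrightarrow> j (v \<otimes>\<^bsub>P\<^esub> w) = j v \<otimes>\<^bsub>A\<^esub> j w"
      "\<And>h v. \<lbrakk>h \<in> carrier H; v \<in> V0\<rbrakk> \<Longrightarrow> j (\<psi> h v) = \<rho> h (j v)"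
  shows "\<exists>k \<in> equivariant_homs H P (discrete_topology (carrier P)) \<psi> A \<rho>. \<forall>v\<in>V0. k v = j v"
proof -
  interpret P: automorphism_action H P \<psi> by fact
  interpret Q0: subgroup Q0 P by fact
  interpret V0: subgroup V0 P by fact
  define pr where "pr x = (THE v. v \<in> V0 \<and> (\<exists>q\<in>Q0. x = q \<otimes>\<^bsub>P\<^esub> v))" for x
  have pr: "pr (q \<otimes>\<^bsub>P\<^esub> v) = v" if q: "q \<in> Q0" and v: "v \<in> V0" for q v
    unfolding pr_def
  proof (rule the_equality)
    show "v \<in> V0 \<and> (\<exists>q'\<in>Q0. q \<otimes>\<^bsub>P\<^esub> v = q' \<otimes>\<^bsub>P\<^esub> v)" using q v by blast
    fix w assume "w \<in> V0 \<and> (\<exists>q'\<in>Q0. q \<otimes>\<^bsub>P\<^esub> v = q' \<otimes>\<^bsub>P\<^esub> w)"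
    then obtain q' where w: "w \<in> V0" "q' \<in> Q0" "q \<otimes>\<^bsub>P\<^esub> v = q' \<otimes>\<^bsub>P\<^esub> w" by blast
    have "inv\<^bsub>P\<^esub> q' \<otimes>\<^bsub>P\<^esub> q = (inv\<^bsub>P\<^esub> q' \<otimes>\<^bsub>P\<^esub> (q \<otimes>\<^bsub>P\<^esub> v)) \<otimes>\<^bsub>P\<^esub> inv\<^bsub>P\<^esub> v"
      using q v w(1,2) by (simp add: P.G.m_assoc)
    also have "\<dots> = w \<otimes>\<^bsub>P\<^esub> inv\<^bsub>P\<^esub> v"
      unfolding w(3) using v w(1,2) by (simp flip: P.G.m_assoc)
    finally have eq: "inv\<^bsub>P\<^esub> q' \<otimes>\<^bsub>P\<^esub> q = w \<otimes>\<^bsub>P\<^esub> inv\<^bsub>P\<^esub> v" .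
    have "w \<otimes>\<^bsub>P\<^esub> inv\<^bsub>P\<^esub> v \<in> Q0" unfolding eq[symmetric] using q w(2) by simp
    moreover have "w \<otimes>\<^bsub>P\<^esub> inv\<^bsub>P\<^esub> v \<in> V0" using v w by simp
    ultimately have "w \<otimes>\<^bsub>P\<^esub> inv\<^bsub>P\<^esub> v = \<one>\<^bsub>P\<^esub>" using int by blast
    then show "w = v" using v w(1) by (simp add: P.G.inv_solve_right')
  qed
  have "restrict (\<lambda>x. j (pr x)) (carrier P) \<in> equivariant_homs H P (discrete_topology (carrier P)) \<psi> A \<rho>"
  proof (rule equivariant_homsI[OF P])
    show "j (pr x) \<in> carrier A" if x: "x \<in> carrier P" for x
      using gen[OF x] j(1) by (auto simp: pr)
    then show "continuous_map (discrete_topology (carrier P)) (discrete_topology (carrier A)) (\<lambda>x. j (pr x))"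
      by auto
    show "j (pr (x \<otimes>\<^bsub>P\<^esub> y)) = j (pr x) \<otimes>\<^bsub>A\<^esub> j (pr y)" if x: "x \<in> carrier P" and y: "y \<in> carrier P" for x y
    proof -
      obtain q v where qv: "q \<in> Q0" "v \<in> V0" "x = q \<otimes>\<^bsub>P\<^esub> v" using gen[OF x] by blast
      obtain r w where rw: "r \<in> Q0" "w \<in> V0" "y = r \<otimes>\<^bsub>P\<^esub> w" using gen[OF y] by blast
      have "x \<otimes>\<^bsub>P\<^esub> y = q \<otimes>\<^bsub>P\<^esub> ((v \<otimes>\<^bsub>P\<^esub> r) \<otimes>\<^bsub>P\<^esub> w)"
        using qv rw by (simp add: P.G.m_assoc)
      also have "v \<otimes>\<^bsub>P\<^esub> r = r \<otimes>\<^bsub>P\<^esub> v" using V0(3) qv rw by simp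
      finally have "x \<otimes>\<^bsub>P\<^esub> y = (q \<otimes>\<^bsub>P\<^esub> r) \<otimes>\<^bsub>P\<^esub> (v \<otimes>\<^bsub>P\<^esub> w)"
        using qv rw by (simp add: P.G.m_assoc)
      then show ?thesis using qv rw j(2) pr[of "q \<otimes>\<^bsub>P\<^esub> r" "v \<otimes>\<^bsub>P\<^esub> w"] by (simp add: pr)
    qed
    show "j (pr (\<psi> h x)) = \<rho> h (j (pr x))" if h: "h \<in> carrier H" and x: "x \<in> carrier P" for h x
    proof -
      obtain q v where qv: "q \<in> Q0" "v \<in> V0" "x = q \<otimes>\<^bsub>P\<^esub> v" using gen[OF x] by blast
      have "\<psi> h q \<in> Q0" "\<psi> h v \<in> V0" using Q0(2)[OF h] V0(2)[OF h] qv by auto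
      then have "pr (\<psi> h x) = \<psi> h v" using qv h by (simp add: P.act_prod pr)
      then show ?thesis using qv h j(3) by (simp add: pr)
    qed
  qed simp
  moreover have "j (pr v) = j v" if "v \<in> V0" for v
    using pr[OF Q0.one_closed that] that by simp
  ultimately show ?thesis by (intro bexI[of _ "restrict (\<lambda>x. j (pr x)) (carrier P)"]) auto
qed

context free_pro_p_action
begin

text \<open>
  A homomorphism from \<open>F\<close> into a finite \<open>p\<close>-group is determined by its values at the \<open>\<gamma>\<close> free generators.
\<close>
lemma finite_equivariant_homs:
  fixes A :: "('a, 'm) monoid_scheme"
  assumes A: "finite_p_group p A" "automorphism_action H A \<rho>"
  shows "finite (equivariant_homs H F T \<phi> A \<rho>)"
proof -
  interpret A: automorphism_action H A \<rho> by fact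
  have fin: "finite (carrier A)" using A(1) by (simp add: finite_p_group_def)
  have inv: "\<rho> h ` {\<one>\<^bsub>A\<^esub>} \<subseteq> {\<one>\<^bsub>A\<^esub>}" if "h \<in> carrier H" for h
    using that A.act_G_one by simp
  have inf: "infinite (UNIV :: nat set set)" by (simp add: Finite_Set.finite_set)
  obtain Q :: "nat set monoid" and \<rho>' \<pi> where Q: "automorphism_action H Q \<rho>'"
    and \<pi>: "\<pi> \<in> hom A Q" "\<pi> ` carrier A = carrier Q"
    and ker: "\<And>x. x \<in> carrier A \<Longrightarrow> \<pi> x = \<one>\<^bsub>Q\<^esub> \<longleftrightarrow> x \<in> {\<one>\<^bsub>A\<^esub>}"
    by (rule finite_quotient_model[OF A(2) fin A.G.one_is_normal inv inf]) (assumption, rule that)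
  interpret Q: automorphism_action H Q \<rho>' by fact
  interpret \<pi>: group_hom A Q \<pi> using \<pi>(1) by unfold_locales
  have inj: "inj_on \<pi> (carrier A)" using \<pi>.inj_on_one_iff ker by auto
  have Qp: "finite_p_group p Q" using prime_p A(1) Q.G.is_group \<pi> by (rule finite_p_group_image)
  show ?thesis
  proof (rule free_pro_p_group_generators[OF prime_p free])
    fix x assume x: "x \<in> {..<\<gamma>} \<rightarrow> carrier F"
      and uniq: "\<And>(G :: nat set monoid) f f' a. \<lbrakk>finite_p_group p G;
        f \<in> hom F G; continuous_map T (discrete_topology (carrier G)) f;
        f' \<in> hom F G; continuous_map T (discrete_topology (carrier G)) f';
        \<And>i. i < \<gamma> \<Longrightarrow> f (x i) = f' (x i); a \<in> carrier F\<rbrakk> \<Longrightarrow> f a = f' a"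
    let ?E = "equivariant_homs H F T \<phi> A \<rho>"
    let ?r = "\<lambda>k. \<lambda>i\<in>{..<\<gamma>}. k (x i)"
    have img: "\<pi> \<circ> k \<in> hom F Q" "continuous_map T (discrete_topology (carrier Q)) (\<pi> \<circ> k)"
      if k: "k \<in> ?E" for k
    proof -
      note kD = equivariant_homsD[OF k]
      show "\<pi> \<circ> k \<in> hom F Q" using kD(1) \<pi>(1) by (rule hom_compose)
      show "continuous_map T (discrete_topology (carrier Q)) (\<pi> \<circ> k)"
        by (rule continuous_map_compose[OF kD(2)]) simp
    qed
    have "inj_on ?r ?E"
    proof (rule inj_onI)
      fix k k' assume k: "k \<in> ?E" "k' \<in> ?E" and eq: "?r k = ?r k'"
      show "k = k'"
      proof (rule extensionalityI[OF equivariant_homsD(3)[OF k(1)] equivariant_homsD(3)[OF k(2)]])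
        fix a assume a: "a \<in> carrier F"
        have "(\<pi> \<circ> k) a = (\<pi> \<circ> k') a"
        proof (rule uniq[OF Qp img[OF k(1)] img[OF k(2)] _ a])
          show "(\<pi> \<circ> k) (x i) = (\<pi> \<circ> k') (x i)" if "i < \<gamma>" for i
            using fun_cong[OF eq, of i] that by simp
        qed
        then show "k a = k' a"
          using inj_onD[OF inj] equivariant_homsD(5)[OF k(1) a] equivariant_homsD(5)[OF k(2) a] by simp
      qed
    qed
    moreover have "?r k \<in> {..<\<gamma>} \<rightarrow>\<^sub>E carrier A" if k: "k \<in> ?E" for k
      using equivariant_homsD(5)[OF k] x by (auto simp: Pi_iff)
    then have "?r ` ?E \<subseteq> {..<\<gamma>} \<rightarrow>\<^sub>E carrier A" by blast
    moreover have "finite ({..<\<gamma>} \<rightarrow>\<^sub>E carrier A)" using fin by (intro finite_PiE) auto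
    ultimately show "finite ?E" by (meson finite_imageD finite_subset)
  qed
qed

text \<open>
  As \<open>V0\<close> is central, the pointwise product of \<open>g\<close> and \<open>k\<close> is a homomorphism. Given \<open>x = g a v\<close> with \<open>v\<close> in \<open>V0\<close>, multiplying \<open>a\<close> by
  an element of the kernel of \<open>g\<close> adjusts the value of \<open>k\<close> to \<open>v\<close> and leaves that of \<open>g\<close> alone.
\<close>
lemma epi_by_central_correction:
  fixes P :: "'a monoid"
  assumes P: "automorphism_action H P \<psi>"
    and g: "g \<in> equivariant_homs H F T \<phi> P \<psi>"
    and k: "k \<in> equivariant_homs H F T \<phi> (P\<lparr>carrier := V0\<rparr>) \<psi>"
    and V0: "subgroup V0 P" "\<And>v x. \<lbrakk>v \<in> V0; x \<in> carrier P\<rbrakk> \<Longrightarrow> v \<otimes>\<^bsub>P\<^esub> x = x \<otimes>\<^bsub>P\<^esub> v"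
    and gen: "\<And>x. x \<in> carrier P \<Longrightarrow> \<exists>a\<in>carrier F. \<exists>v\<in>V0. x = g a \<otimes>\<^bsub>P\<^esub> v"
    and ker: "\<And>v. v \<in> V0 \<Longrightarrow> \<exists>y\<in>carrier F. g y = \<one>\<^bsub>P\<^esub> \<and> k y = v"
  shows "\<exists>f. equivariant_epi H F T \<phi> P \<psi> f"
proof -
  interpret P: automorphism_action H P \<psi> by fact
  interpret V0: subgroup V0 P by fact
  note gD = equivariant_homsD[OF g] and kD = equivariant_homsD[OF k, simplified]
  have kP [simp]: "k x \<in> carrier P" if "x \<in> carrier F" for x using kD(5)[OF that] by simp
  have gP [simp]: "g x \<in> carrier P" if "x \<in> carrier F" for x using gD(5)[OF that] .
  let ?f = "\<lambda>x. g x \<otimes>\<^bsub>P\<^esub> k x"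
  have fm: "?f (x \<otimes>\<^bsub>F\<^esub> y) = ?f x \<otimes>\<^bsub>P\<^esub> ?f y" if xy: "x \<in> carrier F" "y \<in> carrier F" for x y
  proof -
    have "?f (x \<otimes>\<^bsub>F\<^esub> y) = g x \<otimes>\<^bsub>P\<^esub> ((g y \<otimes>\<^bsub>P\<^esub> k x) \<otimes>\<^bsub>P\<^esub> k y)"
      using xy by (simp add: gD(6) kD(6) P.G.m_assoc)
    also have "g y \<otimes>\<^bsub>P\<^esub> k x = k x \<otimes>\<^bsub>P\<^esub> g y" using V0(2)[OF kD(5)] xy by simp
    finally show ?thesis using xy by (simp add: P.G.m_assoc)
  qed
  have "restrict ?f (carrier F) \<in> equivariant_homs H F T \<phi> P \<psi>"
  proof (rule equivariant_homsI[OF F_action topspace_T _ fm])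
    show "continuous_map T (discrete_topology (carrier P)) ?f"
      by (rule continuous_map_determined_by_two[OF gD(2) kD(2)]) (auto simp: topspace_T)
  qed (auto simp: gD(4) kD(4) P.act_prod)
  moreover have "carrier P \<subseteq> restrict ?f (carrier F) ` carrier F"
  proof
    fix x assume "x \<in> carrier P"
    then obtain a v where a: "a \<in> carrier F" "v \<in> V0" "x = g a \<otimes>\<^bsub>P\<^esub> v" using gen by blast
    then have "inv\<^bsub>P\<^esub> (k a) \<otimes>\<^bsub>P\<^esub> v \<in> V0" using kD(5) by simp
    then obtain y where y: "y \<in> carrier F" "g y = \<one>\<^bsub>P\<^esub>" "k y = inv\<^bsub>P\<^esub> (k a) \<otimes>\<^bsub>P\<^esub> v"
      using ker by blast
    have "k a \<otimes>\<^bsub>P\<^esub> (inv\<^bsub>P\<^esub> (k a) \<otimes>\<^bsub>P\<^esub> v) = v"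
      using a by (simp flip: P.G.m_assoc)
    then have "?f (a \<otimes>\<^bsub>F\<^esub> y) = x"
      using a y by (simp add: gD(6) kD(6))
    then show "x \<in> restrict ?f (carrier F) ` carrier F"
      using a y by (intro image_eqI[of _ _ "a \<otimes>\<^bsub>F\<^esub> y"]) auto
  qed
  ultimately show ?thesis using equivariant_homs_surj_imp_epi by blast
qed

text \<open>
  If every \<open>k\<close> vanished on the kernel of \<open>g\<close>, then all of \<open>Hom\<^sub>H(F, V)\<close> would come from \<open>Hom\<^sub>H(Q, V)\<close>. But \<open>Hom\<^sub>H(Q, V)\<close> embeds
  into \<open>Hom\<^sub>H(P, V)\<close> and misses \<open>k0\<close>, so it is too small for that.
\<close>
lemma exists_hom_nontrivial_on_kernel:
  fixes P :: "nat set monoid" and Q :: "nat set monoid" and V :: "(int, nat) module"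
  assumes P: "finite_p_group p P" "automorphism_action H P \<psi>"
    and Q: "automorphism_action H Q \<psi>'"
    and \<pi>: "equivariant_epi H P (discrete_topology (carrier P)) \<psi> Q \<psi>' \<pi>"
    and g: "equivariant_epi H F T \<phi> Q \<psi>' g"
    and V: "finite_p_group p (add_monoid V)" "automorphism_action H (add_monoid V) \<rho>"
    and le: "card (equivariant_homs H P (discrete_topology (carrier P)) \<psi> (add_monoid V) \<rho>)
      \<le> card (equivariant_homs H F T \<phi> (add_monoid V) \<rho>)"
    and k0: "k0 \<in> equivariant_homs H P (discrete_topology (carrier P)) \<psi> (add_monoid V) \<rho>"
      "x0 \<in> carrier P" "\<pi> x0 = \<one>\<^bsub>Q\<^esub>" "k0 x0 \<noteq> \<zero>\<^bsub>V\<^esub>"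
  shows "\<exists>k \<in> equivariant_homs H F T \<phi> (add_monoid V) \<rho>. \<exists>y\<in>carrier F. g y = \<one>\<^bsub>Q\<^esub> \<and> k y \<noteq> \<zero>\<^bsub>V\<^esub>"
proof (rule ccontr)
  assume none: "\<not> ?thesis"
  interpret Q: automorphism_action H Q \<psi>' by fact
  interpret V: group "add_monoid V" using V(1) by (simp add: finite_p_group_def)
  let ?P = "equivariant_homs H P (discrete_topology (carrier P)) \<psi> (add_monoid V) \<rho>"
  let ?Q = "equivariant_homs H Q (discrete_topology (carrier Q)) \<psi>' (add_monoid V) \<rho>"
  let ?F = "equivariant_homs H F T \<phi> (add_monoid V) \<rho>"
  have finP: "finite ?P"
    using P(1) V(1) by (intro equivariant_homs_finite_source) (auto simp: finite_p_group_def)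
  have topP: "topspace (discrete_topology (carrier P)) = carrier P" by simp
  have sub: "pullback P \<pi> ` ?Q \<subseteq> ?P"
    using pullback_equivariant_homs[OF P(2) topP \<pi>] by blast
  have "k x0 = \<zero>\<^bsub>V\<^esub>" if k: "k \<in> pullback P \<pi> ` ?Q" for k
  proof -
    obtain k' where k': "k' \<in> ?Q" "k = pullback P \<pi> k'" using k by blast
    have "k' \<one>\<^bsub>Q\<^esub> = \<one>\<^bsub>add_monoid V\<^esub>"
      using hom_one[OF equivariant_homsD(1)[OF k'(1)] Q.G.is_group V.is_group] .
    then show ?thesis using k'(2) k0(2,3) by (simp add: pullback_def)
  qed
  then have "pullback P \<pi> ` ?Q \<subset> ?P" using sub k0(1,4) by blast
  then have "card (pullback P \<pi> ` ?Q) < card ?P" using finP by (rule psubset_card_mono[rotated])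
  then have less: "card ?Q < card ?P" by (simp add: card_image[OF inj_on_pullback[OF \<pi>]])
  have "?F \<subseteq> pullback F g ` ?Q"
  proof
    fix k assume k: "k \<in> ?F"
    have "k x = \<zero>\<^bsub>V\<^esub>" if "x \<in> carrier F" "g x = \<one>\<^bsub>Q\<^esub>" for x
      using none k that by blast
    then show "k \<in> pullback F g ` ?Q"
      by (intro in_range_pullback[OF F_action Q V.is_group g k]) simp_all
  qed
  moreover have "finite ?Q"
    using finP sub inj_on_pullback[OF \<pi>] by (meson finite_imageD finite_subset)
  ultimately have "card ?F \<le> card ?Q" by (meson card_image_le card_mono finite_imageI le_trans)
  then show False using less le by linarith
qed

text \<open>
  Induction on the order of \<open>P\<close>, passing to the quotient by a minimal invariant central subgroup \<open>V0\<close>.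
\<close>
lemma equivariant_epi_exists:
  fixes P :: "nat set monoid" and S :: "((int, nat) module \<times> ('h \<Rightarrow> nat \<Rightarrow> nat)) set"
  assumes S: "simple_module_representatives (residue_ring (int p)) H S"
    and "finite_p_group p P" "automorphism_action H P \<psi>"
    and "\<And>V \<rho>. (V, \<rho>) \<in> S \<Longrightarrow>
      card (equivariant_homs H P (discrete_topology (carrier P)) \<psi> (add_monoid V) \<rho>)
      \<le> card (equivariant_homs H F T \<phi> (add_monoid V) \<rho>)"
  shows "\<exists>f. equivariant_epi H F T \<phi> P \<psi> f"
  using assms(2-4)
proof (induction "card (carrier P)" arbitrary: P \<psi> rule: less_induct)
  case less
  note P = less.prems(1,2) and le = less.prems(3)
  interpret P: automorphism_action H P \<psi> by fact
  have fin: "finite (carrier P)" using P(1) by (simp add: finite_p_group_def)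
  have topP: "topspace (discrete_topology (carrier P)) = carrier P" by simp
  show ?case
  proof (cases "carrier P = {\<one>\<^bsub>P\<^esub>}")
    case True
    have "restrict (\<lambda>_. \<one>\<^bsub>P\<^esub>) (carrier F) \<in> equivariant_homs H F T \<phi> P \<psi>"
      by (rule equivariant_homsI[OF F_action topspace_T]) (auto simp: P.act_G_one)
    moreover have "carrier P \<subseteq> restrict (\<lambda>_. \<one>\<^bsub>P\<^esub>) (carrier F) ` carrier F"
      unfolding True using F.G.one_closed by (auto intro!: image_eqI[of _ _ "\<one>\<^bsub>F\<^esub>"])
    ultimately show ?thesis by (intro exI) (rule equivariant_homs_surj_imp_epi)
  next
    case False
    obtain V0 where V0: "subgroup V0 P" "V0 \<noteq> {\<one>\<^bsub>P\<^esub>}" "\<And>h. h \<in> carrier H \<Longrightarrow> \<psi> h ` V0 \<subseteq> V0"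
      "\<And>v x. \<lbrakk>v \<in> V0; x \<in> carrier P\<rbrakk> \<Longrightarrow> v \<otimes>\<^bsub>P\<^esub> x = x \<otimes>\<^bsub>P\<^esub> v"
      "\<And>v. v \<in> V0 \<Longrightarrow> v [^]\<^bsub>P\<^esub> p = \<one>\<^bsub>P\<^esub>"
      "\<And>W. \<lbrakk>subgroup W P; W \<subseteq> V0; \<forall>h\<in>carrier H. \<psi> h ` W \<subseteq> W\<rbrakk> \<Longrightarrow> W = {\<one>\<^bsub>P\<^esub>} \<or> W = V0"
      by (rule minimal_invariant_central_subgroup[OF prime_p P(1) False P(2)]) (rule that)
    interpret V0: subgroup V0 P by fact
    have V0_comm: "v \<otimes>\<^bsub>P\<^esub> w = w \<otimes>\<^bsub>P\<^esub> v" if "v \<in> V0" "w \<in> V0" for v w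
      using that V0(4) by simp
    have normal: "V0 \<lhd> P"
    proof (rule P.G.normal_invI[OF V0(1)])
      fix x h assume "x \<in> carrier P" "h \<in> V0"
      then have "x \<otimes>\<^bsub>P\<^esub> h \<otimes>\<^bsub>P\<^esub> inv\<^bsub>P\<^esub> x = h" using V0(4)[of h x, symmetric] by (simp add: P.G.m_assoc)
      then show "x \<otimes>\<^bsub>P\<^esub> h \<otimes>\<^bsub>P\<^esub> inv\<^bsub>P\<^esub> x \<in> V0" using \<open>h \<in> V0\<close> by simp
    qed
    have inf: "infinite (UNIV :: nat set set)" by (simp add: Finite_Set.finite_set)
    obtain Q :: "nat set monoid" and \<psi>' \<pi> where Q: "automorphism_action H Q \<psi>'"
      and \<pi>: "\<pi> \<in> hom P Q" "\<pi> ` carrier P = carrier Q"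
      and ker: "\<And>x. x \<in> carrier P \<Longrightarrow> \<pi> x = \<one>\<^bsub>Q\<^esub> \<longleftrightarrow> x \<in> V0"
      and eq: "\<And>h x. \<lbrakk>h \<in> carrier H; x \<in> carrier P\<rbrakk> \<Longrightarrow> \<pi> (\<psi> h x) = \<psi>' h (\<pi> x)"
      by (rule finite_quotient_model[OF P(2) fin normal V0(3) inf]) (assumption, rule that)
    interpret Q: automorphism_action H Q \<psi>' by fact
    interpret \<pi>: group_hom P Q \<pi> using \<pi>(1) by unfold_locales
    have Qp: "finite_p_group p Q" using prime_p P(1) Q.G.is_group \<pi> by (rule finite_p_group_image)
    have \<pi>_epi: "equivariant_epi H P (discrete_topology (carrier P)) \<psi> Q \<psi>' \<pi>"
      using \<pi> eq by (auto simp: equivariant_epi_def continuous_homs_def)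
    obtain v0 where v0: "v0 \<in> V0" "v0 \<noteq> \<one>\<^bsub>P\<^esub>" using V0(2) V0.one_closed by blast
    have "\<not> inj_on \<pi> (carrier P)"
      using v0 ker[of v0] ker[of "\<one>\<^bsub>P\<^esub>"] by (metis P.G.one_closed V0.mem_carrier inj_onD \<pi>.hom_one)
    then have "card (carrier Q) < card (carrier P)"
      using fin \<pi>(2) by (metis card_image_le eq_card_imp_inj_on le_neq_implies_less)
    moreover have "card (equivariant_homs H Q (discrete_topology (carrier Q)) \<psi>' (add_monoid V) \<rho>)
      \<le> card (equivariant_homs H F T \<phi> (add_monoid V) \<rho>)" if V: "(V, \<rho>) \<in> S" for V \<rho>
    proof -
      have "finite (equivariant_homs H P (discrete_topology (carrier P)) \<psi> (add_monoid V) \<rho>)"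
        using simple_module_finite_p_group[OF prime_p finite_H representatives_simple(1)[OF S V]] fin
        by (intro equivariant_homs_finite_source) (auto simp: finite_p_group_def)
      from card_equivariant_homs_le[OF P(2) topP \<pi>_epi this] show ?thesis using le[OF V] by (rule le_trans)
    qed
    ultimately obtain g where g: "equivariant_epi H F T \<phi> Q \<psi>' g"
      using less.hyps[OF _ Qp Q] by blast
    have "\<exists>g'\<in>equivariant_homs H F T \<phi> P \<psi>. \<forall>x\<in>carrier F. \<pi> (g' x) = g x"
    proof (rule equivariant_lift[OF P Qp Q \<pi>_epi _ _ g])
      show "x \<otimes>\<^bsub>P\<^esub> y = y \<otimes>\<^bsub>P\<^esub> x"
        if "x \<in> carrier P" "\<pi> x = \<one>\<^bsub>Q\<^esub>" "y \<in> carrier P" for x y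
        using that ker V0(4) by blast
      show "x [^]\<^bsub>P\<^esub> p = \<one>\<^bsub>P\<^esub>" if "x \<in> carrier P" "\<pi> x = \<one>\<^bsub>Q\<^esub>" for x
        using that ker V0(5) by blast
    qed
    then obtain g' where g': "g' \<in> equivariant_homs H F T \<phi> P \<psi>"
      and \<pi>g': "\<And>x. x \<in> carrier F \<Longrightarrow> \<pi> (g' x) = g x" by blast
    note g'D = equivariant_homsD[OF g']
    interpret g': group_hom F P g' using g'D(1) by unfold_locales
    define Q0 where "Q0 = g' ` carrier F"
    have Q0: "subgroup Q0 P" unfolding Q0_def by (rule g'.img_is_subgroup)
    interpret Q0: subgroup Q0 P by (rule Q0)
    have Q0_inv: "\<psi> h ` Q0 \<subseteq> Q0" if h: "h \<in> carrier H" for h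
    proof
      fix y assume "y \<in> \<psi> h ` Q0"
      then obtain x where "x \<in> carrier F" "y = g' (\<phi> h x)" using g'D(4)[OF h] by (auto simp: Q0_def)
      then show "y \<in> Q0" using h by (simp add: Q0_def)
    qed
    have gen: "\<exists>a\<in>carrier F. \<exists>v\<in>V0. x = g' a \<otimes>\<^bsub>P\<^esub> v" if x: "x \<in> carrier P" for x
    proof -
      have "\<pi> x \<in> g ` carrier F" using x \<pi>(2) equivariant_epiD(3)[OF g] by auto
      then obtain a where a: "a \<in> carrier F" "\<pi> x = \<pi> (g' a)" using \<pi>g' by auto
      have "\<pi> (inv\<^bsub>P\<^esub> (g' a) \<otimes>\<^bsub>P\<^esub> x) = \<one>\<^bsub>Q\<^esub>"
        using a x by simp
      then have "inv\<^bsub>P\<^esub> (g' a) \<otimes>\<^bsub>P\<^esub> x \<in> V0"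
        using a(1) x ker[of "inv\<^bsub>P\<^esub> (g' a) \<otimes>\<^bsub>P\<^esub> x"] by simp
      moreover have "x = g' a \<otimes>\<^bsub>P\<^esub> (inv\<^bsub>P\<^esub> (g' a) \<otimes>\<^bsub>P\<^esub> x)"
        using a(1) x by (simp flip: P.G.m_assoc)
      ultimately show ?thesis using a(1) by blast
    qed
    have "subgroup (Q0 \<inter> V0) P" using Q0 V0(1) by (rule P.G.subgroups_Inter_pair)
    moreover have "\<forall>h\<in>carrier H. \<psi> h ` (Q0 \<inter> V0) \<subseteq> Q0 \<inter> V0"
      using Q0_inv V0(3) by blast
    ultimately consider "Q0 \<inter> V0 = V0" | "Q0 \<inter> V0 = {\<one>\<^bsub>P\<^esub>}"
      using V0(6)[of "Q0 \<inter> V0"] by blast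
    \<comment> \<open>Minimality of \<open>V0\<close> leaves two cases: the image \<open>Q0\<close> of the lift contains \<open>V0\<close>, or it is a complement of \<open>V0\<close>.\<close>
    then show ?thesis
    proof cases
      case 1
      have "carrier P \<subseteq> g' ` carrier F"
      proof
        fix x assume "x \<in> carrier P"
        then obtain a v where "a \<in> carrier F" "v \<in> V0" "x = g' a \<otimes>\<^bsub>P\<^esub> v" using gen by blast
        moreover have "v \<in> Q0" using 1 \<open>v \<in> V0\<close> by blast
        ultimately have "x \<in> Q0" by (auto simp: Q0_def intro!: Q0.m_closed[unfolded Q0_def])
        then show "x \<in> g' ` carrier F" by (simp add: Q0_def)
      qed
      then show ?thesis by (intro exI) (rule equivariant_homs_surj_imp_epi[OF g'])
    next
      case 2
      obtain V \<rho> j where V: "(V, \<rho>) \<in> S" and j: "bij_betw j V0 (carrier V)"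
        and jm: "\<And>x y. \<lbrakk>x \<in> V0; y \<in> V0\<rbrakk> \<Longrightarrow> j (x \<otimes>\<^bsub>P\<^esub> y) = j x \<oplus>\<^bsub>V\<^esub> j y"
        and je: "\<And>h x. \<lbrakk>h \<in> carrier H; x \<in> V0\<rbrakk> \<Longrightarrow> j (\<psi> h x) = \<rho> h (j x)"
        by (rule minimal_subgroup_representative[OF prime_p P(2) fin S V0(1,2,3) V0_comm V0(5,6)])
          (assumption | rule that)+
      have Vp: "finite_p_group p (add_monoid V)"
        by (rule simple_module_finite_p_group[OF prime_p finite_H representatives_simple(1)[OF S V]])
      have Va: "automorphism_action H (add_monoid V) \<rho>"
        by (rule module_imp_action[OF representatives_simple(2)[OF S V]])
      interpret V: automorphism_action H "add_monoid V" \<rho> by (rule Va)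
      have jV: "j v \<in> carrier V" if "v \<in> V0" for v using j that by (auto simp: bij_betw_def)
      have j1: "j \<one>\<^bsub>P\<^esub> = \<zero>\<^bsub>V\<^esub>"
        using jm[of "\<one>\<^bsub>P\<^esub>" "\<one>\<^bsub>P\<^esub>"] jV[of "\<one>\<^bsub>P\<^esub>"] V.G.r_cancel_one'[of "j \<one>\<^bsub>P\<^esub>" "j \<one>\<^bsub>P\<^esub>"] by simp
      have j_inj: "j v = j w \<longleftrightarrow> v = w" if "v \<in> V0" "w \<in> V0" for v w
        using j that by (auto simp: bij_betw_def inj_on_def)
      have gen': "\<exists>q\<in>Q0. \<exists>v\<in>V0. x = q \<otimes>\<^bsub>P\<^esub> v" if "x \<in> carrier P" for x
        using gen[OF that] by (auto simp: Q0_def)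
      have "\<exists>k \<in> equivariant_homs H P (discrete_topology (carrier P)) \<psi> (add_monoid V) \<rho>. \<forall>v\<in>V0. k v = j v"
        using complement_projection[OF P(2) Q0 Q0_inv V0(1,3,4) gen' 2, of j "add_monoid V" \<rho>] jV jm je
        by simp
      then obtain k0 where k0: "k0 \<in> equivariant_homs H P (discrete_topology (carrier P)) \<psi> (add_monoid V) \<rho>"
        "k0 v0 = j v0" using v0(1) by blast
      have k0_v0: "k0 v0 \<noteq> \<zero>\<^bsub>V\<^esub>" using k0(2) j1 j_inj[OF v0(1) V0.one_closed] v0(2) by simp
      have "\<pi> v0 = \<one>\<^bsub>Q\<^esub>" using ker[of v0] v0(1) by simp
      from exists_hom_nontrivial_on_kernel[OF P Q \<pi>_epi g Vp Va le[OF V] k0(1) V0.mem_carrier[OF v0(1)] this k0_v0]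
      obtain k y0 where k: "k \<in> equivariant_homs H F T \<phi> (add_monoid V) \<rho>"
        and y0: "y0 \<in> carrier F" "g y0 = \<one>\<^bsub>Q\<^esub>" "k y0 \<noteq> \<zero>\<^bsub>V\<^esub>"
        by blast
      note kD = equivariant_homsD[OF k, simplified]
      define k' where "k' = (\<lambda>x\<in>carrier F. inv_into V0 j (k x))"
      have k': "k' x \<in> V0" "j (k' x) = k x" if "x \<in> carrier F" for x
        using kD(5)[OF that] j that
        by (auto simp: k'_def bij_betw_def inv_into_into f_inv_into_f)
      have k'm: "k' (x \<otimes>\<^bsub>F\<^esub> y) = k' x \<otimes>\<^bsub>P\<^esub> k' y" if "x \<in> carrier F" "y \<in> carrier F" for x y
        using that k' by (intro j_inj[THEN iffD1]) (simp_all add: jm kD(6))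
      have k'e: "k' (\<phi> h x) = \<psi> h (k' x)" if hx: "h \<in> carrier H" "x \<in> carrier F" for h x
      proof -
        have "\<psi> h (k' x) \<in> V0" using k'(1)[OF hx(2)] V0(3)[OF hx(1)] by blast
        then show ?thesis using hx k' by (intro j_inj[THEN iffD1]) (simp_all add: je kD(4))
      qed
      have k'_hom: "k' \<in> equivariant_homs H F T \<phi> (P\<lparr>carrier := V0\<rparr>) \<psi>"
      proof -
        have "continuous_map T (discrete_topology V0) k'"
          by (rule continuous_map_determined_by_one[OF kD(2)])
            (use k' in \<open>auto simp: topspace_T k'_def\<close>)
        then show ?thesis
          using k'(1) k'm k'e by (auto simp: equivariant_homs_def hom_def k'_def)
      qed
      \<comment> \<open>The lift \<open>g'\<close> has the same kernel as \<open>g\<close>, because its image meets \<open>V0\<close> trivially.\<close>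
      have ker_g: "g' y = \<one>\<^bsub>P\<^esub>" if "y \<in> carrier F" "g y = \<one>\<^bsub>Q\<^esub>" for y
      proof -
        have "g' y \<in> V0" using that \<pi>g'[of y] ker[of "g' y"] by simp
        then show ?thesis using 2 that by (auto simp: Q0_def)
      qed
      \<comment> \<open>The image under \<open>k'\<close> of the common kernel is invariant and not trivial, hence all of \<open>V0\<close>.\<close>
      define W where "W = k' ` kernel F P g'"
      interpret k': group_hom F P k'
        using k'(1) k'm by unfold_locales (auto simp: hom_def)
      have "subgroup W P"
        unfolding W_def by (rule k'.subgroup_img_is_subgroup[OF g'.subgroup_kernel])
      moreover have "W \<subseteq> V0" using k'(1) by (auto simp: W_def kernel_def)
      moreover have "\<forall>h\<in>carrier H. \<psi> h ` W \<subseteq> W"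
      proof (intro ballI subsetI)
        fix h w assume h: "h \<in> carrier H"
        assume "w \<in> \<psi> h ` W"
        then obtain y where y: "y \<in> carrier F" "g' y = \<one>\<^bsub>P\<^esub>" "w = \<psi> h (k' y)"
          by (auto simp: W_def kernel_def)
        then have "\<phi> h y \<in> kernel F P g'" using h g'D(4)[OF h] by (simp add: kernel_def P.act_G_one)
        then show "w \<in> W" unfolding W_def using y h by (intro image_eqI[of _ _ "\<phi> h y"]) (simp_all add: k'e)
      qed
      ultimately have "W = {\<one>\<^bsub>P\<^esub>} \<or> W = V0" by (rule V0(6))
      moreover have "k' y0 \<in> W" using y0 ker_g by (auto simp: W_def kernel_def)
      moreover have "k' y0 \<noteq> \<one>\<^bsub>P\<^esub>" using k'(2)[OF y0(1)] y0(3) j1 by auto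
      ultimately have "W = V0" by auto
      then have ker_onto: "\<exists>y\<in>carrier F. g' y = \<one>\<^bsub>P\<^esub> \<and> k' y = v" if "v \<in> V0" for v
        using that unfolding W_def kernel_def by blast
      show ?thesis
        by (rule epi_by_central_correction[OF P(2) g' k'_hom V0(1,4) gen ker_onto])
    qed
  qed
qed

end

theorem proposition4p2:
  fixes p \<gamma> :: nat
    and H :: "'h monoid"
    and F :: "'f monoid" and T :: "'f topology" and \<phi> :: "'h \<Rightarrow> 'f \<Rightarrow> 'f"
    and P :: "'a monoid" and \<psi> :: "'h \<Rightarrow> 'a \<Rightarrow> 'a"
    and S :: "((int, nat) module \<times> ('h \<Rightarrow> nat \<Rightarrow> nat)) set"
  assumes "prime p"
    and "group H" and "finite (carrier H)" and "coprime (card (carrier H)) p"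
    and "free_pro_p_group p \<gamma> F T"
    and "acts_by_automorphisms H F \<phi>" and "continuous_action H T \<phi>"
    and "group P" and "finite (carrier P)" and "\<exists>n. card (carrier P) = p ^ n"
    and "acts_by_automorphisms H P \<psi>"
    and "simple_module_representatives (residue_ring (int p)) H S"
  shows "(\<exists>f \<in> continuous_homs F T P (discrete_topology (carrier P)).
            f ` carrier F = carrier P \<and>
            (\<forall>h \<in> carrier H. \<forall>x \<in> carrier F. f (\<phi> h x) = \<psi> h (f x)))
     \<longleftrightarrow>
     (\<forall>(V, \<rho>) \<in> S.
        dim_H1_semidirect (residue_ring (int p)) P (discrete_topology (carrier P)) H \<psi> V \<rho>
          \<le> dim_H1_semidirect (residue_ring (int p)) F T H \<phi> V \<rho>)"
proof -
  let ?K = "residue_ring (int p)" and ?D = "discrete_topology (carrier P)"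
  have "group F"
    using assms(5) by (auto simp: free_pro_p_group_def pro_p_group_def topological_group_def)
  then have F: "automorphism_action H F \<phi>" using assms(2,6) by (intro acts_by_automorphisms_imp_action)
  interpret free_pro_p_action p \<gamma> H F T \<phi>
    by (rule free_pro_p_action.intro[OF assms(1,3,4,5) F assms(7)])
  have P: "automorphism_action H P \<psi>" using assms(2,8,11) by (intro acts_by_automorphisms_imp_action)
  interpret P: automorphism_action H P \<psi> by (rule P)
  have Pp: "finite_p_group p P" using assms(8,9,10) by (simp add: finite_p_group_def)
  have topP: "topspace ?D = carrier P" by simp
  have finite_F: "finite (equivariant_homs H F T \<phi> (add_monoid V) \<rho>)"
    and finite_P: "finite (equivariant_homs H P ?D \<psi> (add_monoid V) \<rho>)"
    and dim_le_iff: "dim_H1_semidirect ?K P ?D H \<psi> V \<rho> \<le> dim_H1_semidirect ?K F T H \<phi> V \<rho> \<longleftrightarrow>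
      card (equivariant_homs H P ?D \<psi> (add_monoid V) \<rho>) \<le> card (equivariant_homs H F T \<phi> (add_monoid V) \<rho>)"
    if V: "(V, \<rho>) \<in> S" for V \<rho>
  proof -
    note simple = representatives_simple[OF assms(12) V]
    have Vp: "finite_p_group p (add_monoid V)"
      by (rule simple_module_finite_p_group[OF assms(1,3) simple(1)])
    show F': "finite (equivariant_homs H F T \<phi> (add_monoid V) \<rho>)"
      using Vp module_imp_action[OF simple(2)] by (rule finite_equivariant_homs)
    show P': "finite (equivariant_homs H P ?D \<psi> (add_monoid V) \<rho>)"
      using assms(9) Vp by (intro equivariant_homs_finite_source) (auto simp: finite_p_group_def)
    have "p > 1" using assms(1) prime_gt_1_nat by blast
    then show "dim_H1_semidirect ?K P ?D H \<psi> V \<rho> \<le> dim_H1_semidirect ?K F T H \<phi> V \<rho> \<longleftrightarrow>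
      card (equivariant_homs H P ?D \<psi> (add_monoid V) \<rho>) \<le> card (equivariant_homs H F T \<phi> (add_monoid V) \<rho>)"
      using card_equivariant_homs[OF assms(1,4) F topspace_T simple(2) F']
        card_equivariant_homs[OF assms(1,4) P topP simple(2) P'] by simp
  qed
  have "(\<exists>f. equivariant_epi H F T \<phi> P \<psi> f) \<longleftrightarrow>
    (\<forall>(V, \<rho>) \<in> S. dim_H1_semidirect ?K P ?D H \<psi> V \<rho> \<le> dim_H1_semidirect ?K F T H \<phi> V \<rho>)"
  proof
    assume "\<exists>f. equivariant_epi H F T \<phi> P \<psi> f"
    then obtain f where f: "equivariant_epi H F T \<phi> P \<psi> f" ..
    show "\<forall>(V, \<rho>) \<in> S. dim_H1_semidirect ?K P ?D H \<psi> V \<rho> \<le> dim_H1_semidirect ?K F T H \<phi> V \<rho>"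
      using card_equivariant_homs_le[OF F topspace_T f finite_F] dim_le_iff by auto
  next
    assume le: "\<forall>(V, \<rho>) \<in> S. dim_H1_semidirect ?K P ?D H \<psi> V \<rho> \<le> dim_H1_semidirect ?K F T H \<phi> V \<rho>"
    \<comment> \<open>\<open>Q\<close> is a copy of \<open>P\<close> on the type for which freeness is stated.\<close>
    have inv: "\<psi> h ` {\<one>\<^bsub>P\<^esub>} \<subseteq> {\<one>\<^bsub>P\<^esub>}" if "h \<in> carrier H" for h
      using that P.act_G_one by simp
    have inf: "infinite (UNIV :: nat set set)" by (simp add: Finite_Set.finite_set)
    obtain Q :: "nat set monoid" and \<psi>' \<pi> where Q: "automorphism_action H Q \<psi>'"
      and \<pi>: "\<pi> \<in> hom P Q" "\<pi> ` carrier P = carrier Q"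
      and ker: "\<And>x. x \<in> carrier P \<Longrightarrow> \<pi> x = \<one>\<^bsub>Q\<^esub> \<longleftrightarrow> x \<in> {\<one>\<^bsub>P\<^esub>}"
      and eq: "\<And>h x. \<lbrakk>h \<in> carrier H; x \<in> carrier P\<rbrakk> \<Longrightarrow> \<pi> (\<psi> h x) = \<psi>' h (\<pi> x)"
      by (rule finite_quotient_model[OF P assms(9) P.G.one_is_normal inv inf]) (assumption, rule that)
    interpret Q: automorphism_action H Q \<psi>' by fact
    interpret \<pi>: group_hom P Q \<pi> using \<pi>(1) by unfold_locales
    have \<pi>_epi: "equivariant_epi H P ?D \<psi> Q \<psi>' \<pi>"
      using \<pi> eq by (auto simp: equivariant_epi_def continuous_homs_def)
    have bij: "bij_betw \<pi> (carrier P) (carrier Q)"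
      using \<pi>(2) \<pi>.inj_on_one_iff ker by (auto simp: bij_betw_def)
    have "\<exists>f. equivariant_epi H F T \<phi> Q \<psi>' f"
    proof (rule equivariant_epi_exists[OF assms(12) _ Q])
      show "finite_p_group p Q" using assms(1) Pp Q.G.is_group \<pi> by (rule finite_p_group_image)
      fix V \<rho> assume V: "(V, \<rho>) \<in> S"
      have "card (equivariant_homs H P ?D \<psi> (add_monoid V) \<rho>) \<le> card (equivariant_homs H F T \<phi> (add_monoid V) \<rho>)"
        using le V dim_le_iff[OF V] by auto
      with card_equivariant_homs_le[OF P topP \<pi>_epi finite_P[OF V]]
      show "card (equivariant_homs H Q (discrete_topology (carrier Q)) \<psi>' (add_monoid V) \<rho>)
        \<le> card (equivariant_homs H F T \<phi> (add_monoid V) \<rho>)" by (rule le_trans)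
    qed
    then obtain f where f: "equivariant_epi H F T \<phi> Q \<psi>' f" ..
    note fD = equivariant_epiD[OF f]
    define f' where "f' x = inv_into (carrier P) \<pi> (f x)" for x
    have f': "f' x \<in> carrier P" "\<pi> (f' x) = f x" if "x \<in> carrier F" for x
      using fD(5)[OF that] \<pi>(2) by (auto simp: f'_def inv_into_into f_inv_into_f)
    have inj: "x = y" if "\<pi> x = \<pi> y" "x \<in> carrier P" "y \<in> carrier P" for x y
      using bij that by (auto simp: bij_betw_def inj_on_def)
    have "restrict f' (carrier F) \<in> equivariant_homs H F T \<phi> P \<psi>"
    proof (rule equivariant_homsI[OF F topspace_T f'(1)])
      show "f' (x \<otimes>\<^bsub>F\<^esub> y) = f' x \<otimes>\<^bsub>P\<^esub> f' y" if "x \<in> carrier F" "y \<in> carrier F" for x y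
        by (rule inj) (use that f' fD(6) in simp_all)
      show "f' (\<phi> h x) = \<psi> h (f' x)" if "h \<in> carrier H" "x \<in> carrier F" for h x
        by (rule inj) (use that f' fD(4) eq in simp_all)
      show "continuous_map T ?D f'"
      proof (rule continuous_map_determined_by_one[OF fD(2)])
        show "f' \<in> topspace T \<rightarrow> carrier P" using f'(1) by (auto simp: topspace_T)
      qed (simp add: f'_def)
    qed
    moreover have "carrier P \<subseteq> restrict f' (carrier F) ` carrier F"
    proof
      fix x assume x: "x \<in> carrier P"
      then obtain a where a: "a \<in> carrier F" "f a = \<pi> x" using \<pi>(2) fD(3) by (metis imageE imageI)
      then have "f' a = x" using x f'[OF a(1)] by (intro inj) simp_all
      then show "x \<in> restrict f' (carrier F) ` carrier F" using a(1) by (intro image_eqI[of _ _ a]) simp_all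
    qed
    ultimately show "\<exists>f. equivariant_epi H F T \<phi> P \<psi> f"
      by (intro exI) (rule equivariant_homs_surj_imp_epi)
  qed
  then show ?thesis unfolding equivariant_epi_def by blast
qed

end
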